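(* Let $\mathcal{S}=\mathcal{G}\times S$ be a slab and fix a real number $q\ge 1$. There exists $p_c=p_c(\mathcal{S})\in[0,1]$ such that: (1) for every $p\in[0,1]$ with $p<p_c$ there exists $c=c(p,\mathcal{S})>0$ such that for any vertices $x,y$ of $\mathcal{S}$, $$\phi^1_{p,q,\mathcal{S}}\big[x\text{ and }y\text{ are connected by a path of open edges}\big]\le \exp(-c|x-y|);$$ (2) for every $p\in[0,1]$ with $p>p_c$, there exists $\phi^0_{p,q,\mathcal{S}}$-almost surely an infinite open cluster.
   Context: Slab: $\mathcal{G}=(V_{\mathcal{G}},E_{\mathcal{G}})$ is a connected, locally finite planar graph, (properly) embedded in $\mathbb{R}^2$, invariant under the translations by $(1,0)$ and $(0,1)$, under reflection with respect to the line $\{(0,y):y\in\mathbb{R}\}$, and under rotation by $\pi/2$ around $0$. $S=(V_S,E_S)$ is a finite connected graph. $\mathcal{S}=\mathcal{G}\times S$ has vertex set $V_{\mathcal{G}}\times V_S$, with $(u,v)$ and $(u',v')$ adjacent if either $u=u'$ and $\{v,v'\}\in E_S$, or $\{u,u'\}\in E_{\mathcal{G}}$ and $v=v'$. $|x-y|$ is the graph distance in $\mathcal{S}$. Random-cluster model: for a finite graph $G=(V_G,E_G)$, $p\in[0,1]$, $q>0$, the random-cluster measure on $\{0,1\}^{E_G}$ is $$\phi_{p,q,G}(\omega)=\frac{p^{o(\omega)}(1-p)^{c(\omega)}q^{k(\omega)}}{Z(p,q,G)},$$ where $o(\omega)$, $c(\omega)$, $k(\omega)$ are the numbers of open edges ($\omega(e)=1$),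 closed edges ($\omega(e)=0$), and clusters (connected components of the graph $(V_G,\{e:\omega(e)=1\})$), and $Z$ is the normalising constant. For $q\ge1$, the free infinite-volume measure $\phi^0_{p,q,\mathcal{S}}$ is the weak limit of $\phi_{p,q,G_n}$ along an increasing sequence of finite subgraphs $G_n$ exhausting $\mathcal{S}$; the wired infinite-volume measure $\phi^1_{p,q,\mathcal{S}}$ is the weak limit of the analogous measures on $G_n$ where all clusters touching the boundary of $G_n$ (vertices of $G_n$ with a neighbour in $\mathcal{S}$ outside $G_n$) are counted as a single cluster in $k(\omega)$. *)

theory Defs
  imports "HOL-Probability.Probability"
begin

section \<open>Graphs\<close>

datatype 'a graph = Graph (verts: "'a set") (edges: "'a set set")

definition simple_graph :: "'a graph \<Rightarrow> bool" where
  "simple_graph G \<longleftrightarrow> (\<forall>e\<in>edges G. e \<subseteq> verts G \<and> card e = 2)"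

definition finite_graph :: "'a graph \<Rightarrow> bool" where
  "finite_graph G \<longleftrightarrow> simple_graph G \<and> finite (verts G)"

definition locally_finite :: "'a graph \<Rightarrow> bool" where
  "locally_finite G \<longleftrightarrow> (\<forall>v\<in>verts G. finite {e\<in>edges G. v \<in> e})"

definition adj :: "'a set set \<Rightarrow> ('a \<times> 'a) set" where
  "adj F = {(x, y). {x, y} \<in> F}"

definition connected_graph :: "'a graph \<Rightarrow> bool" where
  "connected_graph G \<longleftrightarrow>
     verts G \<noteq> {} \<and> (\<forall>x\<in>verts G. \<forall>y\<in>verts G. (x, y) \<in> (adj (edges G))\<^sup>*)"

definition graph_dist :: "'a graph \<Rightarrow> 'a \<Rightarrow> 'a \<Rightarrow> nat" where
  "graph_dist G x y = (LEAST n. (x, y) \<in> adj (edges G) ^^ n)"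

definition subgraph :: "'a graph \<Rightarrow> 'a graph \<Rightarrow> bool" where
  "subgraph H G \<longleftrightarrow> verts H \<subseteq> verts G \<and> edges H \<subseteq> edges G"

definition induced_subgraph :: "'a graph \<Rightarrow> 'a graph \<Rightarrow> bool" where
  "induced_subgraph H G \<longleftrightarrow>
     verts H \<subseteq> verts G \<and> edges H = {e\<in>edges G. e \<subseteq> verts H}"

definition exhausts :: "(nat \<Rightarrow> 'a graph) \<Rightarrow> 'a graph \<Rightarrow> bool" where
  "exhausts H G \<longleftrightarrow>
     (\<forall>n. finite_graph (H n) \<and> subgraph (H n) (H (Suc n))) \<and>
     (\<Union>n. verts (H n)) = verts G \<and> (\<Union>n. edges (H n)) = edges G"

definition boundary :: "'a graph \<Rightarrow> 'a graph \<Rightarrow> 'a set" where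
  "boundary G H = {v\<in>verts H. \<exists>u\<in>verts G - verts H. {u, v} \<in> edges G}"


section \<open>Planar lattices and slabs\<close>

text \<open>The vertices are points of the plane and \<open>\<gamma> e\<close> is the curve representing the edge \<open>e\<close>.
  The last two conditions say that the embedding is proper.\<close>

definition properly_embedded ::
  "(real \<times> real) graph \<Rightarrow> ((real \<times> real) set \<Rightarrow> (real \<times> real) set) \<Rightarrow> bool" where
  "properly_embedded G \<gamma> \<longleftrightarrow>
     (\<forall>e\<in>edges G. \<exists>g. arc g \<and> {pathstart g, pathfinish g} = e \<and> path_image g = \<gamma> e) \<and>
     (\<forall>e\<in>edges G. \<gamma> e \<inter> verts G = e) \<and>
     (\<forall>e\<in>edges G. \<forall>e'\<in>edges G. e \<noteq> e' \<longrightarrow> \<gamma> e \<inter> \<gamma> e' = e \<inter> e') \<and>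
     (\<forall>K. compact K \<longrightarrow> finite (verts G \<inter> K)) \<and>
     (\<forall>K. compact K \<longrightarrow> finite {e\<in>edges G. \<gamma> e \<inter> K \<noteq> {}})"

definition invariant_under ::
  "(real \<times> real \<Rightarrow> real \<times> real) \<Rightarrow> (real \<times> real) graph
     \<Rightarrow> ((real \<times> real) set \<Rightarrow> (real \<times> real) set) \<Rightarrow> bool" where
  "invariant_under T G \<gamma> \<longleftrightarrow>
     T ` verts G = verts G \<and> (\<lambda>e. T ` e) ` edges G = edges G \<and>
     (\<forall>e\<in>edges G. \<gamma> (T ` e) = T ` \<gamma> e)"

definition planar_lattice ::
  "(real \<times> real) graph \<Rightarrow> ((real \<times> real) set \<Rightarrow> (real \<times> real) set) \<Rightarrow> bool" where
  "planar_lattice G \<gamma> \<longleftrightarrow>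
     simple_graph G \<and> connected_graph G \<and> locally_finite G \<and> properly_embedded G \<gamma> \<and>
     invariant_under (\<lambda>(x, y). (x + 1, y)) G \<gamma> \<and>
     invariant_under (\<lambda>(x, y). (x, y + 1)) G \<gamma> \<and>
     invariant_under (\<lambda>(x, y). (- x, y)) G \<gamma> \<and>
     invariant_under (\<lambda>(x, y). (- y, x)) G \<gamma>"

definition slab :: "'a graph \<Rightarrow> 'b graph \<Rightarrow> ('a \<times> 'b) graph" where
  "slab G S = Graph (verts G \<times> verts S)
     ({{(u, v), (u, v')} | u v v'. u \<in> verts G \<and> {v, v'} \<in> edges S} \<union>
      {{(u, v), (u', v)} | u u' v. {u, u'} \<in> edges G \<and> v \<in> verts S})"


section \<open>Finite-volume random-cluster measures\<close>

text \<open>A configuration is a function from edges to \<^typ>\<open>bool\<close>, with \<^const>\<open>True\<close> meaning open.\<close>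

definition open_edges :: "'a graph \<Rightarrow> ('a set \<Rightarrow> bool) \<Rightarrow> 'a set set" where
  "open_edges G \<omega> = {e\<in>edges G. \<omega> e}"

definition joined :: "'a graph \<Rightarrow> ('a set \<Rightarrow> bool) \<Rightarrow> 'a \<Rightarrow> 'a \<Rightarrow> bool" where
  "joined G \<omega> x y \<longleftrightarrow> (x, y) \<in> (adj (open_edges G \<omega>))\<^sup>*"

definition clusters :: "'a graph \<Rightarrow> ('a set \<Rightarrow> bool) \<Rightarrow> 'a set set" where
  "clusters G \<omega> = verts G // {(x, y). x \<in> verts G \<and> y \<in> verts G \<and> joined G \<omega> x y}"

definition free_count :: "'a graph \<Rightarrow> ('a set \<Rightarrow> bool) \<Rightarrow> nat" where
  "free_count H \<omega> = card (clusters H \<omega>)"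

text \<open>All the clusters meeting \<open>B\<close> together contribute one to the count.\<close>

definition wired_count :: "'a set \<Rightarrow> 'a graph \<Rightarrow> ('a set \<Rightarrow> bool) \<Rightarrow> nat" where
  "wired_count B H \<omega> =
     card {C\<in>clusters H \<omega>. C \<inter> B = {}} + (if \<exists>C\<in>clusters H \<omega>. C \<inter> B \<noteq> {} then 1 else 0)"

definition rc_weight ::
  "real \<Rightarrow> real \<Rightarrow> 'a graph \<Rightarrow> (('a set \<Rightarrow> bool) \<Rightarrow> nat) \<Rightarrow> ('a set \<Rightarrow> bool) \<Rightarrow> real" where
  "rc_weight p q H k \<omega> =
     p ^ card {e\<in>edges H. \<omega> e} * (1 - p) ^ card {e\<in>edges H. \<not> \<omega> e} * q ^ k \<omega>"

definition rc_measure ::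
  "real \<Rightarrow> real \<Rightarrow> 'a graph \<Rightarrow> (('a set \<Rightarrow> bool) \<Rightarrow> nat) \<Rightarrow> ('a set \<Rightarrow> bool) measure" where
  "rc_measure p q H k =
     (let \<Omega> = edges H \<rightarrow>\<^sub>E UNIV; Z = (\<Sum>\<omega>\<in>\<Omega>. rc_weight p q H k \<omega>)
      in point_measure \<Omega> (\<lambda>\<omega>. ennreal (rc_weight p q H k \<omega> / Z)))"

definition free_finite :: "real \<Rightarrow> real \<Rightarrow> 'a graph \<Rightarrow> ('a set \<Rightarrow> bool) measure" where
  "free_finite p q H = rc_measure p q H (free_count H)"

definition wired_finite :: "real \<Rightarrow> real \<Rightarrow> 'a graph \<Rightarrow> 'a graph \<Rightarrow> ('a set \<Rightarrow> bool) measure" where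
  "wired_finite p q G H = rc_measure p q H (wired_count (boundary G H) H)"


section \<open>Infinite-volume measures\<close>

definition config_space :: "'a graph \<Rightarrow> ('a set \<Rightarrow> bool) measure" where
  "config_space G = PiM (edges G) (\<lambda>_. count_space UNIV)"

definition config_topology :: "'a graph \<Rightarrow> ('a set \<Rightarrow> bool) topology" where
  "config_topology G = product_topology (\<lambda>_. discrete_topology UNIV) (edges G)"

text \<open>To speak of weak convergence, a measure on configurations of a finite subgraph \<open>H\<close> of \<open>G\<close>
  is regarded as a measure on configurations of \<open>G\<close> by declaring the edges outside \<open>H\<close> closed.
  Every local event is eventually unaffected by this choice.\<close>

definition extend_measure_closed ::
  "'a graph \<Rightarrow> 'a graph \<Rightarrow> ('a set \<Rightarrow> bool) measure \<Rightarrow> ('a set \<Rightarrow> bool) measure" where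
  "extend_measure_closed G H M =
     distr M (config_space G) (\<lambda>\<omega>. restrict (\<lambda>e. e \<in> edges H \<and> \<omega> e) (edges G))"

definition weakly_converges ::
  "'c topology \<Rightarrow> (nat \<Rightarrow> 'c measure) \<Rightarrow> 'c measure \<Rightarrow> bool" where
  "weakly_converges X M N \<longleftrightarrow>
     (\<forall>f. continuous_map X euclideanreal f \<and> bounded (f ` topspace X) \<longrightarrow>
          (\<lambda>n. integral\<^sup>L (M n) f) \<longlonglongrightarrow> integral\<^sup>L N f)"

definition free_rc :: "real \<Rightarrow> real \<Rightarrow> 'a graph \<Rightarrow> ('a set \<Rightarrow> bool) measure" where
  "free_rc p q G = (THE \<mu>.
     prob_space \<mu> \<and> sets \<mu> = sets (config_space G) \<and>
     (\<forall>H. exhausts H G \<longrightarrow>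
        weakly_converges (config_topology G)
          (\<lambda>n. extend_measure_closed G (H n) (free_finite p q (H n))) \<mu>))"

text \<open>For wired boundary conditions the approximating subgraphs are induced ones. The boundary
  only sees vertices outside \<open>H n\<close>; if edges between vertices of \<open>H n\<close> could be missing, the limit
  would depend on the sequence (deleting all edges near the boundary gives the free measure).\<close>

definition wired_rc :: "real \<Rightarrow> real \<Rightarrow> 'a graph \<Rightarrow> ('a set \<Rightarrow> bool) measure" where
  "wired_rc p q G = (THE \<mu>.
     prob_space \<mu> \<and> sets \<mu> = sets (config_space G) \<and>
     (\<forall>H. exhausts H G \<and> (\<forall>n. induced_subgraph (H n) G) \<longrightarrow>
        weakly_converges (config_topology G)
          (\<lambda>n. extend_measure_closed G (H n) (wired_finite p q G (H n))) \<mu>))"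

end

theory Submission
  imports Defs "HOL-Real_Asymp.Real_Asymp"
begin

text \<open>The OSSS inequality bounds the variance of a function by the sum over coordinates of the revealment
  by a decision tree times the covariance with the coordinate; it holds for measures satisfying the FKG
  lattice condition. Applied to the event that a vertex is connected to distance \<open>n\<close> and to the
  explorations of the clusters of the spheres of radius \<open>1, \<dots>, n\<close>, it shows that the connection
  probabilities \<open>\<theta> n\<close> in wired balls satisfy \<open>\<theta>' n \<ge> c n \<theta> n / (\<Sum>i<n. \<theta> i)\<close>.
  By the argument of Duminil-Copin, Raoufi and Tassion, such a family decays exponentially below
  the point where it ceases to be summable, and does not tend to zero above it.

  To pass from wired to free boundary conditions above the critical point, note that the two free
  energies on a box differ by a boundary term. By convexity the wired density of open edges is
  at most the free density at any larger parameter, so the two measures coincide at every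
  continuity point of the free density. Finally, on the event \<open>N\<close> that all clusters are finite, which does
  not depend on the edges in any finite set, a decreasing local event has conditional probability at
  most its unconditional one. Applied to the events that a vertex \<open>u\<close> is not connected to distance
  \<open>m\<close>, which exhaust \<open>N\<close>, this gives \<open>P N \<le> (1 - L) * P N\<close>, where \<open>L > 0\<close> bounds the
  connection probabilities of \<open>u\<close> from below.\<close>

section \<open>Correlation inequalities on finite power sets\<close>

text \<open>Edge states are dependent, so OSSS cannot be obtained by resampling coordinates
  independently. The substitute is a pair of configurations driven by common uniform variables along
  the tree. Strong positive association keeps ordered configurations ordered and makes conditional
  covariances decrease on average as edges are revealed. The graph is only quasi-transitive: arm
  probabilities depend on the base vertex and revealments involve arms from other vertices, so the
  inequality closes only after summing over a fundamental domain. The derivative is taken in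
  \<open>ln (p / (1 - p))\<close>, a coordinate that misses \<open>p = 0\<close> and
  \<open>p = 1\<close>; these are reached by monotonicity from interior parameters. The boundary
  term in the comparison of free energies is negligible because a box of side \<open>N\<close> has
  volume of order \<open>N ^ 2\<close> and boundary of order \<open>N\<close>. The infinite-volume
  measures are definite descriptions over all exhaustions, so a common limit must be constructed
  before anything can be said about them. The closing inequality for \<open>P N\<close> stands in
  for ergodicity or a zero-one law.\<close>

lemma four_functions_two_point:
  fixes a0 a1 b0 b1 c0 c1 d0 d1 :: real
  assumes nonneg: "0 \<le> a0" "0 \<le> a1" "0 \<le> b0" "0 \<le> b1" "0 \<le> c0" "0 \<le> c1" "0 \<le> d0" "0 \<le> d1"
    and "a0 * b0 \<le> c0 * d0" "a0 * b1 \<le> c1 * d0" "a1 * b0 \<le> c1 * d0" "a1 * b1 \<le> c1 * d1"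
  shows "(a0 + a1) * (b0 + b1) \<le> (c0 + c1) * (d0 + d1)"
proof -
  \<comment> \<open>The unmixed products \<open>a0 * b0\<close> and \<open>a1 * b1\<close> are
    compared directly with \<open>c0 * d0\<close> and \<open>c1 * d1\<close>. What remains is
    \<open>x + y \<le> u + v\<close> from \<open>x, y \<le> u\<close> and
    \<open>x * y \<le> u * v\<close>, which follows from
    \<open>0 \<le> (u - x) * (u - y)\<close>.\<close>
  define x y u v where "x = a0 * b1" and "y = a1 * b0" and "u = c1 * d0" and "v = c0 * d1"
  have xyuv: "x \<le> u" "y \<le> u" "0 \<le> x" "0 \<le> y" "0 \<le> u" "0 \<le> v"
    using assms by (auto simp: x_def y_def u_def v_def)
  have "x * y = (a0 * b0) * (a1 * b1)" by (simp add: x_def y_def)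
  also have "\<dots> \<le> (c0 * d0) * (c1 * d1)" by (rule mult_mono) (use assms in auto)
  finally have xy: "x * y \<le> u * v" by (simp add: u_def v_def mult_ac)
  have "x + y \<le> u + v"
  proof (cases "u = 0")
    case False
    have "0 \<le> (u - x) * (u - y)" using xyuv by simp
    then have "u * (x + y) \<le> u * (u + v)" using xy by (simp add: algebra_simps)
    then show ?thesis using False xyuv by simp
  qed (use xyuv in auto)
  then show ?thesis using assms by (simp add: algebra_simps x_def y_def u_def v_def)
qed

lemma sum_Pow_insert:
  fixes f :: "'e set \<Rightarrow> real"
  assumes "finite E" "e \<notin> E"
  shows "sum f (Pow (insert e E)) = (\<Sum>A\<in>Pow E. f A + f (insert e A))"
proof -
  have "sum f (Pow (insert e E)) = sum f (Pow E) + sum f (insert e ` Pow E)"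
    unfolding Pow_insert using assms by (intro sum.union_disjoint) auto
  also have "sum f (insert e ` Pow E) = (\<Sum>A\<in>Pow E. f (insert e A))"
    using assms by (subst sum.reindex) (auto simp: inj_on_def)
  finally show ?thesis by (simp add: sum.distrib)
qed

text \<open>The Ahlswede-Daykin inequality. Summing each function over the state of one element
  \<open>e\<close> leaves four functions on the smaller ground set, and the two-point case says
  precisely that these satisfy the hypothesis again.\<close>

theorem four_functions:
  fixes \<alpha> \<beta> \<gamma> \<delta> :: "'e set \<Rightarrow> real"
  assumes "finite E"
    and "\<And>A. A \<subseteq> E \<Longrightarrow> 0 \<le> \<alpha> A" "\<And>A. A \<subseteq> E \<Longrightarrow> 0 \<le> \<beta> A"
    and "\<And>A. A \<subseteq> E \<Longrightarrow> 0 \<le> \<gamma> A" "\<And>A. A \<subseteq> E \<Longrightarrow> 0 \<le> \<delta> A"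
    and "\<And>A B. A \<subseteq> E \<Longrightarrow> B \<subseteq> E \<Longrightarrow> \<alpha> A * \<beta> B \<le> \<gamma> (A \<union> B) * \<delta> (A \<inter> B)"
  shows "sum \<alpha> (Pow E) * sum \<beta> (Pow E) \<le> sum \<gamma> (Pow E) * sum \<delta> (Pow E)"
  using assms
proof (induction E arbitrary: \<alpha> \<beta> \<gamma> \<delta> rule: finite_induct)
  case (insert e E)
  note nonneg = insert.prems(1-4) and ff = insert.prems(5)
  have "(\<Sum>A\<in>Pow E. \<alpha> A + \<alpha> (insert e A)) * (\<Sum>A\<in>Pow E. \<beta> A + \<beta> (insert e A))
      \<le> (\<Sum>A\<in>Pow E. \<gamma> A + \<gamma> (insert e A)) * (\<Sum>A\<in>Pow E. \<delta> A + \<delta> (insert e A))"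
  proof (rule insert.IH)
    fix A B assume AB: "A \<subseteq> E" "B \<subseteq> E"
    have e: "e \<notin> A" "e \<notin> B" using AB insert.hyps by auto
    have *: "A \<subseteq> insert e E" "B \<subseteq> insert e E" "insert e A \<subseteq> insert e E" "insert e B \<subseteq> insert e E"
      "A \<union> B \<subseteq> insert e E" "A \<inter> B \<subseteq> insert e E"
      "insert e (A \<union> B) \<subseteq> insert e E" "insert e (A \<inter> B) \<subseteq> insert e E"
      using AB by auto
    have int: "A \<inter> insert e B = A \<inter> B" "insert e A \<inter> B = A \<inter> B" using e by auto
    show "(\<alpha> A + \<alpha> (insert e A)) * (\<beta> B + \<beta> (insert e B))
        \<le> (\<gamma> (A \<union> B) + \<gamma> (insert e (A \<union> B))) * (\<delta> (A \<inter> B) + \<delta> (insert e (A \<inter> B)))"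
    proof (rule four_functions_two_point)
      show "\<alpha> A * \<beta> B \<le> \<gamma> (A \<union> B) * \<delta> (A \<inter> B)"
        using ff[OF *(1,2)] .
      show "\<alpha> A * \<beta> (insert e B) \<le> \<gamma> (insert e (A \<union> B)) * \<delta> (A \<inter> B)"
        using ff[OF *(1,4)] int by (simp add: insert_commute)
      show "\<alpha> (insert e A) * \<beta> B \<le> \<gamma> (insert e (A \<union> B)) * \<delta> (A \<inter> B)"
        using ff[OF *(3,2)] int by simp
      show "\<alpha> (insert e A) * \<beta> (insert e B) \<le> \<gamma> (insert e (A \<union> B)) * \<delta> (insert e (A \<inter> B))"
        using ff[OF *(3,4)] by simp
    qed (intro nonneg *)+
  qed (auto intro!: add_nonneg_nonneg nonneg)
  then show ?case using insert.hyps by (simp add: sum_Pow_insert)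
qed auto

section \<open>Increasing functions, weighted averages and Holley's inequality\<close>

definition incr_on :: "'e set \<Rightarrow> ('e set \<Rightarrow> real) \<Rightarrow> bool" where
  "incr_on E f \<longleftrightarrow> (\<forall>A B. A \<subseteq> B \<longrightarrow> B \<subseteq> E \<longrightarrow> f A \<le> f B)"

lemma incr_onD: "incr_on E f \<Longrightarrow> A \<subseteq> B \<Longrightarrow> B \<subseteq> E \<Longrightarrow> f A \<le> f B"
  by (auto simp: incr_on_def)

text \<open>Weights stay unnormalised, so that conditioning on a cylinder is the same formula with a
  smaller index set \<open>X\<close>.\<close>

definition wE :: "('e set \<Rightarrow> real) \<Rightarrow> 'e set set \<Rightarrow> ('e set \<Rightarrow> real) \<Rightarrow> real" where
  "wE w X f = (\<Sum>A\<in>X. w A * f A) / (\<Sum>A\<in>X. w A)"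

text \<open>The four functions are \<open>w1 * g\<close>, \<open>w2\<close> on the left and
  \<open>w2 * g\<close>, \<open>w1\<close> on the right. Subtracting the minimum \<open>f {}\<close>
  makes \<open>g\<close> nonnegative, as is required there, and shifts both averages
  equally.\<close>

theorem holley:
  fixes w1 w2 f :: "'e set \<Rightarrow> real"
  assumes E: "finite E"
    and nonneg: "\<And>A. A \<subseteq> E \<Longrightarrow> 0 \<le> w1 A" "\<And>A. A \<subseteq> E \<Longrightarrow> 0 \<le> w2 A"
    and pos: "0 < sum w1 (Pow E)" "0 < sum w2 (Pow E)"
    and lat: "\<And>A B. A \<subseteq> E \<Longrightarrow> B \<subseteq> E \<Longrightarrow> w1 A * w2 B \<le> w2 (A \<union> B) * w1 (A \<inter> B)"
    and f: "incr_on E f"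
  shows "wE w1 (Pow E) f \<le> wE w2 (Pow E) f"
proof -
  define g where "g A = f A - f {}" for A
  have g: "0 \<le> g A" if "A \<subseteq> E" for A using incr_onD[OF f, of "{}" A] that by (simp add: g_def)
  have gm: "g A \<le> g (A \<union> B)" if "A \<subseteq> E" "B \<subseteq> E" for A B
    using incr_onD[OF f, of A "A \<union> B"] that by (simp add: g_def)
  have "(\<Sum>A\<in>Pow E. w1 A * g A) * sum w2 (Pow E) \<le> (\<Sum>A\<in>Pow E. w2 A * g A) * sum w1 (Pow E)"
  proof (rule four_functions[OF E])
    fix A B assume AB: "A \<subseteq> E" "B \<subseteq> E"
    have "w1 A * g A * w2 B = (w1 A * w2 B) * g A" by simp
    also have "\<dots> \<le> (w2 (A \<union> B) * w1 (A \<inter> B)) * g (A \<union> B)"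
      by (rule mult_mono) (use lat[OF AB] g gm[OF AB] nonneg AB in \<open>auto simp: le_infI1\<close>)
    finally show "w1 A * g A * w2 B \<le> w2 (A \<union> B) * g (A \<union> B) * w1 (A \<inter> B)"
      by (simp add: mult_ac)
  qed (use nonneg g in auto)
  then have "wE w1 (Pow E) g \<le> wE w2 (Pow E) g"
    using pos by (simp add: wE_def divide_simps mult_ac)
  moreover have "wE w (Pow E) g = wE w (Pow E) f - f {}" if "0 < sum w (Pow E)" for w
    using that by (simp add: wE_def g_def algebra_simps sum_subtractf diff_divide_distrib
        flip: sum_distrib_left)
  ultimately show ?thesis using pos by auto
qed

lemma wE_add:
  "wE w X (\<lambda>A. f A + g A) = wE w X f + wE w X g"
  by (simp add: wE_def algebra_simps sum.distrib add_divide_distrib)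

lemma wE_diff:
  "wE w X (\<lambda>A. f A - g A) = wE w X f - wE w X g"
  by (simp add: wE_def algebra_simps sum_subtractf diff_divide_distrib)

lemma wE_cmult: "wE w X (\<lambda>A. c * f A) = c * wE w X f"
  by (simp add: wE_def sum_distrib_left mult_ac)

lemma wE_sum: "wE w X (\<lambda>A. \<Sum>i\<in>I. f i A) = (\<Sum>i\<in>I. wE w X (f i))"
  by (induction I rule: infinite_finite_induct) (auto simp: wE_add, auto simp: wE_def)

lemma wE_const: "0 < sum w X \<Longrightarrow> wE w X (\<lambda>A. c) = c"
  by (simp add: wE_def flip: sum_distrib_right)

lemma wE_mono:
  assumes "\<And>A. A \<in> X \<Longrightarrow> 0 \<le> w A" "\<And>A. A \<in> X \<Longrightarrow> f A \<le> g A"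
  shows "wE w X f \<le> wE w X g"
  unfolding wE_def using assms by (intro divide_right_mono sum_mono mult_left_mono sum_nonneg) auto

lemma wE_cong: "(\<And>A. A \<in> X \<Longrightarrow> f A = g A) \<Longrightarrow> wE w X f = wE w X g"
  by (simp add: wE_def)

section \<open>The OSSS inequality for monotone measures\<close>

datatype 'e dtree = Leaf | Node 'e "'e dtree" "'e dtree"

text \<open>\<open>D\<close> holds the coordinates queried so far, and no coordinate is queried
  twice along a branch. The first subtree is followed when the coordinate is closed, the second when
  it is open.\<close>

fun dtree_ok :: "'e set \<Rightarrow> 'e set \<Rightarrow> 'e dtree \<Rightarrow> bool" where
  "dtree_ok E D Leaf \<longleftrightarrow> True"
| "dtree_ok E D (Node e l r) \<longleftrightarrow> e \<in> E - D \<and> dtree_ok E (insert e D) l \<and> dtree_ok E (insert e D) r"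

text \<open>The configurations compatible with a partial revelation: \<open>D\<close> is the set of
  queried coordinates and \<open>X\<close> the set of those found open.\<close>

definition cyl :: "'e set \<Rightarrow> 'e set \<Rightarrow> 'e set \<Rightarrow> 'e set set" where
  "cyl E D X = {A. A \<subseteq> E \<and> A \<inter> D = X}"

lemma finite_cyl: "finite E \<Longrightarrow> finite (cyl E D X)"
  by (rule finite_subset[of _ "Pow E"]) (auto simp: cyl_def)

lemma cyl_empty: "cyl E {} {} = Pow E"
  by (auto simp: cyl_def)

lemma cyl_split:
  assumes "e \<notin> D" "X \<subseteq> D"
  shows "cyl E D X = cyl E (insert e D) X \<union> cyl E (insert e D) (insert e X)"
    and "cyl E (insert e D) X \<inter> cyl E (insert e D) (insert e X) = {}"
  using assms by (auto simp: cyl_def)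

section \<open>Conditional expectations and covariances given revealed coordinates\<close>

locale monotone_measure =
  fixes E :: "'e set" and w :: "'e set \<Rightarrow> real"
  assumes fin: "finite E"
    and wpos: "A \<subseteq> E \<Longrightarrow> 0 < w A"
    and lattice: "A \<subseteq> E \<Longrightarrow> B \<subseteq> E \<Longrightarrow> w A * w B \<le> w (A \<union> B) * w (A \<inter> B)"
begin

abbreviation ce :: "'e set \<Rightarrow> 'e set \<Rightarrow> ('e set \<Rightarrow> real) \<Rightarrow> real" where
  "ce D X f \<equiv> wE w (cyl E D X) f"

definition pr :: "'e set \<Rightarrow> 'e set \<Rightarrow> 'e \<Rightarrow> real" where
  "pr D X e = ce D X (\<lambda>A. of_bool (e \<in> A))"

definition cv :: "'e set \<Rightarrow> 'e set \<Rightarrow> ('e set \<Rightarrow> real) \<Rightarrow> 'e \<Rightarrow> real" where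
  "cv D X f e = ce D X (\<lambda>A. f A * of_bool (e \<in> A)) - ce D X f * pr D X e"

lemma cyl_pos:
  assumes "D \<subseteq> E" "X \<subseteq> D" shows "0 < sum w (cyl E D X)"
proof (rule sum_pos2[OF finite_cyl[OF fin]])
  show "X \<in> cyl E D X" using assms by (auto simp: cyl_def)
qed (use assms wpos in \<open>auto simp: cyl_def intro: less_imp_le\<close>)

lemma pr_bounds: "0 \<le> pr D X e" "pr D X e \<le> 1"
proof -
  have "0 \<le> w A" if "A \<in> cyl E D X" for A using wpos that by (auto simp: cyl_def intro: less_imp_le)
  then have "(\<Sum>A\<in>cyl E D X. w A * of_bool (e \<in> A)) \<le> sum w (cyl E D X)"
    "0 \<le> (\<Sum>A\<in>cyl E D X. w A * of_bool (e \<in> A))" "0 \<le> sum w (cyl E D X)"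
    by (auto intro!: sum_mono sum_nonneg)
  then show "0 \<le> pr D X e" "pr D X e \<le> 1" by (auto simp: pr_def wE_def divide_le_eq_1)
qed

lemma ce_split:
  assumes "D \<subseteq> E" "X \<subseteq> D" "e \<in> E - D"
  shows "ce D X f = (1 - pr D X e) * ce (insert e D) X f + pr D X e * ce (insert e D) (insert e X) f"
proof -
  have e: "e \<notin> D" using assms by auto
  note sp = cyl_split[OF e assms(2), of E]
  have split: "sum h (cyl E D X) = sum h (cyl E (insert e D) X) + sum h (cyl E (insert e D) (insert e X))"
    for h :: "'e set \<Rightarrow> real"
    unfolding sp(1) using sp(2) by (intro sum.union_disjoint finite_cyl fin) auto
  let ?a = "sum w (cyl E (insert e D) X)" and ?b = "sum w (cyl E (insert e D) (insert e X))"
  have pos: "0 < ?a" "0 < ?b" using assms by (auto intro!: cyl_pos)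
  have 0: "(\<Sum>A\<in>cyl E (insert e D) X. w A * of_bool (e \<in> A)) = 0"
    using assms e by (intro sum.neutral) (auto simp: cyl_def)
  have 1: "(\<Sum>A\<in>cyl E (insert e D) (insert e X). w A * of_bool (e \<in> A)) = ?b"
    using assms e by (intro sum.cong) (auto simp: cyl_def)
  have pr: "pr D X e = ?b / (?a + ?b)"
    by (simp add: pr_def wE_def split 0 1)
  have pr': "1 - pr D X e = ?a / (?a + ?b)"
    using pos by (simp add: pr field_simps)
  show ?thesis
    unfolding pr' unfolding pr using pos
    by (simp add: wE_def split add_divide_distrib)
qed

text \<open>Both conditional laws live on the unrevealed coordinates \<open>E - D\<close>, with
  weights \<open>w (X \<union> A)\<close> and \<open>w (P \<union> A)\<close>. The lattice condition
  for \<open>w\<close> is Holley's condition for this pair.\<close>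

lemma ce_mono_cond:
  assumes "D \<subseteq> E" "X \<subseteq> P" "P \<subseteq> D" and f: "incr_on E f"
  shows "ce D X f \<le> ce D P f"
proof -
  have im: "cyl E D Q = (\<union>) Q ` Pow (E - D)" if "Q \<subseteq> D" for Q
  proof (intro equalityI subsetI)
    fix A assume "A \<in> cyl E D Q"
    then have "A = Q \<union> (A - D)" "A - D \<in> Pow (E - D)" by (auto simp: cyl_def)
    then show "A \<in> (\<union>) Q ` Pow (E - D)" by (rule image_eqI)
  qed (use that assms in \<open>auto simp: cyl_def\<close>)
  have inj: "inj_on ((\<union>) Q) (Pow (E - D))" if "Q \<subseteq> D" for Q
    using that by (auto simp: inj_on_def)
  have conv: "sum h (cyl E D Q) = (\<Sum>A\<in>Pow (E - D). h (Q \<union> A))" if "Q \<subseteq> D" for Q and h :: "'e set \<Rightarrow> real"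
    unfolding im[OF that] by (simp add: sum.reindex[OF inj[OF that]])
  have X: "X \<subseteq> D" using assms by auto
  have 1: "ce D X f = wE (\<lambda>A. w (X \<union> A)) (Pow (E - D)) (\<lambda>A. f (X \<union> A))"
    using X by (simp add: wE_def conv)
  have 2: "ce D P f = wE (\<lambda>A. w (P \<union> A)) (Pow (E - D)) (\<lambda>A. f (P \<union> A))"
    using assms by (simp add: wE_def conv)
  have "wE (\<lambda>A. w (X \<union> A)) (Pow (E - D)) (\<lambda>A. f (X \<union> A))
      \<le> wE (\<lambda>A. w (X \<union> A)) (Pow (E - D)) (\<lambda>A. f (P \<union> A))"
    using assms by (intro wE_mono incr_onD[OF f] less_imp_le[OF wpos]) auto
  also have "\<dots> \<le> wE (\<lambda>A. w (P \<union> A)) (Pow (E - D)) (\<lambda>A. f (P \<union> A))"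
  proof (rule holley)
    fix A B assume AB: "A \<subseteq> E - D" "B \<subseteq> E - D"
    have "w (X \<union> A) * w (P \<union> B) \<le> w ((X \<union> A) \<union> (P \<union> B)) * w ((X \<union> A) \<inter> (P \<union> B))"
      using assms AB X by (intro lattice) auto
    moreover have "(X \<union> A) \<union> (P \<union> B) = P \<union> (A \<union> B)" "(X \<union> A) \<inter> (P \<union> B) = X \<union> (A \<inter> B)"
      using assms AB by auto
    ultimately show "w (X \<union> A) * w (P \<union> B) \<le> w (P \<union> (A \<union> B)) * w (X \<union> (A \<inter> B))" by simp
  next
    show "0 < (\<Sum>A\<in>Pow (E - D). w (X \<union> A))" "0 < (\<Sum>A\<in>Pow (E - D). w (P \<union> A))"
      using cyl_pos[of D X] cyl_pos[of D P] assms X by (auto simp: conv)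
    show "incr_on (E - D) (\<lambda>A. f (P \<union> A))"
      using assms by (auto simp: incr_on_def intro!: incr_onD[OF f])
  qed (use assms X fin in \<open>auto intro!: less_imp_le[OF wpos]\<close>)
  finally show ?thesis by (simp add: 1 2)
qed

lemma incr_of_bool: "incr_on E (\<lambda>A. of_bool (e \<in> A))"
  by (auto simp: incr_on_def)

lemma pr_mono: "D \<subseteq> E \<Longrightarrow> X \<subseteq> P \<Longrightarrow> P \<subseteq> D \<Longrightarrow> pr D X e \<le> pr D P e"
  unfolding pr_def by (rule ce_mono_cond) (auto simp: incr_of_bool)

lemma ce_mono_insert:
  assumes "D \<subseteq> E" "X \<subseteq> D" "e \<in> E - D" "incr_on E f"
  shows "ce (insert e D) X f \<le> ce (insert e D) (insert e X) f"
  using assms by (intro ce_mono_cond) auto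

text \<open>The law of total covariance for one revealed coordinate: the mean of the conditional
  covariances plus the covariance of the conditional means, the latter being functions of a
  two-valued variable.\<close>

lemma cv_total:
  assumes "D \<subseteq> E" "X \<subseteq> D" "e \<in> E - D"
  shows "cv D X f x = (1 - pr D X e) * cv (insert e D) X f x + pr D X e * cv (insert e D) (insert e X) f x
     + pr D X e * (1 - pr D X e) * (ce (insert e D) (insert e X) f - ce (insert e D) X f)
        * (pr (insert e D) (insert e X) x - pr (insert e D) X x)"
proof -
  have 1: "pr D X x = (1 - pr D X e) * pr (insert e D) X x + pr D X e * pr (insert e D) (insert e X) x"
    unfolding pr_def[of _ _ x] by (rule ce_split[OF assms])
  show ?thesis
    unfolding cv_def 1 ce_split[OF assms, of f] ce_split[OF assms, of "\<lambda>A. f A * of_bool (x \<in> A)"]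
    by algebra
qed

lemma pr_decided:
  assumes "e \<in> D" "X \<subseteq> D" "D \<subseteq> E" shows "pr D X e = of_bool (e \<in> X)"
proof -
  have "pr D X e = ce D X (\<lambda>A. of_bool (e \<in> X))"
    unfolding pr_def using assms by (intro wE_cong) (auto simp: cyl_def)
  also have "\<dots> = of_bool (e \<in> X)" by (rule wE_const[OF cyl_pos]) (use assms in auto)
  finally show ?thesis .
qed

lemma cv_decided:
  assumes "e \<in> D" "X \<subseteq> D" "D \<subseteq> E" shows "cv D X f e = 0"
proof -
  have "ce D X (\<lambda>A. f A * of_bool (e \<in> A)) = ce D X (\<lambda>A. of_bool (e \<in> X) * f A)"
    using assms by (intro wE_cong) (auto simp: cyl_def)
  then show ?thesis using assms by (simp add: cv_def pr_decided wE_cmult)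
qed

text \<open>In \<open>cv_total\<close> with \<open>x = e\<close> the conditional covariances vanish,
  since \<open>e\<close> is constant once revealed; only the covariance of the conditional means
  survives.\<close>

lemma cv_self:
  assumes "D \<subseteq> E" "X \<subseteq> D" "e \<in> E - D"
  shows "cv D X f e = pr D X e * (1 - pr D X e) * (ce (insert e D) (insert e X) f - ce (insert e D) X f)"
proof -
  have sub: "X \<subseteq> insert e D" "insert e X \<subseteq> insert e D" using assms by auto
  have "pr (insert e D) (insert e X) e = 1" "pr (insert e D) X e = 0"
    "cv (insert e D) (insert e X) f e = 0" "cv (insert e D) X f e = 0"
    using assms sub by (auto simp: pr_decided cv_decided)
  then show ?thesis by (subst cv_total[OF assms]) simp
qed

lemma cv_super:
  assumes "D \<subseteq> E" "X \<subseteq> D" "e \<in> E - D" "incr_on E f"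
  shows "(1 - pr D X e) * cv (insert e D) X f x + pr D X e * cv (insert e D) (insert e X) f x \<le> cv D X f x"
proof -
  have "ce (insert e D) X f \<le> ce (insert e D) (insert e X) f"
    "pr (insert e D) X x \<le> pr (insert e D) (insert e X) x"
    unfolding pr_def using assms by (auto intro!: ce_mono_insert incr_of_bool)
  then have "0 \<le> pr D X e * (1 - pr D X e) * (ce (insert e D) (insert e X) f - ce (insert e D) X f)
        * (pr (insert e D) (insert e X) x - pr (insert e D) X x)"
    using pr_bounds[of D X e] by simp
  then show ?thesis by (subst cv_total[OF assms(1-3)]) simp
qed

lemma cv_nonneg:
  assumes "D \<subseteq> E" "X \<subseteq> D" "incr_on E f"
  shows "0 \<le> cv D X f e"
proof (cases "e \<in> E - D")
  case True
  then show ?thesis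
    using ce_mono_insert[OF assms(1,2) True assms(3)] pr_bounds[of D X e]
    by (simp add: cv_self[OF assms(1,2) True])
next
  case False
  show ?thesis
  proof (cases "e \<in> D")
    case False
    with \<open>e \<notin> E - D\<close> have e: "e \<notin> E" by auto
    have "pr D X e = ce D X (\<lambda>A. 0)"
      unfolding pr_def using e by (intro wE_cong) (auto simp: cyl_def)
    moreover have "ce D X (\<lambda>A. f A * of_bool (e \<in> A)) = ce D X (\<lambda>A. 0)"
      using e by (intro wE_cong) (auto simp: cyl_def)
    moreover have "ce D X (\<lambda>A. 0) = 0" by (simp add: wE_def)
    ultimately show ?thesis unfolding cv_def by simp
  qed (use cv_decided assms in auto)
qed

section \<open>Decision trees and the coupling of two configurations\<close>

fun revealment :: "'e \<Rightarrow> 'e dtree \<Rightarrow> 'e set \<Rightarrow> 'e set \<Rightarrow> real" where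
  "revealment x Leaf D X = 0"
| "revealment x (Node e l r) D X = of_bool (x = e) + (1 - pr D X e) * revealment x l (insert e D) X
     + pr D X e * revealment x r (insert e D) (insert e X)"

text \<open>The expectation of \<open>f(Y) g(X)\<close>, where \<open>X\<close> and \<open>Y\<close> have the conditional laws given the
  revealed states \<open>X\<close> and \<open>P\<close>, the coordinates queried by the tree along \<open>X\<close> are sampled for both
  from the same uniform variables, and the remaining coordinates are sampled independently.\<close>

fun coupled :: "('e set \<Rightarrow> real) \<Rightarrow> ('e set \<Rightarrow> real) \<Rightarrow> 'e dtree \<Rightarrow> 'e set \<Rightarrow> 'e set \<Rightarrow> 'e set \<Rightarrow> real" where
  "coupled f g Leaf D X P = ce D P f * ce D X g"
| "coupled f g (Node e l r) D X P =
    (let a = pr D X e; c = pr D P e; m = min a c; D' = insert e D in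
       m * coupled f g r D' (insert e X) (insert e P) + (a - m) * coupled f g r D' (insert e X) P
     + (c - m) * coupled f g l D' X (insert e P) + (1 - a - c + m) * coupled f g l D' X P)"

text \<open>The tree computes \<open>g\<close>: at every leaf the answers fix its value on all
  compatible configurations.\<close>

fun determined :: "('e set \<Rightarrow> real) \<Rightarrow> 'e dtree \<Rightarrow> 'e set \<Rightarrow> 'e set \<Rightarrow> bool" where
  "determined g Leaf D X \<longleftrightarrow> (\<exists>c. \<forall>A\<in>cyl E D X. g A = c)"
| "determined g (Node e l r) D X \<longleftrightarrow>
     determined g l (insert e D) X \<and> determined g r (insert e D) (insert e X)"

lemma revealment_nonneg: "0 \<le> revealment x T D X"
  by (induction T arbitrary: D X) (auto simp: pr_bounds)

lemma revealment_decided: "x \<in> D \<Longrightarrow> dtree_ok E D T \<Longrightarrow> revealment x T D X = 0"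
  by (induction T arbitrary: D X) auto

text \<open>From equal states the common uniform variables give equal answers, so the coupling stays
  diagonal down to a leaf. There \<open>g\<close> is constant and the product of the means is the
  mean of the product.\<close>

lemma coupled_diag:
  assumes "D \<subseteq> E" "X \<subseteq> D" "dtree_ok E D T" "determined g T D X"
  shows "coupled f g T D X X = ce D X (\<lambda>A. f A * g A)"
  using assms
proof (induction T arbitrary: D X)
  case Leaf
  then obtain c where c: "\<And>A. A \<in> cyl E D X \<Longrightarrow> g A = c" by auto
  have "ce D X g = c" using wE_const[OF cyl_pos[OF Leaf(1,2)], of c] wE_cong[of "cyl E D X" g "\<lambda>_. c" w] c by simp
  moreover have "ce D X (\<lambda>A. f A * g A) = ce D X (\<lambda>A. c * f A)" by (rule wE_cong) (simp add: c)
  ultimately show ?case by (simp add: wE_cmult)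
next
  case (Node e l r)
  then have "coupled f g r (insert e D) (insert e X) (insert e X) = ce (insert e D) (insert e X) (\<lambda>A. f A * g A)"
    "coupled f g l (insert e D) X X = ce (insert e D) X (\<lambda>A. f A * g A)"
    by (auto intro!: Node.IH)
  then show ?case using Node.prems by (simp add: ce_split[of D X e] Let_def)
qed

context
  fixes f g :: "'e set \<Rightarrow> real"
  assumes f: "incr_on E f" and g: "\<And>A. A \<subseteq> E \<Longrightarrow> 0 \<le> g A" "\<And>A. A \<subseteq> E \<Longrightarrow> g A \<le> 1"
begin

lemma ce_g: "0 \<le> ce D X g" "D \<subseteq> E \<Longrightarrow> X \<subseteq> D \<Longrightarrow> ce D X g \<le> 1"
proof -
  have w: "0 \<le> w A" if "A \<in> cyl E D X" for A
    using wpos that by (auto simp: cyl_def intro: less_imp_le)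
  then show "0 \<le> ce D X g"
    using g by (auto simp: wE_def cyl_def intro!: divide_nonneg_nonneg sum_nonneg mult_nonneg_nonneg)
  assume D: "D \<subseteq> E" "X \<subseteq> D"
  have "ce D X g \<le> ce D X (\<lambda>_. 1)" using w g by (intro wE_mono) (auto simp: cyl_def)
  also have "\<dots> = 1" by (rule wE_const[OF cyl_pos[OF D]])
  finally show "ce D X g \<le> 1" .
qed

text \<open>Started from \<open>P \<subseteq> P'\<close> with the same uniform variables, the two
  versions of \<open>Y\<close> remain ordered while \<open>X\<close> is untouched. In mean, the gain
  in \<open>f(Y)\<close> is thus nonnegative, and multiplying it by \<open>g(X)\<close> in
  \<open>[0, 1]\<close> keeps it between zero and the full gain.\<close>

lemma coupled_increment:
  assumes "D \<subseteq> E" "X \<subseteq> D" "P \<subseteq> P'" "P' \<subseteq> D" "dtree_ok E D T"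
  shows "0 \<le> coupled f g T D X P' - coupled f g T D X P"
    and "coupled f g T D X P' - coupled f g T D X P \<le> ce D P' f - ce D P f"
proof -
  have "coupled f g T D X P' - coupled f g T D X P \<in> {0..ce D P' f - ce D P f}"
    using assms
  proof (induction T arbitrary: D X P P')
    case Leaf
    have "0 \<le> ce D P' f - ce D P f" using ce_mono_cond[OF Leaf(1,3,4) f] by simp
    moreover have "ce D P' f * ce D X g - ce D P f * ce D X g = (ce D P' f - ce D P f) * ce D X g"
      by (simp add: algebra_simps)
    ultimately show ?case using ce_g[of D X] Leaf by (auto simp: mult_left_le)
  next
    case (Node e l r)
    let ?D = "insert e D"
    have e: "e \<in> E - D" and ok: "dtree_ok E ?D l" "dtree_ok E ?D r" using Node.prems by auto
    have P: "P \<subseteq> D" using Node.prems by auto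
    define a c c' where "a = pr D X e" and "c = pr D P e" and "c' = pr D P' e"
    have b: "0 \<le> a" "a \<le> 1" "0 \<le> c" "c \<le> c'" "c' \<le> 1"
      using pr_bounds pr_mono Node.prems by (auto simp: a_def c_def c'_def)
    define F where "F Q = ce ?D Q f" for Q
    define R where "R Q = coupled f g r ?D (insert e X) Q" for Q
    define L where "L Q = coupled f g l ?D X Q" for Q
    have IH: "R Q' - R Q \<in> {0..F Q' - F Q}" "L Q' - L Q \<in> {0..F Q' - F Q}"
      if "Q \<subseteq> Q'" "Q' \<subseteq> ?D" for Q Q'
      unfolding R_def L_def F_def using that Node.prems e ok by (intro Node.IH; auto)+
    have sub: "insert e P \<subseteq> insert e P'" "P \<subseteq> insert e P'" "P \<subseteq> P'" "insert e P' \<subseteq> ?D" "P' \<subseteq> ?D"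
      using Node.prems by auto
    define m n where "m = min a c" and "n = min a c'"
    have mn: "0 \<le> m" "m \<le> n" "m \<le> c" "n \<le> a" "n - m \<le> c' - c" "a - n \<le> 1 - c'"
      using b by (auto simp: m_def n_def min_def)
    \<comment> \<open>The unit interval is cut at \<open>a\<close>, \<open>c\<close> and
      \<open>c'\<close>. The six terms are the pieces on which the answers for \<open>X\<close>,
      \<open>P\<close> and \<open>P'\<close> are constant: \<open>R\<close> stands for an open
      answer for \<open>X\<close>, \<open>L\<close> for a closed one, and the weights pair up to
      \<open>c\<close>, \<open>c' - c\<close> and \<open>1 - c'\<close>.\<close>
    have eq: "coupled f g (Node e l r) D X P' - coupled f g (Node e l r) D X P =
       m * (R (insert e P') - R (insert e P)) + (c - m) * (L (insert e P') - L (insert e P))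
       + (n - m) * (R (insert e P') - R P) + ((c' - c) - (n - m)) * (L (insert e P') - L P)
       + (a - n) * (R P' - R P) + (1 - c' - (a - n)) * (L P' - L P)"
      by (simp add: Let_def R_def L_def m_def n_def a_def c_def c'_def algebra_simps)
    have ceq: "ce D P' f - ce D P f = c * (F (insert e P') - F (insert e P))
      + (c' - c) * (F (insert e P') - F P) + (1 - c') * (F P' - F P)"
      using ce_split[of D P' e f] ce_split[of D P e f] Node.prems e P
      by (simp add: F_def c_def c'_def algebra_simps)
    have comb: "x * s + y * t \<in> {0..z * v}"
      if "s \<in> {0..v}" "t \<in> {0..v}" "0 \<le> x" "0 \<le> y" "x + y = z" for x y z s t v :: real
    proof -
      have "x * s + y * t \<le> x * v + y * v" using that by (intro add_mono mult_left_mono) auto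
      then show ?thesis using that by (auto simp: distrib_right)
    qed
    have 1: "m * (R (insert e P') - R (insert e P)) + (c - m) * (L (insert e P') - L (insert e P))
        \<in> {0..c * (F (insert e P') - F (insert e P))}"
      using mn by (intro comb IH sub) auto
    have 2: "(n - m) * (R (insert e P') - R P) + ((c' - c) - (n - m)) * (L (insert e P') - L P)
        \<in> {0..(c' - c) * (F (insert e P') - F P)}"
      using mn by (intro comb IH sub) auto
    have 3: "(a - n) * (R P' - R P) + (1 - c' - (a - n)) * (L P' - L P) \<in> {0..(1 - c') * (F P' - F P)}"
      using mn by (intro comb IH sub) auto
    show ?case unfolding eq ceq using 1 2 3 by auto
  qed
  then show "0 \<le> coupled f g T D X P' - coupled f g T D X P"
    and "coupled f g T D X P' - coupled f g T D X P \<le> ce D P' f - ce D P f" by auto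
qed

text \<open>Common uniform variables are replaced by independent ones query by query. A query of
  \<open>e\<close> costs at most the covariance of \<open>f\<close> with \<open>e\<close> given the
  state of \<open>Y\<close> at that moment. By \<open>cv_super\<close> the mean of the later
  covariances is at most the initial one, which leaves the revealment as its coefficient.\<close>

lemma coupled_decorrelation:
  assumes "D \<subseteq> E" "X \<subseteq> D" "P \<subseteq> D" "dtree_ok E D T"
  shows "coupled f g T D X P - ce D P f * ce D X g \<le> (\<Sum>x\<in>E. revealment x T D X * cv D P f x)"
  using assms
proof (induction T arbitrary: D X P)
  case (Node e l r)
  let ?D = "insert e D"
  have e: "e \<in> E - D" and ok: "dtree_ok E ?D l" "dtree_ok E ?D r" using Node.prems by auto
  define a c m where "a = pr D X e" and "c = pr D P e" and "m = min a c"
  have b: "0 \<le> a" "a \<le> 1" "0 \<le> c" "c \<le> 1"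
    using pr_bounds by (auto simp: a_def c_def)
  define F0 F1 G0 G1 where "F0 = ce ?D P f" and "F1 = ce ?D (insert e P) f"
    and "G0 = ce ?D X g" and "G1 = ce ?D (insert e X) g"
  define R where "R Q = coupled f g r ?D (insert e X) Q" for Q
  define L where "L Q = coupled f g l ?D X Q" for Q
  define s where "s T' X' Q = (\<Sum>x\<in>E. revealment x T' ?D X' * cv ?D Q f x)" for T' X' Q
  have F: "F0 \<le> F1" unfolding F0_def F1_def using Node.prems e f by (intro ce_mono_insert) auto
  have IH: "R (insert e P) \<le> F1 * G1 + s r (insert e X) (insert e P)" "R P \<le> F0 * G1 + s r (insert e X) P"
    "L (insert e P) \<le> F1 * G0 + s l X (insert e P)" "L P \<le> F0 * G0 + s l X P"
    using Node.IH(1)[of ?D X "insert e P"] Node.IH(1)[of ?D X P]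
      Node.IH(2)[of ?D "insert e X" "insert e P"] Node.IH(2)[of ?D "insert e X" P]
      Node.prems e ok unfolding R_def L_def F0_def F1_def G0_def G1_def s_def
    by (simp_all add: algebra_simps subset_insertI2 insert_mono)
  \<comment> \<open>\<open>m - a * c\<close> is the covariance of the two coupled answers, and
    \<open>c * (1 - c)\<close> is the variance of the answer for \<open>Y\<close>.\<close>
  have mle: "0 \<le> m - a * c" "m - a * c \<le> c * (1 - c)"
  proof -
    have "a * c \<le> a" "a * c \<le> c" using b by (auto simp: mult_left_le mult_left_le_one_le)
    then show "0 \<le> m - a * c" by (simp add: m_def)
    show "m - a * c \<le> c * (1 - c)"
    proof (cases "a \<le> c")
      case True
      then have "a * (1 - c) \<le> c * (1 - c)" using b by (intro mult_right_mono) auto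
      then show ?thesis using True by (simp add: m_def algebra_simps)
    next
      case False
      then have "c * c \<le> a * c" using b by (intro mult_right_mono) auto
      then show ?thesis using False by (simp add: m_def algebra_simps)
    qed
  qed
  have dR: "R (insert e P) - R P \<le> F1 - F0" unfolding R_def F1_def F0_def
    using Node.prems e ok by (intro coupled_increment) auto
  have dL: "0 \<le> L (insert e P) - L P" unfolding L_def
    using Node.prems e ok by (intro coupled_increment) auto
  have "(m - a * c) * ((R (insert e P) - R P) - (L (insert e P) - L P)) \<le> (m - a * c) * (F1 - F0)"
    using mle dR dL by (intro mult_left_mono) auto
  also have "\<dots> \<le> c * (1 - c) * (F1 - F0)" using mle F by (intro mult_right_mono) auto
  also have "\<dots> = cv D P f e"
    using Node.prems e by (simp add: cv_self c_def F1_def F0_def)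
  finally have cov: "(m - a * c) * ((R (insert e P) - R P) - (L (insert e P) - L P)) \<le> cv D P f e" .
  \<comment> \<open>Independent answers for \<open>X\<close> and \<open>Y\<close>, corrected by the
    covariance of the coupled answers times a mixed second difference.\<close>
  have "coupled f g (Node e l r) D X P =
     a * (c * R (insert e P) + (1 - c) * R P) + (1 - a) * (c * L (insert e P) + (1 - c) * L P)
     + (m - a * c) * ((R (insert e P) - R P) - (L (insert e P) - L P))"
    by (simp add: Let_def a_def c_def m_def R_def L_def algebra_simps)
  also have "\<dots> \<le> a * (c * (F1 * G1 + s r (insert e X) (insert e P)) + (1 - c) * (F0 * G1 + s r (insert e X) P))
     + (1 - a) * (c * (F1 * G0 + s l X (insert e P)) + (1 - c) * (F0 * G0 + s l X P)) + cv D P f e"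
    using b by (intro add_mono cov mult_left_mono IH) auto
  also have "\<dots> = ce D P f * ce D X g + a * (c * s r (insert e X) (insert e P) + (1 - c) * s r (insert e X) P)
     + (1 - a) * (c * s l X (insert e P) + (1 - c) * s l X P) + cv D P f e"
  proof -
    have "ce D P f = (1 - c) * F0 + c * F1" "ce D X g = (1 - a) * G0 + a * G1"
      using Node.prems e unfolding F0_def F1_def G0_def G1_def a_def c_def by (auto intro!: ce_split)
    then show ?thesis by algebra
  qed
  also have "\<dots> \<le> ce D P f * ce D X g + a * (\<Sum>x\<in>E. revealment x r ?D (insert e X) * cv D P f x)
     + (1 - a) * (\<Sum>x\<in>E. revealment x l ?D X * cv D P f x) + cv D P f e"
  proof -
    have "c * s T' X' (insert e P) + (1 - c) * s T' X' P \<le> (\<Sum>x\<in>E. revealment x T' ?D X' * cv D P f x)" for T' X'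
    proof -
      have "c * s T' X' (insert e P) + (1 - c) * s T' X' P
        = (\<Sum>x\<in>E. revealment x T' ?D X' * ((1 - c) * cv ?D P f x + c * cv ?D (insert e P) f x))"
        by (simp add: s_def sum_distrib_left sum.distrib[symmetric] algebra_simps)
      also have "\<dots> \<le> (\<Sum>x\<in>E. revealment x T' ?D X' * cv D P f x)"
        unfolding c_def using Node.prems e f
        by (intro sum_mono mult_left_mono cv_super revealment_nonneg) auto
      finally show ?thesis .
    qed
    then show ?thesis using b by (intro order_refl add_mono mult_left_mono) auto
  qed
  also have "\<dots> = ce D P f * ce D X g + (\<Sum>x\<in>E. revealment x (Node e l r) D X * cv D P f x)"
  proof -
    have "(\<Sum>x\<in>E. of_bool (x = e) * cv D P f x) = (\<Sum>x\<in>E. if x = e then cv D P f x else 0)"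
      by (intro sum.cong) auto
    also have "\<dots> = cv D P f e" using e fin by (simp add: sum.delta)
    finally have "cv D P f e = (\<Sum>x\<in>E. of_bool (x = e) * cv D P f x)" by simp
    then show ?thesis
      by (simp add: a_def sum_distrib_left sum.distrib[symmetric] algebra_simps)
  qed
  finally show ?case by simp
qed auto

end

text \<open>The coupling is started from two empty states. There it is diagonal, so its value is the
  mean of \<open>f * g\<close>, and its distance from the product of the means is the decorrelation
  error.\<close>

theorem OSSS:
  assumes "incr_on E f" "\<And>A. A \<subseteq> E \<Longrightarrow> 0 \<le> g A" "\<And>A. A \<subseteq> E \<Longrightarrow> g A \<le> 1"
    and "dtree_ok E {} T" "determined g T {} {}"
  shows "wE w (Pow E) (\<lambda>A. f A * g A) - wE w (Pow E) f * wE w (Pow E) g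
    \<le> (\<Sum>x\<in>E. revealment x T {} {} * cv {} {} f x)"
proof -
  have "coupled f g T {} {} {} - ce {} {} f * ce {} {} g \<le> (\<Sum>x\<in>E. revealment x T {} {} * cv {} {} f x)"
    by (rule coupled_decorrelation) (use assms in auto)
  moreover have "coupled f g T {} {} {} = ce {} {} (\<lambda>A. f A * g A)"
    by (rule coupled_diag) (use assms in auto)
  ultimately show ?thesis by (simp add: cyl_empty)
qed

end

section \<open>Finite random-cluster measures\<close>

definition rcw :: "real \<Rightarrow> real \<Rightarrow> 'e set \<Rightarrow> ('e set \<Rightarrow> nat) \<Rightarrow> 'e set \<Rightarrow> real" where
  "rcw p q E k A = p ^ card A * (1 - p) ^ card (E - A) * q ^ k A"

definition rcE :: "real \<Rightarrow> real \<Rightarrow> 'e set \<Rightarrow> ('e set \<Rightarrow> nat) \<Rightarrow> ('e set \<Rightarrow> real) \<Rightarrow> real" where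
  "rcE p q E k = wE (rcw p q E k) (Pow E)"

text \<open>For cluster counts this says that an edge joining two vertices already connected for \<open>k1\<close> in
  \<open>A\<close> does the same for \<open>k2\<close> in every larger configuration.\<close>

definition closes_more :: "('e set \<Rightarrow> nat) \<Rightarrow> ('e set \<Rightarrow> nat) \<Rightarrow> 'e set \<Rightarrow> bool" where
  "closes_more k1 k2 E \<longleftrightarrow>
     (\<forall>A B e. A \<subseteq> B \<longrightarrow> B \<subseteq> E \<longrightarrow> e \<in> E - B \<longrightarrow> k2 B + k1 (insert e A) \<le> k1 A + k2 (insert e B))"

text \<open>The elements of \<open>A - B\<close> are added one at a time, to
  \<open>A \<inter> B\<close> and to \<open>B\<close>. The hypothesis compares the drops of the two
  counts at each addition, and the drops telescope.\<close>

lemma closes_more_lattice: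
  assumes "closes_more k1 k2 E" "finite E" "A \<subseteq> E" "B \<subseteq> E"
  shows "k1 A + k2 B \<le> k2 (A \<union> B) + k1 (A \<inter> B)"
proof -
  have "k1 ((A \<inter> B) \<union> Y) + k2 B \<le> k2 (B \<union> Y) + k1 (A \<inter> B)" if "finite Y" "Y \<subseteq> A - B" for Y
    using that
  proof (induction Y rule: finite_induct)
    case (insert e Y)
    have "k2 (B \<union> Y) + k1 (insert e ((A \<inter> B) \<union> Y)) \<le> k1 ((A \<inter> B) \<union> Y) + k2 (insert e (B \<union> Y))"
      using insert.prems insert.hyps assms
      by (intro assms(1)[unfolded closes_more_def, rule_format]) auto
    moreover have "k1 ((A \<inter> B) \<union> Y) + k2 B \<le> k2 (B \<union> Y) + k1 (A \<inter> B)"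
      using insert by auto
    ultimately show ?case by simp
  qed auto
  moreover have "finite (A - B)" using assms finite_subset[of "A - B" E] by auto
  moreover have "A \<inter> B \<union> (A - B) = A" "B \<union> (A - B) = A \<union> B" by auto
  ultimately show ?thesis by (metis order_refl)
qed

lemma bernoulli_weight_prod:
  assumes "finite E" "A \<subseteq> E"
  shows "p ^ card A * (1 - p) ^ card (E - A) = (\<Prod>e\<in>E. if e \<in> A then p else 1 - p :: real)"
proof -
  have "(\<Prod>e\<in>E. if e \<in> A then p else 1 - p) = p ^ card (E \<inter> {e. e \<in> A}) * (1 - p) ^ card (E \<inter> - {e. e \<in> A})"
    using assms by (simp add: prod.If_cases)
  moreover have "E \<inter> {e. e \<in> A} = A" "E \<inter> - {e. e \<in> A} = E - A" using assms by auto
  ultimately show ?thesis by simp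
qed

lemma rcw_nonneg: "0 \<le> p \<Longrightarrow> p \<le> 1 \<Longrightarrow> 0 \<le> q \<Longrightarrow> 0 \<le> rcw p q E k A"
  by (simp add: rcw_def)

lemma rcw_pos: "0 < p \<Longrightarrow> p < 1 \<Longrightarrow> 0 < q \<Longrightarrow> 0 < rcw p q E k A"
  by (simp add: rcw_def)

lemma rcw_sum_pos:
  assumes "finite E" "0 \<le> p" "p \<le> 1" "0 < q"
  shows "0 < sum (rcw p q E k) (Pow E)"
proof (cases "p = 1")
  case True
  then show ?thesis using assms
    by (intro sum_pos2[of _ E]) (auto simp: rcw_nonneg, auto simp: rcw_def)
next
  case False
  then show ?thesis using assms
    by (intro sum_pos2[of _ "{}"]) (auto simp: rcw_nonneg, auto simp: rcw_def)
qed

text \<open>The Bernoulli factor is checked edge by edge; \<open>p1 \<le> p2\<close> matters for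
  edges of \<open>A - B\<close>, and all other edges give equality. For the cluster factor,
  \<open>q \<ge> 1\<close> turns the inequality of counts into one of powers.\<close>

lemma rcw_lattice:
  assumes "finite E" "A \<subseteq> E" "B \<subseteq> E" "0 \<le> p1" "p1 \<le> p2" "p2 \<le> 1" "1 \<le> q" "closes_more k1 k2 E"
  shows "rcw p1 q E k1 A * rcw p2 q E k2 B \<le> rcw p2 q E k2 (A \<union> B) * rcw p1 q E k1 (A \<inter> B)"
proof -
  let ?b = "\<lambda>p A. p ^ card A * (1 - p) ^ card (E - A)"
  have "?b p1 A * ?b p2 B = (\<Prod>e\<in>E. (if e \<in> A then p1 else 1 - p1) * (if e \<in> B then p2 else 1 - p2))"
    using assms by (simp only: bernoulli_weight_prod prod.distrib)
  also have "\<dots> \<le> (\<Prod>e\<in>E. (if e \<in> A \<union> B then p2 else 1 - p2) * (if e \<in> A \<inter> B then p1 else 1 - p1))"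
  proof (intro prod_mono conjI)
    fix e
    have "(1 - p1) * p2 \<ge> p1 * (1 - p2)" using assms by (simp add: algebra_simps)
    then show "(if e \<in> A then p1 else 1 - p1) * (if e \<in> B then p2 else 1 - p2)
      \<le> (if e \<in> A \<union> B then p2 else 1 - p2) * (if e \<in> A \<inter> B then p1 else 1 - p1)"
      by (auto simp: mult_ac)
    show "0 \<le> (if e \<in> A then p1 else 1 - p1) * (if e \<in> B then p2 else 1 - p2)" using assms by auto
  qed
  also have "\<dots> = ?b p2 (A \<union> B) * ?b p1 (A \<inter> B)"
    using bernoulli_weight_prod[OF assms(1), of "A \<union> B" p2] bernoulli_weight_prod[OF assms(1), of "A \<inter> B" p1] assms
    by (simp only: prod.distrib) (simp add: le_infI1)
  finally have b: "?b p1 A * ?b p2 B \<le> ?b p2 (A \<union> B) * ?b p1 (A \<inter> B)" .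
  have "q ^ k1 A * q ^ k2 B \<le> q ^ k2 (A \<union> B) * q ^ k1 (A \<inter> B)"
    using closes_more_lattice[OF assms(8,1-3)] assms
    by (simp flip: power_add add: power_increasing)
  with b have "(?b p1 A * ?b p2 B) * (q ^ k1 A * q ^ k2 B)
      \<le> (?b p2 (A \<union> B) * ?b p1 (A \<inter> B)) * (q ^ k2 (A \<union> B) * q ^ k1 (A \<inter> B))"
    by (rule mult_mono) (use assms in auto)
  then show ?thesis by (simp add: rcw_def mult_ac)
qed

lemma rcE_mono:
  assumes "finite E" "0 \<le> p1" "p1 \<le> p2" "p2 \<le> 1" "1 \<le> q" "closes_more k1 k2 E" "incr_on E f"
  shows "rcE p1 q E k1 f \<le> rcE p2 q E k2 f"
  unfolding rcE_def using assms
  by (intro holley) (auto simp: rcw_nonneg rcw_sum_pos rcw_lattice)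

section \<open>Conditioning on the edges outside a smaller volume\<close>

lemma sum_Pow_split:
  fixes h :: "'e set \<Rightarrow> real"
  assumes "finite E'" "E \<subseteq> E'"
  shows "sum h (Pow E') = (\<Sum>Y\<in>Pow (E' - E). \<Sum>A\<in>Pow E. h (A \<union> Y))"
proof -
  have "bij_betw (\<lambda>(Y, A). A \<union> Y) (Pow (E' - E) \<times> Pow E) (Pow E')"
    using assms by (intro bij_betw_byWitness[where f' = "\<lambda>A. (A - E, A \<inter> E)"]) auto
  then have "sum h (Pow E') = (\<Sum>z\<in>Pow (E' - E) \<times> Pow E. h (case z of (Y, A) \<Rightarrow> A \<union> Y))"
    by (rule sum.reindex_bij_betw[symmetric])
  then show ?thesis by (simp add: sum.cartesian_product split_def)
qed

text \<open>The domain Markov property: for a fixed outside configuration \<open>Y\<close> the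
  inside again carries a random-cluster weight, whose count sees \<open>Y\<close> as boundary
  condition.\<close>

lemma rcw_extend:
  assumes "finite E'" "E \<subseteq> E'" "A \<subseteq> E" "Y \<subseteq> E' - E"
  shows "rcw p q E' k' (A \<union> Y) = p ^ card Y * (1 - p) ^ card (E' - E - Y) * rcw p q E (\<lambda>A. k' (A \<union> Y)) A"
proof -
  have fin: "finite A" "finite Y" "finite E"
    using assms by (auto intro: finite_subset)
  have "card (A \<union> Y) = card A + card Y" using assms fin by (intro card_Un_disjoint) auto
  moreover have "E' - (A \<union> Y) = (E - A) \<union> (E' - E - Y)" using assms by auto
  then have "card (E' - (A \<union> Y)) = card (E - A) + card (E' - E - Y)"
    using assms fin by (simp add: card_Un_disjoint Int_Diff disjoint_iff)
  ultimately show ?thesis by (simp add: rcw_def power_add)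
qed

context
  fixes E E' :: "'e set" and p q :: real and k k' :: "'e set \<Rightarrow> nat" and f g :: "'e set \<Rightarrow> real"
  assumes E': "finite E'" "E \<subseteq> E'" and p: "0 \<le> p" "p \<le> 1" and q: "1 \<le> q"
    and f: "incr_on E f" and g: "\<And>Y. Y \<subseteq> E' - E \<Longrightarrow> 0 \<le> g Y"
begin

private abbreviation "Z Y \<equiv> sum (rcw p q E (\<lambda>A. k' (A \<union> Y))) (Pow E)"
private abbreviation "c Y \<equiv> p ^ card Y * (1 - p) ^ card (E' - E - Y)"

private lemma Z: "0 < Z Y"
  using p q E' by (auto intro!: rcw_sum_pos finite_subset[of E E'])

private lemma c: "0 \<le> c Y" using p by auto

private lemma numerator:
  "(\<Sum>A\<in>Pow E'. rcw p q E' k' A * (f (A \<inter> E) * g (A - E)))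
    = (\<Sum>Y\<in>Pow (E' - E). (c Y * g Y * Z Y) * rcE p q E (\<lambda>A. k' (A \<union> Y)) f)"
proof -
  have "(\<Sum>A\<in>Pow E'. rcw p q E' k' A * (f (A \<inter> E) * g (A - E)))
    = (\<Sum>Y\<in>Pow (E' - E). \<Sum>A\<in>Pow E. rcw p q E' k' (A \<union> Y) * (f ((A \<union> Y) \<inter> E) * g ((A \<union> Y) - E)))"
    by (rule sum_Pow_split[OF E'])
  also have "\<dots> = (\<Sum>Y\<in>Pow (E' - E). c Y * g Y * (\<Sum>A\<in>Pow E. rcw p q E (\<lambda>A. k' (A \<union> Y)) A * f A))"
  proof (rule sum.cong[OF refl])
    fix Y assume Y: "Y \<in> Pow (E' - E)"
    have "(\<Sum>A\<in>Pow E. rcw p q E' k' (A \<union> Y) * (f ((A \<union> Y) \<inter> E) * g ((A \<union> Y) - E)))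
      = (\<Sum>A\<in>Pow E. c Y * g Y * (rcw p q E (\<lambda>A. k' (A \<union> Y)) A * f A))"
    proof (rule sum.cong[OF refl])
      fix A assume A: "A \<in> Pow E"
      then have "(A \<union> Y) \<inter> E = A" "(A \<union> Y) - E = Y" using Y by auto
      then show "rcw p q E' k' (A \<union> Y) * (f ((A \<union> Y) \<inter> E) * g ((A \<union> Y) - E))
        = c Y * g Y * (rcw p q E (\<lambda>A. k' (A \<union> Y)) A * f A)"
        using rcw_extend[OF E', of A Y p q k'] A Y by simp
    qed
    then show "(\<Sum>A\<in>Pow E. rcw p q E' k' (A \<union> Y) * (f ((A \<union> Y) \<inter> E) * g ((A \<union> Y) - E)))
      = c Y * g Y * (\<Sum>A\<in>Pow E. rcw p q E (\<lambda>A. k' (A \<union> Y)) A * f A)"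
      by (simp add: sum_distrib_left)
  qed
  also have "\<dots> = (\<Sum>Y\<in>Pow (E' - E). (c Y * g Y * Z Y) * rcE p q E (\<lambda>A. k' (A \<union> Y)) f)"
    using less_imp_neq[OF Z] by (intro sum.cong) (auto simp: rcE_def wE_def)
  finally show ?thesis .
qed

private lemma denominator:
  "(\<Sum>A\<in>Pow E'. rcw p q E' k' A * g (A - E)) = (\<Sum>Y\<in>Pow (E' - E). c Y * g Y * Z Y)"
proof -
  have "(\<Sum>A\<in>Pow E'. rcw p q E' k' A * g (A - E))
    = (\<Sum>Y\<in>Pow (E' - E). \<Sum>A\<in>Pow E. rcw p q E' k' (A \<union> Y) * g ((A \<union> Y) - E))"
    by (rule sum_Pow_split[OF E'])
  also have "\<dots> = (\<Sum>Y\<in>Pow (E' - E). \<Sum>A\<in>Pow E. c Y * g Y * rcw p q E (\<lambda>A. k' (A \<union> Y)) A)"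
  proof (intro sum.cong[OF refl])
    fix Y A assume Y: "Y \<in> Pow (E' - E)" and A: "A \<in> Pow E"
    then have "(A \<union> Y) - E = Y" by auto
    then show "rcw p q E' k' (A \<union> Y) * g ((A \<union> Y) - E) = c Y * g Y * rcw p q E (\<lambda>A. k' (A \<union> Y)) A"
      using rcw_extend[OF E', of A Y p q k'] A Y by simp
  qed
  finally show ?thesis by (simp add: sum_distrib_left)
qed

private lemma Z': "0 < sum (rcw p q E' k') (Pow E')"
  using p q E' by (auto intro!: rcw_sum_pos)

private lemma cgZ: "Y \<subseteq> E' - E \<Longrightarrow> 0 \<le> c Y * g Y * Z Y"
  using c[of Y] g less_imp_le[OF Z] by (simp add: mult_nonneg_nonneg)

text \<open>Whatever the outside configuration \<open>Y\<close>, the conditional expectation of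
  \<open>f\<close> inside is at most the one with count \<open>k\<close>. The bound survives
  averaging over \<open>Y\<close> against any nonnegative outside weight \<open>g\<close>.\<close>

lemma rcE_volume_le:
  assumes "\<And>Y. Y \<subseteq> E' - E \<Longrightarrow> closes_more (\<lambda>A. k' (A \<union> Y)) k E"
  shows "rcE p q E' k' (\<lambda>A. f (A \<inter> E) * g (A - E)) \<le> rcE p q E k f * rcE p q E' k' (\<lambda>A. g (A - E))"
proof -
  have "(\<Sum>Y\<in>Pow (E' - E). (c Y * g Y * Z Y) * rcE p q E (\<lambda>A. k' (A \<union> Y)) f)
    \<le> (\<Sum>Y\<in>Pow (E' - E). (c Y * g Y * Z Y) * rcE p q E k f)"
    using assms p q E' f
    by (intro sum_mono mult_left_mono rcE_mono cgZ) (auto intro: finite_subset)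
  also have "\<dots> = rcE p q E k f * (\<Sum>Y\<in>Pow (E' - E). c Y * g Y * Z Y)"
    by (simp only: sum_distrib_left mult.commute)
  finally show ?thesis unfolding rcE_def[of p q E'] wE_def numerator denominator times_divide_eq_right
    by (rule divide_right_mono[OF _ less_imp_le[OF Z']])
qed

lemma rcE_volume_ge:
  assumes "\<And>Y. Y \<subseteq> E' - E \<Longrightarrow> closes_more k (\<lambda>A. k' (A \<union> Y)) E"
  shows "rcE p q E k f * rcE p q E' k' (\<lambda>A. g (A - E)) \<le> rcE p q E' k' (\<lambda>A. f (A \<inter> E) * g (A - E))"
proof -
  have "(\<Sum>Y\<in>Pow (E' - E). (c Y * g Y * Z Y) * rcE p q E k f)
    \<le> (\<Sum>Y\<in>Pow (E' - E). (c Y * g Y * Z Y) * rcE p q E (\<lambda>A. k' (A \<union> Y)) f)"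
    using assms p q E' f
    by (intro sum_mono mult_left_mono rcE_mono cgZ) (auto intro: finite_subset)
  moreover have "(\<Sum>Y\<in>Pow (E' - E). (c Y * g Y * Z Y) * rcE p q E k f)
    = rcE p q E k f * (\<Sum>Y\<in>Pow (E' - E). c Y * g Y * Z Y)"
    by (simp only: sum_distrib_left mult.commute)
  ultimately show ?thesis unfolding rcE_def[of p q E'] wE_def numerator denominator times_divide_eq_right
    using divide_right_mono[OF _ less_imp_le[OF Z']] by simp
qed

end

section \<open>Counting clusters\<close>

text \<open>Connectivity in \<open>A\<close> when the vertices of \<open>B\<close> are identified;
  \<open>B = {}\<close> is the free boundary condition. Counting its classes with \<open>ncl\<close>
  treats free and wired counts uniformly.\<close>

definition conn :: "'a set \<Rightarrow> 'a set set \<Rightarrow> ('a \<times> 'a) set" where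
  "conn B A = (adj A \<union> B \<times> B)\<^sup>*"

definition ncl :: "'a set \<Rightarrow> 'a set \<Rightarrow> 'a set set \<Rightarrow> nat" where
  "ncl V B A = card ((\<lambda>x. conn B A `` {x}) ` V)"

lemma sym_adj: "sym (adj A)"
  by (auto simp: sym_def adj_def insert_commute)

lemma adj_mono: "A \<subseteq> A' \<Longrightarrow> adj A \<subseteq> adj A'"
  by (auto simp: adj_def)

lemma conn_mono: "A \<subseteq> A' \<Longrightarrow> B \<subseteq> B' \<Longrightarrow> conn B A \<subseteq> conn B' A'"
  unfolding conn_def by (intro rtrancl_mono Un_mono adj_mono Sigma_mono)

lemma sym_conn: "sym (conn B A)"
  unfolding conn_def by (intro sym_rtrancl sym_Un sym_adj) (auto simp: sym_def)

lemma trans_conn: "trans (conn B A)" unfolding conn_def by (rule trans_rtrancl)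

lemma conn_refl: "(x, x) \<in> conn B A" by (simp add: conn_def)

lemma conn_class_eq: "conn B A `` {x} = conn B A `` {y} \<longleftrightarrow> (x, y) \<in> conn B A"
proof
  assume "conn B A `` {x} = conn B A `` {y}"
  moreover have "y \<in> conn B A `` {y}" by (simp add: conn_refl)
  ultimately show "(x, y) \<in> conn B A" by blast
next
  assume xy: "(x, y) \<in> conn B A"
  then have yx: "(y, x) \<in> conn B A" by (rule symD[OF sym_conn])
  show "conn B A `` {x} = conn B A `` {y}"
    using transD[OF trans_conn xy] transD[OF trans_conn yx] by blast
qed

text \<open>A path can be shortened so that it crosses the new edge at most once, in one of the two
  directions.\<close>

lemma conn_insert:
  "conn B (insert {x, y} A) = conn B A \<union> {(u, v). ((u, x) \<in> conn B A \<and> (y, v) \<in> conn B A)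
      \<or> ((u, y) \<in> conn B A \<and> (x, v) \<in> conn B A)}" (is "?L = ?R")
proof (intro equalityI subrelI)
  note tr = transD[OF trans_conn[of B A]]
  fix u v assume "(u, v) \<in> ?L"
  then show "(u, v) \<in> ?R" unfolding conn_def[of B "insert _ _"]
  proof (induction rule: rtrancl_induct)
    case base then show ?case by (simp add: conn_refl)
  next
    case (step v w)
    consider "(v, w) \<in> conn B A" | "v = x" "w = y" | "v = y" "w = x"
      using step.hyps(2) by (auto simp: adj_def doubleton_eq_iff conn_def)
    then show ?case
    proof cases
      case 1
      then have "(a, w) \<in> conn B A" if "(a, v) \<in> conn B A" for a using tr[OF that] by blast
      then show ?thesis using step.IH by blast
    next
      case 2 then show ?thesis using step.IH by (auto simp: conn_refl)
    next
      case 3 then show ?thesis using step.IH by (auto simp: conn_refl)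
    qed
  qed
next
  fix u v assume uv: "(u, v) \<in> ?R"
  have le: "conn B A \<subseteq> ?L" by (rule conn_mono) auto
  have xy: "(x, y) \<in> ?L" "(y, x) \<in> ?L" by (auto simp: conn_def adj_def insert_commute)
  note tr = transD[OF trans_conn[of B "insert {x, y} A"]]
  from uv consider "(u, v) \<in> ?L" | "(u, x) \<in> ?L" "(y, v) \<in> ?L" | "(u, y) \<in> ?L" "(x, v) \<in> ?L"
    using le by blast
  then show "(u, v) \<in> ?L"
  proof cases
    case 2 then show ?thesis using tr[OF tr[OF _ xy(1)]] by blast
  next
    case 3 then show ?thesis using tr[OF tr[OF _ xy(2)]] by blast
  qed
qed

text \<open>If the endpoints are already connected, the relation does not change; otherwise exactly
  the classes of \<open>x\<close> and \<open>y\<close> merge.\<close>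

lemma ncl_insert:
  assumes "finite V" "x \<in> V" "y \<in> V"
  shows "ncl V B A = ncl V B (insert {x, y} A) + of_bool ((x, y) \<notin> conn B A)"
proof (cases "(x, y) \<in> conn B A")
  case True
  then have "conn B (insert {x, y} A) = conn B A"
  proof -
    have yx: "(y, x) \<in> conn B A" using True by (rule symD[OF sym_conn])
    have "{(u, v). ((u, x) \<in> conn B A \<and> (y, v) \<in> conn B A) \<or> ((u, y) \<in> conn B A \<and> (x, v) \<in> conn B A)}
        \<subseteq> conn B A" (is "?N \<subseteq> _")
    proof clarify
      fix u v assume "((u, x) \<in> conn B A \<and> (y, v) \<in> conn B A) \<or> ((u, y) \<in> conn B A \<and> (x, v) \<in> conn B A)"
      then show "(u, v) \<in> conn B A"
        using transD[OF trans_conn transD[OF trans_conn _ True]] transD[OF trans_conn transD[OF trans_conn _ yx]]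
        by metis
    qed
    then show ?thesis unfolding conn_insert by (rule Un_absorb2)
  qed
  then show ?thesis using True by (simp add: ncl_def)
next
  case False
  note sy = symD[OF sym_conn[of B A]]
  define c where "c z = conn B A `` {z}" for z
  have ceq: "c u = c v \<longleftrightarrow> (u, v) \<in> conn B A" for u v unfolding c_def by (rule conn_class_eq)
  have memc: "u \<in> c v \<longleftrightarrow> c u = c v" for u v
    unfolding ceq using sy[of u v] sy[of v u] by (auto simp: c_def)
  have new: "conn B (insert {x, y} A) `` {z} = (if z \<in> c x \<union> c y then c x \<union> c y else c z)" for z
  proof -
    have "conn B (insert {x, y} A) `` {z} =
        c z \<union> (if (z, x) \<in> conn B A then c y else {}) \<union> (if (z, y) \<in> conn B A then c x else {})"
      unfolding conn_insert c_def by auto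
    also have "(z, x) \<in> conn B A \<longleftrightarrow> z \<in> c x" by (simp add: memc ceq)
    also have "(z, y) \<in> conn B A \<longleftrightarrow> z \<in> c y" by (simp add: memc ceq)
    also have "c z \<union> (if z \<in> c x then c y else {}) \<union> (if z \<in> c y then c x else {})
        = (if z \<in> c x \<union> c y then c x \<union> c y else c z)"
    proof (cases "z \<in> c x \<union> c y")
      case True
      then have "c z = c x \<and> z \<in> c x \<or> c z = c y \<and> z \<in> c y" by (simp add: memc)
      then show ?thesis by (elim disjE conjE; auto)
    qed simp
    finally show ?thesis .
  qed
  have "(\<lambda>z. conn B (insert {x, y} A) `` {z}) ` V = insert (c x \<union> c y) (c ` V - {c x, c y})" (is "?L = ?R")
  proof (intro equalityI subsetI)
    fix C assume "C \<in> ?L"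
    then obtain z where z: "z \<in> V" "C = (if z \<in> c x \<union> c y then c x \<union> c y else c z)"
      by (auto simp: new)
    moreover have "c z \<noteq> c x" "c z \<noteq> c y" if "z \<notin> c x \<union> c y"
      using that by (auto simp: memc)
    ultimately show "C \<in> ?R" by auto
  next
    fix C assume "C \<in> ?R"
    then consider "C = c x \<union> c y" | z where "z \<in> V" "C = c z" "c z \<noteq> c x" "c z \<noteq> c y" by auto
    then show "C \<in> ?L"
    proof cases
      case 1
      moreover have "x \<in> c x" by (simp add: c_def conn_refl)
      ultimately show ?thesis using assms by (auto simp: new intro!: image_eqI[of _ _ x])
    next
      case 2
      then have "z \<notin> c x \<union> c y" by (auto simp: memc)
      then show ?thesis using 2 by (auto simp: new intro!: image_eqI[of _ _ z])
    qed
  qed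
  moreover have "c x \<union> c y \<notin> c ` V - {c x, c y}"
  proof
    assume "c x \<union> c y \<in> c ` V - {c x, c y}"
    then obtain z where z: "c x \<union> c y = c z" by auto
    have "x \<in> c z" "y \<in> c z" unfolding z[symmetric] by (auto simp: memc)
    then have "c x = c y" by (simp add: memc)
    then show False using False by (simp add: ceq)
  qed
  moreover have "card (c ` V - {c x, c y}) = card (c ` V) - 2"
  proof -
    have "card {c x, c y} = 2" using False by (simp add: ceq)
    then show ?thesis using assms by (subst card_Diff_subset) auto
  qed
  moreover have "2 \<le> card (c ` V)"
  proof -
    have "card {c x, c y} \<le> card (c ` V)" using assms by (intro card_mono) auto
    moreover have "card {c x, c y} = 2" using False by (simp add: ceq)
    ultimately show ?thesis by simp
  qed
  ultimately have "card ((\<lambda>z. conn B (insert {x, y} A) `` {z}) ` V) = card (c ` V) - 1"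
    using assms by simp
  then show ?thesis using False \<open>2 \<le> card (c ` V)\<close> by (simp add: ncl_def c_def)
qed

text \<open>By \<open>ncl_insert\<close> a count drops at an edge exactly when its endpoints are not
  yet connected. Comparing the drops of two counts thus amounts to transferring connections from one
  system to the other.\<close>

lemma ncl_closes_more:
  assumes V: "finite V1" "finite V2" "\<And>e. e \<in> E \<Longrightarrow> \<exists>x y. e = {x, y} \<and> x \<in> V1 \<inter> V2 \<and> y \<in> V1 \<inter> V2"
    and conn: "\<And>A A' x y. A \<subseteq> A' \<Longrightarrow> A' \<subseteq> E \<Longrightarrow> {x, y} \<in> E \<Longrightarrow> (x, y) \<in> conn B1 (A \<union> Y1)
        \<Longrightarrow> (x, y) \<in> conn B2 (A' \<union> Y2)"
  shows "closes_more (\<lambda>A. ncl V1 B1 (A \<union> Y1)) (\<lambda>A. ncl V2 B2 (A \<union> Y2)) E"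
  unfolding closes_more_def
proof (intro allI impI)
  fix A A' e assume A: "A \<subseteq> A'" "A' \<subseteq> E" "e \<in> E - A'"
  then obtain x y where e: "e = {x, y}" "x \<in> V1 \<inter> V2" "y \<in> V1 \<inter> V2" using V(3) by blast
  then have *: "(x, y) \<in> conn B1 (A \<union> Y1) \<Longrightarrow> (x, y) \<in> conn B2 (A' \<union> Y2)"
    using A conn by blast
  have "ncl V1 B1 (A \<union> Y1) = ncl V1 B1 (insert e A \<union> Y1) + of_bool ((x, y) \<notin> conn B1 (A \<union> Y1))"
    "ncl V2 B2 (A' \<union> Y2) = ncl V2 B2 (insert e A' \<union> Y2) + of_bool ((x, y) \<notin> conn B2 (A' \<union> Y2))"
    using ncl_insert[of V1 x y B1 "A \<union> Y1"] ncl_insert[of V2 x y B2 "A' \<union> Y2"] e V by auto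
  then show "ncl V2 B2 (A' \<union> Y2) + ncl V1 B1 (insert e A \<union> Y1)
      \<le> ncl V1 B1 (A \<union> Y1) + ncl V2 B2 (insert e A' \<union> Y2)"
    using * by auto
qed

section \<open>Monotonicity in the parameter, the wiring and the volume\<close>

definition gE :: "real \<Rightarrow> real \<Rightarrow> 'a graph \<Rightarrow> 'a set \<Rightarrow> ('a set set \<Rightarrow> real) \<Rightarrow> real" where
  "gE p q H B = rcE p q (edges H) (ncl (verts H) B)"

lemma simple_edge:
  assumes "simple_graph H" "e \<in> edges H"
  shows "\<exists>x y. e = {x, y} \<and> x \<in> verts H \<and> y \<in> verts H \<and> x \<noteq> y"
proof -
  have "e \<subseteq> verts H" "card e = 2" using assms by (auto simp: simple_graph_def)
  then show ?thesis by (auto simp: card_2_iff)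
qed

lemma finite_edges: "finite_graph H \<Longrightarrow> finite (edges H)"
  by (rule finite_subset[of _ "Pow (verts H)"]) (auto simp: finite_graph_def simple_graph_def)

lemma gE_mono:
  assumes "finite_graph H" "0 \<le> p1" "p1 \<le> p2" "p2 \<le> 1" "1 \<le> q" "B1 \<subseteq> B2" "incr_on (edges H) f"
  shows "gE p1 q H B1 f \<le> gE p2 q H B2 f"
proof -
  have "closes_more (\<lambda>A. ncl (verts H) B1 (A \<union> {})) (\<lambda>A. ncl (verts H) B2 (A \<union> {})) (edges H)"
  proof (rule ncl_closes_more)
    fix A A' and x y :: 'a assume "A \<subseteq> A'" "(x, y) \<in> conn B1 (A \<union> {})"
    then show "(x, y) \<in> conn B2 (A' \<union> {})" using conn_mono[of A A' B1 B2] assms by auto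
  qed (use assms simple_edge in \<open>fastforce simp: finite_graph_def\<close>)+
  then show ?thesis
    unfolding gE_def using assms by (intro rcE_mono) (auto simp: finite_edges)
qed

text \<open>Outside edges can only create connections, so conditionally on them the inside dominates
  the free measure of \<open>H\<close>. The factor \<open>g\<close> carries an arbitrary outside
  event along, which is what decoupling will need.\<close>

lemma gE_volume_free:
  assumes "finite_graph H" "finite_graph H'" "subgraph H H'" "0 \<le> p" "p \<le> 1" "1 \<le> q"
    and "incr_on (edges H) f" "\<And>Y. Y \<subseteq> edges H' - edges H \<Longrightarrow> 0 \<le> g Y"
  shows "gE p q H {} f * gE p q H' {} (\<lambda>A. g (A - edges H))
    \<le> gE p q H' {} (\<lambda>A. f (A \<inter> edges H) * g (A - edges H))"
  unfolding gE_def
proof (rule rcE_volume_ge)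
  fix Y assume "Y \<subseteq> edges H' - edges H"
  have "closes_more (\<lambda>A. ncl (verts H) {} (A \<union> {})) (\<lambda>A. ncl (verts H') {} (A \<union> Y)) (edges H)"
  proof (rule ncl_closes_more)
    fix A A' and x y :: 'a assume "A \<subseteq> A'" "(x, y) \<in> conn {} (A \<union> {})"
    then show "(x, y) \<in> conn {} (A' \<union> Y)" using conn_mono[of "A \<union> {}" "A' \<union> Y" "{}" "{}"] by blast
  next
    fix e assume "e \<in> edges H"
    then show "\<exists>x y. e = {x, y} \<and> x \<in> verts H \<inter> verts H' \<and> y \<in> verts H \<inter> verts H'"
      using simple_edge[of H e] assms(1,3) unfolding finite_graph_def subgraph_def by blast
  qed (use assms in \<open>auto simp: finite_graph_def\<close>)
  then show "closes_more (ncl (verts H) {}) (\<lambda>A. ncl (verts H') {} (A \<union> Y)) (edges H)" by simp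
qed (use assms finite_edges in \<open>auto simp: subgraph_def\<close>)

text \<open>A path of the larger volume that leaves \<open>H\<close> does so at the boundary of \<open>H\<close>, so that wiring the
  boundary joins whatever is joined outside.\<close>

lemma conn_wired_restrict:
  assumes "induced_subgraph H G" "induced_subgraph H' G" "verts H \<subseteq> verts H'" "A \<subseteq> edges H"
    "Y \<subseteq> edges H' - edges H" "simple_graph G"
    and "(x, y) \<in> conn (boundary G H') (A \<union> Y)" "x \<in> verts H"
  shows "if y \<in> verts H then (x, y) \<in> conn (boundary G H) A
    else \<exists>b\<in>boundary G H. (x, b) \<in> conn (boundary G H) A"
  using assms(7) unfolding conn_def[of "boundary G H'"]
proof (induction rule: rtrancl_induct)
  case base
  then show ?case using assms by (simp add: conn_refl)
next
  case (step y z)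
  let ?B = "boundary G H"
  note tr = transD[OF trans_conn[of ?B A]]
  have BB: "(b, b') \<in> conn ?B A" if "b \<in> ?B" "b' \<in> ?B" for b b'
    using that by (auto simp: conn_def)
  have bd: "v \<in> ?B" if "v \<in> verts H" "v \<in> boundary G H'" for v
    using that assms by (auto simp: boundary_def)
  have bd2: "v \<in> ?B" if "v \<in> verts H" "{u, v} \<in> edges G" "u \<notin> verts H" for u v
  proof -
    have "{u, v} \<subseteq> verts G" using bspec[OF assms(6)[unfolded simple_graph_def] that(2)] by simp
    then have "u \<in> verts G - verts H" using that(3) by simp
    then show ?thesis using that(1,2) unfolding boundary_def by blast
  qed
  from step.hyps(2) consider (edge) "{y, z} \<in> A \<union> Y" | (wire) "y \<in> boundary G H'" "z \<in> boundary G H'"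
    by (auto simp: adj_def)
  then show ?case
  proof cases
    case edge
    have G: "{y, z} \<in> edges G" using edge assms by (auto simp: induced_subgraph_def)
    have inA: "{y, z} \<in> A" if "y \<in> verts H" "z \<in> verts H"
      using that edge G assms by (auto simp: induced_subgraph_def)
    then have AA: "(y, z) \<in> conn ?B A" if "y \<in> verts H" "z \<in> verts H"
      using that by (auto simp: conn_def adj_def)
    show ?thesis
    proof (cases "y \<in> verts H"; cases "z \<in> verts H")
      assume "y \<in> verts H" "z \<in> verts H"
      then show ?thesis using step.IH AA tr by auto
    next
      assume yz: "y \<in> verts H" "z \<notin> verts H"
      then have "y \<in> ?B" using bd2[of y z] G by (simp add: insert_commute)
      then show ?thesis using yz step.IH by auto
    next
      assume yz: "y \<notin> verts H" "z \<in> verts H"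
      then have "z \<in> ?B" using bd2[of z y] G by simp
      then show ?thesis using yz step.IH BB tr by auto
    qed (use step.IH in auto)
  next
    case wire
    then show ?thesis using step.IH bd BB tr by (auto split: if_splits)
  qed
qed

text \<open>No outside configuration connects vertices of \<open>H\<close> more than the wiring of
  its boundary does, by \<open>conn_wired_restrict\<close>.\<close>

lemma gE_volume_wired:
  assumes G: "simple_graph G" and H: "induced_subgraph H G" "induced_subgraph H' G" "verts H \<subseteq> verts H'"
    and fin: "finite_graph H" "finite_graph H'" and p: "0 \<le> p" "p \<le> 1" "1 \<le> q"
    and f: "incr_on (edges H) f"
  shows "gE p q H' (boundary G H') (\<lambda>A. f (A \<inter> edges H)) \<le> gE p q H (boundary G H) f"
proof -
  have sub: "edges H \<subseteq> edges H'" using H by (auto simp: induced_subgraph_def)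
  have "gE p q H' (boundary G H') (\<lambda>A. f (A \<inter> edges H) * 1)
     \<le> gE p q H (boundary G H) f * gE p q H' (boundary G H') (\<lambda>A. 1)"
    unfolding gE_def
  proof (rule rcE_volume_le)
    fix Y assume Y: "Y \<subseteq> edges H' - edges H"
    have "closes_more (\<lambda>A. ncl (verts H') (boundary G H') (A \<union> Y)) (\<lambda>A. ncl (verts H) (boundary G H) (A \<union> {})) (edges H)"
    proof (rule ncl_closes_more)
      fix A A' and x y :: 'a assume A: "A \<subseteq> A'" "A' \<subseteq> edges H" "{x, y} \<in> edges H"
        "(x, y) \<in> conn (boundary G H') (A \<union> Y)"
      then have "x \<in> verts H" "y \<in> verts H" using fin by (auto simp: finite_graph_def simple_graph_def)
      then have "(x, y) \<in> conn (boundary G H) A"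
        using conn_wired_restrict[OF H _ Y G A(4)] A by auto
      then show "(x, y) \<in> conn (boundary G H) (A' \<union> {})" using conn_mono[of A A'] A by auto
    next
      fix e assume "e \<in> edges H"
      then show "\<exists>x y. e = {x, y} \<and> x \<in> verts H' \<inter> verts H \<and> y \<in> verts H' \<inter> verts H"
        using simple_edge[of H e] fin(1) H(3) unfolding finite_graph_def by blast
    qed (use fin in \<open>auto simp: finite_graph_def\<close>)
    then show "closes_more (\<lambda>A. ncl (verts H') (boundary G H') (A \<union> Y)) (ncl (verts H) (boundary G H)) (edges H)"
      by simp
  qed (use assms sub finite_edges in auto)
  moreover have "gE p q H' (boundary G H') (\<lambda>A. 1) = 1"
    unfolding gE_def rcE_def using p finite_edges[OF fin(2)] by (intro wE_const rcw_sum_pos) auto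
  ultimately show ?thesis by simp
qed

section \<open>Agreement of \<open>ncl\<close> with the free and wired cluster counts\<close>

lemma clusters_eq_image:
  assumes "simple_graph H" "B \<subseteq> verts H"
  shows "clusters H \<omega> = (\<lambda>x. conn {} (open_edges H \<omega>) `` {x}) ` verts H"
proof -
  have inV: "y \<in> verts H" if "(x, y) \<in> conn {} (open_edges H \<omega>)" "x \<in> verts H" for x y
    using that unfolding conn_def
    by (induction rule: rtrancl_induct) (use assms in \<open>auto simp: adj_def open_edges_def simple_graph_def\<close>)
  have "{(x, y). x \<in> verts H \<and> y \<in> verts H \<and> joined H \<omega> x y} `` {x} = conn {} (open_edges H \<omega>) `` {x}"
    if "x \<in> verts H" for x
    using inV that by (auto simp: joined_def conn_def)
  then show ?thesis by (auto simp: clusters_def quotient_def)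
qed

lemma wired_count_eq_ncl:
  assumes H: "finite_graph H" and B: "B \<subseteq> verts H"
  shows "wired_count B H \<omega> = ncl (verts H) B (open_edges H \<omega>)"
proof -
  let ?A = "open_edges H \<omega>" and ?V = "verts H"
  define c where "c x = conn {} ?A `` {x}" for x
  define U where "U = (\<Union>b\<in>B. c b)"
  have sg: "simple_graph H" using H by (simp add: finite_graph_def)
  have cl: "clusters H \<omega> = c ` ?V" using clusters_eq_image[OF sg B] by (simp add: c_def)
  note tr0 = transD[OF trans_conn[of "{}" ?A]] and sy0 = symD[OF sym_conn[of "{}" ?A]]
  note tr = transD[OF trans_conn[of B ?A]]
  have le: "conn {} ?A \<subseteq> conn B ?A" by (rule conn_mono) auto
  have BB: "(b, b') \<in> conn B ?A" if "b \<in> B" "b' \<in> B" for b b' using that by (auto simp: conn_def)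
  \<comment> \<open>\<open>U\<close> is the union of the clusters meeting \<open>B\<close>. Wiring
    turns it into a single class and leaves the other clusters alone.\<close>
  have char: "(x, y) \<in> conn B ?A \<longleftrightarrow> (x, y) \<in> conn {} ?A \<or> (x \<in> U \<and> y \<in> U)" (is "_ \<longleftrightarrow> ?R y") for x y
  proof
    assume "(x, y) \<in> conn B ?A"
    then show "?R y" unfolding conn_def[of B]
    proof (induction rule: rtrancl_induct)
      case base then show ?case by (simp add: conn_refl)
    next
      case (step y z)
      from step.hyps(2) consider "(y, z) \<in> conn {} ?A" | "y \<in> B" "z \<in> B" by (auto simp: conn_def)
      then show ?case
      proof cases
        case 1 then show ?thesis using step.IH tr0 by (auto simp: U_def c_def)
      next
        case 2
        then have "y \<in> U" "z \<in> U"
          using conn_refl[of y "{}" ?A] conn_refl[of z "{}" ?A] unfolding U_def c_def by blast+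
        moreover have "x \<in> U" if "(x, y) \<in> conn {} ?A" using that 2 sy0 by (auto simp: U_def c_def)
        ultimately show ?thesis using step.IH by auto
      qed
    qed
  next
    assume "?R y"
    then show "(x, y) \<in> conn B ?A"
    proof
      assume "x \<in> U \<and> y \<in> U"
      then obtain b b' where b: "b \<in> B" "b' \<in> B" "(b, x) \<in> conn {} ?A" "(b', y) \<in> conn {} ?A"
        by (auto simp: U_def c_def)
      then have "(x, b) \<in> conn B ?A" "(b, b') \<in> conn B ?A" "(b', y) \<in> conn B ?A"
        using sy0 le BB by blast+
      then show ?thesis using tr by blast
    qed (use le in auto)
  qed
  have cB: "conn B ?A `` {x} = (if c x \<inter> B = {} then c x else U)" if "x \<in> ?V" for x
  proof -
    have "c x \<inter> B = {} \<longleftrightarrow> x \<notin> U" using sy0 by (auto simp: c_def U_def)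
    moreover have "c x \<subseteq> U" if "x \<in> U" using that tr0 by (auto simp: c_def U_def)
    ultimately show ?thesis by (auto simp: char c_def)
  qed
  have img: "(\<lambda>x. conn B ?A `` {x}) ` ?V = {C \<in> c ` ?V. C \<inter> B = {}} \<union> (if \<exists>C\<in>c ` ?V. C \<inter> B \<noteq> {} then {U} else {})"
    using cB by (auto simp: image_iff)
  have UB: "U \<inter> B \<noteq> {}" if "\<exists>C\<in>c ` ?V. C \<inter> B \<noteq> {}"
  proof -
    from that obtain b where "b \<in> B" by blast
    then have "b \<in> U" using conn_refl[of b "{}" ?A] unfolding U_def c_def by blast
    then show ?thesis using \<open>b \<in> B\<close> by blast
  qed
  have "card ((\<lambda>x. conn B ?A `` {x}) ` ?V) = card {C \<in> c ` ?V. C \<inter> B = {}} + (if \<exists>C\<in>c ` ?V. C \<inter> B \<noteq> {} then 1 else 0)"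
    unfolding img using H UB by (subst card_Un_disjoint) (auto simp: finite_graph_def)
  then show ?thesis by (simp add: wired_count_def cl ncl_def)
qed

lemma free_count_eq_ncl: "finite_graph H \<Longrightarrow> free_count H \<omega> = ncl (verts H) {} (open_edges H \<omega>)"
  by (subst wired_count_eq_ncl[symmetric]) (auto simp: wired_count_def free_count_def)

lemma boundary_subset: "boundary G H \<subseteq> verts H"
  by (auto simp: boundary_def)

section \<open>Measures on infinite configurations\<close>

abbreviation CS :: "'e set \<Rightarrow> ('e \<Rightarrow> bool) measure" where
  "CS E \<equiv> PiM E (\<lambda>_. count_space UNIV)"

abbreviation (input) ploc :: "('e \<Rightarrow> bool) measure \<Rightarrow> 'e set \<Rightarrow> ('e set \<Rightarrow> bool) \<Rightarrow> real" where
  "ploc M F Q \<equiv> measure M {\<omega> \<in> space M. Q {e\<in>F. \<omega> e}}"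

abbreviation (input) pcyl :: "('e \<Rightarrow> bool) measure \<Rightarrow> 'e set \<Rightarrow> 'e set \<Rightarrow> real" where
  "pcyl M F A \<equiv> measure M {\<omega> \<in> space M. {e\<in>F. \<omega> e} = A}"

lemma measurable_local:
  assumes "finite F" "F \<subseteq> E"
  shows "{\<omega> \<in> space (CS E). Q {e\<in>F. \<omega> e}} \<in> sets (CS E)"
proof -
  have "{\<omega> \<in> space (CS E). Q {e\<in>F. \<omega> e}} = (\<Union>A\<in>{A\<in>Pow F. Q A}. {\<omega> \<in> space (CS E). \<forall>e\<in>F. \<omega> e = (e \<in> A)})"
  proof (intro equalityI subsetI)
    fix \<omega> assume "\<omega> \<in> {\<omega> \<in> space (CS E). Q {e\<in>F. \<omega> e}}"
    then show "\<omega> \<in> (\<Union>A\<in>{A\<in>Pow F. Q A}. {\<omega> \<in> space (CS E). \<forall>e\<in>F. \<omega> e = (e \<in> A)})"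
      by (intro UN_I[of "{e\<in>F. \<omega> e}"]) auto
  next
    fix \<omega> assume "\<omega> \<in> (\<Union>A\<in>{A\<in>Pow F. Q A}. {\<omega> \<in> space (CS E). \<forall>e\<in>F. \<omega> e = (e \<in> A)})"
    then obtain A where A: "A \<subseteq> F" "Q A" "\<omega> \<in> space (CS E)" "\<forall>e\<in>F. \<omega> e = (e \<in> A)" by auto
    then have "{e\<in>F. \<omega> e} = A" by auto
    then show "\<omega> \<in> {\<omega> \<in> space (CS E). Q {e\<in>F. \<omega> e}}" using A by simp
  qed
  also have "\<dots> \<in> sets (CS E)"
  proof (rule sets.finite_UN)
    fix A assume "A \<in> {A\<in>Pow F. Q A}"
    have "{\<omega> \<in> space (CS E). \<omega> e = (e \<in> A)} \<in> sets (CS E)" if "e \<in> F" for e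
    proof -
      have [measurable]: "(\<lambda>\<omega>. \<omega> e) \<in> measurable (CS E) (count_space UNIV)"
        using that assms by (intro measurable_component_singleton) auto
      show ?thesis by measurable
    qed
    then show "{\<omega> \<in> space (CS E). \<forall>e\<in>F. \<omega> e = (e \<in> A)} \<in> sets (CS E)"
      using assms by (intro sets.sets_Collect_finite_All) auto
  qed (use assms in auto)
  finally show ?thesis .
qed

lemma prob_local_sum:
  assumes M: "prob_space M" "sets M = sets (CS E)" and F: "finite F" "F \<subseteq> E"
  shows "ploc M F Q = (\<Sum>A\<in>{A\<in>Pow F. Q A}. pcyl M F A)"
proof -
  interpret prob_space M by fact
  have sp: "space M = space (CS E)" using M(2) by (rule sets_eq_imp_space_eq)
  have "{\<omega> \<in> space M. Q {e\<in>F. \<omega> e}} = (\<Union>A\<in>{A\<in>Pow F. Q A}. {\<omega> \<in> space M. {e\<in>F. \<omega> e} = A})"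
    by auto
  also have "measure M \<dots> = (\<Sum>A\<in>{A\<in>Pow F. Q A}. pcyl M F A)"
  proof (rule finite_measure_finite_Union)
    show "(\<lambda>A. {\<omega> \<in> space M. {e\<in>F. \<omega> e} = A}) ` {A\<in>Pow F. Q A} \<subseteq> events"
      using measurable_local[OF F] unfolding sp M(2) by auto
  qed (use F in \<open>auto simp: disjoint_family_on_def\<close>)
  finally show ?thesis .
qed

lemma integral_local:
  fixes h :: "'e set \<Rightarrow> real"
  assumes M: "prob_space M" "sets M = sets (CS E)" and F: "finite F" "F \<subseteq> E"
  shows "integrable M (\<lambda>\<omega>. h {e\<in>F. \<omega> e})"
    and "(\<integral>\<omega>. h {e\<in>F. \<omega> e} \<partial>M) = (\<Sum>A\<in>Pow F. h A * pcyl M F A)"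
proof -
  interpret prob_space M by fact
  have sp: "space M = space (CS E)" using M(2) by (rule sets_eq_imp_space_eq)
  let ?C = "\<lambda>A. {\<omega> \<in> space M. {e\<in>F. \<omega> e} = A}"
  have C: "?C A \<in> sets M" for A using measurable_local[OF F] unfolding sp M(2) by auto
  have eq: "h {e\<in>F. \<omega> e} = (\<Sum>A\<in>Pow F. h A * indicator (?C A) \<omega>)" if "\<omega> \<in> space M" for \<omega>
  proof -
    have "(\<Sum>A\<in>Pow F. h A * indicator (?C A) \<omega>) = (\<Sum>A\<in>Pow F. if A = {e\<in>F. \<omega> e} then h A else 0)"
      using that by (intro sum.cong) (auto simp: indicator_def)
    then show ?thesis using F by (simp add: sum.delta)
  qed
  have int: "integrable M (\<lambda>\<omega>. \<Sum>A\<in>Pow F. h A * indicator (?C A) \<omega>)"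
    by (intro Bochner_Integration.integrable_sum integrable_mult_right integrable_real_indicator)
      (auto simp: C less_top[symmetric])
  show "integrable M (\<lambda>\<omega>. h {e\<in>F. \<omega> e})"
    using int by (subst Bochner_Integration.integrable_cong[OF refl eq]) auto
  have "(\<integral>\<omega>. h {e\<in>F. \<omega> e} \<partial>M) = (\<integral>\<omega>. (\<Sum>A\<in>Pow F. h A * indicator (?C A) \<omega>) \<partial>M)"
    by (rule Bochner_Integration.integral_cong[OF refl eq])
  also have "\<dots> = (\<Sum>A\<in>Pow F. h A * measure M (?C A))"
    by (subst Bochner_Integration.integral_sum)
      (auto simp: C less_top[symmetric] Int_absorb1 intro!: integrable_mult_right integrable_real_indicator sum.cong)
  finally show "(\<integral>\<omega>. h {e\<in>F. \<omega> e} \<partial>M) = (\<Sum>A\<in>Pow F. h A * measure M (?C A))" .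
qed

subsection \<open>Existence by projective limits\<close>

context
  fixes E :: "'e set" and a :: "'e set \<Rightarrow> 'e set \<Rightarrow> real"
  assumes a_nonneg: "\<And>F A. finite F \<Longrightarrow> F \<subseteq> E \<Longrightarrow> A \<subseteq> F \<Longrightarrow> 0 \<le> a F A"
    and a_empty: "a {} {} = 1"
    and a_split: "\<And>F A e. finite F \<Longrightarrow> insert e F \<subseteq> E \<Longrightarrow> e \<notin> F \<Longrightarrow> A \<subseteq> F \<Longrightarrow>
      a F A = a (insert e F) A + a (insert e F) (insert e A)"
begin

private lemma a_consistent:
  assumes "finite K" "K \<inter> J = {}" "finite J" "J \<union> K \<subseteq> E" "A \<subseteq> J"
  shows "a J A = (\<Sum>B\<in>Pow K. a (J \<union> K) (A \<union> B))"
  using assms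
proof (induction K rule: finite_induct)
  case (insert e K)
  have "(\<Sum>B\<in>Pow (insert e K). a (J \<union> insert e K) (A \<union> B))
    = (\<Sum>B\<in>Pow K. a (insert e (J \<union> K)) (A \<union> B) + a (insert e (J \<union> K)) (insert e (A \<union> B)))"
    using insert.hyps by (subst sum_Pow_insert) auto
  also have "\<dots> = (\<Sum>B\<in>Pow K. a (J \<union> K) (A \<union> B))"
    using insert.hyps insert.prems by (intro sum.cong a_split[symmetric]) auto
  also have "\<dots> = a J A" using insert.prems by (intro insert.IH[symmetric]) auto
  finally show ?case by simp
qed simp

private definition pm :: "'e set \<Rightarrow> 'e set measure" where
  "pm F = point_measure (Pow F) (\<lambda>A. ennreal (a F A))"

private definition cfg_real :: "'e set \<Rightarrow> 'e set \<Rightarrow> 'e \<Rightarrow> real" where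
  "cfg_real F A = (\<lambda>e\<in>F. of_bool (e \<in> A))"

private definition PF :: "'e set \<Rightarrow> ('e \<Rightarrow> real) measure" where
  "PF F = distr (pm F) (PiM F (\<lambda>_. borel)) (cfg_real F)"

private lemma cfg_real_measurable: "cfg_real F \<in> measurable (pm F) (PiM F (\<lambda>_. borel))"
  by (auto simp: pm_def cfg_real_def space_PiM)

private lemma pm_restrict:
  assumes "J \<subseteq> H" "finite H" "H \<subseteq> E"
  shows "distr (pm H) (count_space (Pow J)) (\<lambda>A. A \<inter> J) = pm J"
proof (rule measure_eqI_finite[of _ "Pow J"])
  have J: "finite J" using assms by (auto intro: finite_subset)
  show "finite (Pow J)" using J by simp
  fix A assume A: "A \<in> Pow J"
  have "emeasure (distr (pm H) (count_space (Pow J)) (\<lambda>A. A \<inter> J)) {A} = emeasure (pm H) {B\<in>Pow H. B \<inter> J = A}"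
    using A by (subst emeasure_distr) (auto simp: pm_def space_point_measure intro!: arg_cong2[where f=emeasure])
  also have "\<dots> = (\<Sum>B\<in>{B\<in>Pow H. B \<inter> J = A}. ennreal (a H B))"
    using assms by (subst pm_def, subst emeasure_point_measure_finite) auto
  also have "\<dots> = (\<Sum>B\<in>Pow (H - J). ennreal (a H (A \<union> B)))"
  proof (rule sum.reindex_bij_witness[where i = "\<lambda>B. A \<union> B" and j = "\<lambda>B. B - J"])
  qed (use A assms in \<open>auto intro!: arg_cong2[where f=a] arg_cong[where f=ennreal]\<close>)
  also have "\<dots> = ennreal (\<Sum>B\<in>Pow (H - J). a H (A \<union> B))"
    using A assms by (intro sum_ennreal a_nonneg) auto
  also have "(\<Sum>B\<in>Pow (H - J). a H (A \<union> B)) = a J A"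
  proof -
    have *: "(H - J) \<inter> J = {}" "J \<union> (H - J) = H" using assms by auto
    then show ?thesis using a_consistent[of "H - J" J A] assms A J by auto
  qed
  also have "ennreal (a J A) = emeasure (pm J) {A}"
    using A J by (subst pm_def, subst emeasure_point_measure_finite) auto
  finally show "emeasure (distr (pm H) (count_space (Pow J)) (\<lambda>A. A \<inter> J)) {A} = emeasure (pm J) {A}" .
qed (auto simp: pm_def sets_point_measure)

private lemma prob_pm: "finite F \<Longrightarrow> F \<subseteq> E \<Longrightarrow> prob_space (pm F)"
proof
  assume F: "finite F" "F \<subseteq> E"
  have "emeasure (pm F) (space (pm F)) = (\<Sum>A\<in>Pow F. ennreal (a F A))"
    using F unfolding pm_def by (subst emeasure_point_measure_finite) (auto simp: space_point_measure)
  also have "\<dots> = ennreal (\<Sum>A\<in>Pow F. a F A)" using F by (intro sum_ennreal a_nonneg) auto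
  also have "(\<Sum>A\<in>Pow F. a F A) = 1" using a_consistent[of F "{}" "{}"] F a_empty by simp
  finally show "emeasure (pm F) (space (pm F)) = 1" by simp
qed

private lemma PF_projective:
  assumes "J \<subseteq> H" "finite H" "H \<subseteq> E"
  shows "PF J = distr (PF H) (PiM J (\<lambda>_. borel)) (\<lambda>f. restrict f J)"
proof -
  have 1: "cfg_real J \<in> measurable (count_space (Pow J)) (PiM J (\<lambda>_. borel))"
    by (auto simp: cfg_real_def space_PiM)
  have 2: "(\<lambda>A. A \<inter> J) \<in> measurable (pm H) (count_space (Pow J))"
    by (auto simp: pm_def)
  have "distr (PF H) (PiM J (\<lambda>_. borel)) (\<lambda>f. restrict f J) = distr (pm H) (PiM J (\<lambda>_. borel)) ((\<lambda>f. restrict f J) \<circ> cfg_real H)"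
    unfolding PF_def using assms by (intro distr_distr measurable_restrict_subset cfg_real_measurable)
  also have "(\<lambda>f. restrict f J) \<circ> cfg_real H = cfg_real J \<circ> (\<lambda>A. A \<inter> J)"
    using assms by (auto simp: cfg_real_def fun_eq_iff restrict_def)
  also have "distr (pm H) (PiM J (\<lambda>_. borel)) (cfg_real J \<circ> (\<lambda>A. A \<inter> J))
      = distr (distr (pm H) (count_space (Pow J)) (\<lambda>A. A \<inter> J)) (PiM J (\<lambda>_. borel)) (cfg_real J)"
    by (rule distr_distr[symmetric, OF 1 2])
  also have "\<dots> = PF J" unfolding pm_restrict[OF assms] PF_def ..
  finally show ?thesis ..
qed

text \<open>Kolmogorov extension. The projective limit theorem is applied to real coordinates, an
  open edge being coded by \<open>1\<close> and a closed one by \<open>0\<close>; the map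
  \<open>\<pi>\<close> then decodes the limit into configurations.\<close>

lemma ex_measure_with_cylinders:
  "\<exists>\<mu>. prob_space \<mu> \<and> sets \<mu> = sets (CS E) \<and>
    (\<forall>F A. finite F \<longrightarrow> F \<subseteq> E \<longrightarrow> A \<subseteq> F \<longrightarrow> pcyl \<mu> F A = a F A)"
proof -
  interpret polish_projective E PF
  proof (intro polish_projective.intro projective_family.intro)
    show "PF J = distr (PF H) (PiM J (\<lambda>_. borel)) (\<lambda>f. restrict f J)"
      if "J \<subseteq> H" "finite H" "H \<subseteq> E" for J H by (rule PF_projective[OF that])
    show "prob_space (PF J)" if "finite J" "J \<subseteq> E" for J
      unfolding PF_def by (intro prob_space.prob_space_distr prob_pm cfg_real_measurable that)
  qed
  define \<pi> where "\<pi> x = (\<lambda>e\<in>E. x e = (1::real))" for x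
  have m: "\<pi> \<in> measurable lim (CS E)"
    unfolding \<pi>_def
  proof (rule measurable_restrict)
    fix e assume e: "e \<in> E"
    have [measurable]: "(\<lambda>x. x e) \<in> measurable lim borel"
      using measurable_component_singleton[OF e, of "\<lambda>_. borel :: real measure"]
      by (simp add: measurable_cong_sets[OF sets_lim refl])
    show "(\<lambda>x. x e = 1) \<in> measurable lim (count_space UNIV)" by measurable
  qed
  define \<mu> where "\<mu> = distr lim (CS E) \<pi>"
  have "prob_space \<mu>" unfolding \<mu>_def by (rule P.prob_space_distr[OF m])
  moreover have "sets \<mu> = sets (CS E)" by (simp add: \<mu>_def)
  moreover have "pcyl \<mu> F A = a F A"
    if F: "finite F" "F \<subseteq> E" "A \<subseteq> F" for F A
  proof -
    let ?X = "{x \<in> space (PiM F (\<lambda>_. borel :: real measure)). \<forall>e\<in>F. (x e = 1) = (e \<in> A)}"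
    have X: "?X \<in> sets (PiM F (\<lambda>_. borel))"
    proof (rule sets.sets_Collect_finite_All[OF _ F(1)])
      fix e assume e: "e \<in> F"
      have [measurable]: "(\<lambda>x. x e) \<in> borel_measurable (PiM F (\<lambda>_. borel :: real measure))"
        using e by (rule measurable_component_singleton)
      show "{x \<in> space (PiM F (\<lambda>_. borel :: real measure)). (x e = 1) = (e \<in> A)} \<in> sets (PiM F (\<lambda>_. borel))"
        by measurable
    qed
    have "pcyl \<mu> F A = measure lim (\<pi> -` {\<omega> \<in> space (CS E). {e\<in>F. \<omega> e} = A} \<inter> space lim)"
      unfolding \<mu>_def using measurable_local[OF F(1,2), of "\<lambda>B. B = A"] m by (subst measure_distr) auto
    also have "\<pi> -` {\<omega> \<in> space (CS E). {e\<in>F. \<omega> e} = A} \<inter> space lim = prod_emb E (\<lambda>_. borel) F ?X"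
    proof -
      have *: "{e\<in>F. \<pi> x e} = A \<longleftrightarrow> (\<forall>e\<in>F. (x e = 1) = (e \<in> A))" for x
        using F by (auto simp: \<pi>_def)
      show ?thesis
        using F by (auto simp: * prod_emb_def space_PiM \<pi>_def PiE_iff extensional_def)
    qed
    also have "measure lim \<dots> = measure (PF F) ?X" by (rule measure_lim_emb[OF F(2,1) X])
    also have "\<dots> = measure (pm F) (cfg_real F -` ?X \<inter> space (pm F))"
      unfolding PF_def by (rule measure_distr[OF cfg_real_measurable X])
    also have "cfg_real F -` ?X \<inter> space (pm F) = {A}"
      using F by (auto simp: cfg_real_def pm_def space_point_measure space_PiM)
    also have "measure (pm F) {A} = a F A"
      using F a_nonneg unfolding pm_def by (subst measure_point_measure_finite_if) auto
    finally show ?thesis .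
  qed
  ultimately show ?thesis by blast
qed

end

subsection \<open>Weak convergence from cylinder probabilities\<close>

lemma measure_eq_if_cylinders_eq:
  assumes M: "prob_space M" "sets M = sets (CS E)" and N: "prob_space N" "sets N = sets (CS E)"
    and eq: "\<And>F A. finite F \<Longrightarrow> F \<subseteq> E \<Longrightarrow> A \<subseteq> F \<Longrightarrow>
      pcyl M F A = pcyl N F A"
  shows "M = N"
proof (rule measure_eqI_PiM_infinite[OF M(2) N(2)])
  interpret M: prob_space M by fact
  interpret N: prob_space N by fact
  show "finite_measure M" by unfold_locales
  fix J X assume J: "finite J" "J \<subseteq> E" "\<And>i. i \<in> J \<Longrightarrow> X i \<in> sets (count_space (UNIV :: bool set))"
  have sp: "space M = space (CS E)" "space N = space (CS E)" by (rule sets_eq_imp_space_eq[OF M(2)], rule sets_eq_imp_space_eq[OF N(2)])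
  have e: "prod_emb E (\<lambda>_. count_space UNIV) J (Pi\<^sub>E J X) = {\<omega> \<in> space (CS E). \<forall>e\<in>J. (e \<in> {e\<in>J. \<omega> e}) \<in> X e}"
    by (auto simp: prod_emb_def restrict_PiE_iff space_PiM)
  have "measure M (prod_emb E (\<lambda>_. count_space UNIV) J (Pi\<^sub>E J X)) = measure N (prod_emb E (\<lambda>_. count_space UNIV) J (Pi\<^sub>E J X))"
    unfolding e
    using prob_local_sum[OF M J(1,2), of "\<lambda>B. \<forall>e\<in>J. (e \<in> B) \<in> X e"] prob_local_sum[OF N J(1,2), of "\<lambda>B. \<forall>e\<in>J. (e \<in> B) \<in> X e"]
      eq[OF J(1,2)] unfolding sp by simp
  then show "emeasure M (prod_emb E (\<lambda>_. count_space UNIV) J (Pi\<^sub>E J X)) = emeasure N (prod_emb E (\<lambda>_. count_space UNIV) J (Pi\<^sub>E J X))"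
    by (simp add: M.emeasure_eq_measure N.emeasure_eq_measure)
qed

text \<open>The configuration space is compact, so a continuous function depends on finitely many
  edges up to a uniform error. The finite subcover consists of cylinders on which \<open>f\<close>
  stays within \<open>\<epsilon> / 2\<close> of its value at a centre, and two configurations
  agreeing on all edges involved share such a cylinder.\<close>

lemma uniformly_local:
  fixes f :: "('e \<Rightarrow> bool) \<Rightarrow> real"
  assumes f: "continuous_map (product_topology (\<lambda>_. discrete_topology UNIV) E) euclideanreal f" and \<epsilon>: "0 < \<epsilon>"
  shows "\<exists>F. finite F \<and> F \<subseteq> E \<and> (\<forall>\<omega>\<in>E \<rightarrow>\<^sub>E UNIV. \<forall>\<omega>'\<in>E \<rightarrow>\<^sub>E UNIV. (\<forall>e\<in>F. \<omega> e = \<omega>' e) \<longrightarrow> \<bar>f \<omega> - f \<omega>'\<bar> < \<epsilon>)"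
proof -
  let ?X = "product_topology (\<lambda>_. discrete_topology (UNIV :: bool set)) E"
  have ts: "topspace ?X = E \<rightarrow>\<^sub>E UNIV" by simp
  have "\<exists>F. finite F \<and> F \<subseteq> E \<and> (\<forall>\<omega>'\<in>E \<rightarrow>\<^sub>E UNIV. (\<forall>e\<in>F. \<omega>' e = \<omega> e) \<longrightarrow> \<bar>f \<omega>' - f \<omega>\<bar> < \<epsilon> / 2)"
    if \<omega>: "\<omega> \<in> E \<rightarrow>\<^sub>E UNIV" for \<omega>
  proof -
    have "openin ?X {\<omega>' \<in> topspace ?X. f \<omega>' \<in> ball (f \<omega>) (\<epsilon> / 2)}"
      by (rule openin_continuous_map_preimage[OF f]) simp
    moreover have "\<omega> \<in> {\<omega>' \<in> topspace ?X. f \<omega>' \<in> ball (f \<omega>) (\<epsilon> / 2)}"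
      using \<omega> \<epsilon> ts by auto
    ultimately obtain U where U: "finite {i \<in> E. U i \<noteq> UNIV}" "\<omega> \<in> Pi\<^sub>E E U"
      "Pi\<^sub>E E U \<subseteq> {\<omega>' \<in> topspace ?X. f \<omega>' \<in> ball (f \<omega>) (\<epsilon> / 2)}"
      unfolding openin_product_topology_alt topspace_discrete_topology by meson
    show ?thesis
    proof (intro exI[of _ "{i \<in> E. U i \<noteq> UNIV}"] conjI ballI impI)
      fix \<omega>' assume \<omega>': "\<omega>' \<in> E \<rightarrow>\<^sub>E UNIV" "\<forall>e\<in>{i \<in> E. U i \<noteq> UNIV}. \<omega>' e = \<omega> e"
      have "\<omega>' e \<in> U e" if "e \<in> E" for e
      proof (cases "U e = UNIV")
        case False
        then have "\<omega>' e = \<omega> e" using \<omega>'(2) that by blast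
        then show ?thesis using PiE_mem[OF U(2) that] by simp
      qed simp
      then have "\<omega>' \<in> Pi\<^sub>E E U" using \<omega>'(1) by (auto simp: PiE_iff)
      then have "f \<omega>' \<in> ball (f \<omega>) (\<epsilon> / 2)" using U(3) by blast
      then show "\<bar>f \<omega>' - f \<omega>\<bar> < \<epsilon> / 2" by (simp add: dist_real_def abs_minus_commute)
    qed (use U in auto)
  qed
  then obtain F where F: "\<And>\<omega>. \<omega> \<in> E \<rightarrow>\<^sub>E UNIV \<Longrightarrow> finite (F \<omega>) \<and> F \<omega> \<subseteq> E \<and>
      (\<forall>\<omega>'\<in>E \<rightarrow>\<^sub>E UNIV. (\<forall>e\<in>F \<omega>. \<omega>' e = \<omega> e) \<longrightarrow> \<bar>f \<omega>' - f \<omega>\<bar> < \<epsilon> / 2)" by metis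
  define V where "V \<omega> = (\<Pi>\<^sub>E e\<in>E. if e \<in> F \<omega> then {\<omega> e} else UNIV)" for \<omega>
  have V: "openin ?X (V \<omega>)" if "\<omega> \<in> E \<rightarrow>\<^sub>E UNIV" for \<omega>
    unfolding V_def openin_PiE_gen using F[OF that] by (auto intro: finite_subset)
  have "compact_space ?X" by (simp add: compact_space_product_topology compact_space_discrete_topology)
  moreover have "\<forall>W\<in>V ` (E \<rightarrow>\<^sub>E UNIV). openin ?X W" using V by auto
  moreover have "topspace ?X \<subseteq> \<Union>(V ` (E \<rightarrow>\<^sub>E UNIV))"
  proof
    fix \<omega> assume "\<omega> \<in> topspace ?X"
    then have \<omega>: "\<omega> \<in> E \<rightarrow>\<^sub>E UNIV" unfolding ts .
    moreover have "\<omega> \<in> V \<omega>" unfolding V_def using \<omega> by (intro PiE_I) auto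
    ultimately show "\<omega> \<in> \<Union>(V ` (E \<rightarrow>\<^sub>E UNIV))" by blast
  qed
  ultimately obtain \<W> where "finite \<W>" "\<W> \<subseteq> V ` (E \<rightarrow>\<^sub>E UNIV)" "topspace ?X \<subseteq> \<Union>\<W>"
    unfolding compact_space_alt by meson
  then obtain T where T: "finite T" "T \<subseteq> E \<rightarrow>\<^sub>E UNIV" "E \<rightarrow>\<^sub>E UNIV \<subseteq> \<Union>(V ` T)"
    unfolding ts by (metis finite_subset_image)
  show ?thesis
  proof (intro exI[of _ "\<Union>(F ` T)"] conjI ballI impI)
    fix \<omega> \<omega>' :: "'e \<Rightarrow> bool" assume w: "\<omega> \<in> E \<rightarrow>\<^sub>E UNIV" "\<omega>' \<in> E \<rightarrow>\<^sub>E UNIV" "\<forall>e\<in>\<Union>(F ` T). \<omega> e = \<omega>' e"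
    obtain t where t: "t \<in> T" "\<omega> \<in> V t" using T w by blast
    have Ft: "F t \<subseteq> E" using F T t by blast
    have "\<forall>e\<in>F t. \<omega> e = t e"
    proof
      fix e assume "e \<in> F t"
      then have "e \<in> E" using Ft by blast
      then have "\<omega> e \<in> (if e \<in> F t then {t e} else UNIV)" using t(2) unfolding V_def by (rule PiE_mem[rotated])
      then show "\<omega> e = t e" using \<open>e \<in> F t\<close> by simp
    qed
    moreover have "\<forall>e\<in>F t. \<omega>' e = t e" using calculation w t by auto
    ultimately have "\<bar>f \<omega> - f t\<bar> < \<epsilon> / 2" "\<bar>f \<omega>' - f t\<bar> < \<epsilon> / 2" using F[of t] T t w by blast+
    then show "\<bar>f \<omega> - f \<omega>'\<bar> < \<epsilon>" by linarith
  next
    have FT: "finite (F t) \<and> F t \<subseteq> E" if "t \<in> T" for t using F T that by blast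
    show "finite (\<Union>(F ` T))" using T(1) FT by (intro finite_UN_I) blast+
    show "\<Union>(F ` T) \<subseteq> E" using FT by blast
  qed
qed

text \<open>By \<open>uniformly_local\<close>, closing all edges outside a suitable finite set
  \<open>F n\<close> changes \<open>f\<close> by less than \<open>1 / (n + 1)\<close>. This exhibits
  \<open>f\<close> as a limit of functions of finitely many edges.\<close>

lemma measurable_continuous_config:
  fixes f :: "('e \<Rightarrow> bool) \<Rightarrow> real"
  assumes f: "continuous_map (product_topology (\<lambda>_. discrete_topology UNIV) E) euclideanreal f"
  shows "f \<in> borel_measurable (CS E)"
proof -
  have "\<exists>F. finite F \<and> F \<subseteq> E \<and> (\<forall>\<omega>\<in>E \<rightarrow>\<^sub>E UNIV. \<forall>\<omega>'\<in>E \<rightarrow>\<^sub>E UNIV. (\<forall>e\<in>F. \<omega> e = \<omega>' e) \<longrightarrow> \<bar>f \<omega> - f \<omega>'\<bar> < inverse (real (Suc n)))"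
    for n using uniformly_local[OF f, of "inverse (real (Suc n))"] by simp
  then obtain F where F: "\<And>n. finite (F n)" "\<And>n. F n \<subseteq> E"
    "\<And>n \<omega> \<omega>'. \<omega> \<in> E \<rightarrow>\<^sub>E UNIV \<Longrightarrow> \<omega>' \<in> E \<rightarrow>\<^sub>E UNIV \<Longrightarrow> (\<forall>e\<in>F n. \<omega> e = \<omega>' e) \<Longrightarrow> \<bar>f \<omega> - f \<omega>'\<bar> < inverse (real (Suc n))"
    by metis
  define g where "g n \<omega> = f (\<lambda>e\<in>E. e \<in> {e\<in>F n. \<omega> e})" for n \<omega>
  have g: "g n \<in> borel_measurable (CS E)" for n
  proof (rule measurableI)
    fix A :: "real set"
    have "g n -` A \<inter> space (CS E) = {\<omega> \<in> space (CS E). f (\<lambda>e\<in>E. e \<in> {e\<in>F n. \<omega> e}) \<in> A}"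
      by (auto simp: g_def)
    then show "g n -` A \<inter> space (CS E) \<in> sets (CS E)"
      using measurable_local[OF F(1)[of n] F(2)[of n], of "\<lambda>B. f (\<lambda>e\<in>E. e \<in> B) \<in> A"] by simp
  qed simp
  show ?thesis
  proof (rule borel_measurable_LIMSEQ_real[of _ g])
    fix \<omega> assume "\<omega> \<in> space (CS E)"
    then have \<omega>: "\<omega> \<in> E \<rightarrow>\<^sub>E UNIV" by (simp add: space_PiM)
    have "\<bar>g n \<omega> - f \<omega>\<bar> < inverse (real (Suc n))" for n
      unfolding g_def using F(2)[of n] \<omega> by (intro F(3)) auto
    then have "norm (g n \<omega> - f \<omega>) \<le> inverse (real (Suc n))" for n
      unfolding real_norm_def by (rule less_imp_le)
    then have "(\<lambda>n. g n \<omega> - f \<omega>) \<longlonglongrightarrow> 0"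
      by (intro Lim_null_comparison[OF _ LIMSEQ_inverse_real_of_nat] always_eventually allI)
    then show "(\<lambda>n. g n \<omega>) \<longlonglongrightarrow> f \<omega>" by (rule LIM_zero_cancel)
  qed (rule g)
qed

text \<open>Up to \<open>r / 3\<close>, uniformly over all probability measures, the integrand
  depends on finitely many edges. Its integral is then a finite combination of cylinder
  probabilities.\<close>

lemma weakly_converges_if_cylinders:
  fixes M :: "nat \<Rightarrow> ('e \<Rightarrow> bool) measure"
  assumes M: "\<And>n. prob_space (M n)" "\<And>n. sets (M n) = sets (CS E)" and N: "prob_space N" "sets N = sets (CS E)"
    and conv: "\<And>F A. finite F \<Longrightarrow> F \<subseteq> E \<Longrightarrow> A \<subseteq> F \<Longrightarrow>
      (\<lambda>n. pcyl (M n) F A) \<longlonglongrightarrow> pcyl N F A"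
  shows "weakly_converges (product_topology (\<lambda>_. discrete_topology UNIV) E) M N"
  unfolding weakly_converges_def
proof (intro allI impI)
  fix f :: "('e \<Rightarrow> bool) \<Rightarrow> real"
  let ?X = "product_topology (\<lambda>_. discrete_topology (UNIV :: bool set)) E"
  assume "continuous_map ?X euclideanreal f \<and> bounded (f ` topspace ?X)"
  then have f: "continuous_map ?X euclideanreal f" and bdd: "bounded (f ` (E \<rightarrow>\<^sub>E UNIV))" by auto
  obtain C where C: "\<And>\<omega>. \<omega> \<in> E \<rightarrow>\<^sub>E UNIV \<Longrightarrow> \<bar>f \<omega>\<bar> \<le> C" using bdd by (auto simp: bounded_iff)
  have fm: "f \<in> borel_measurable (CS E)" by (rule measurable_continuous_config[OF f])
  show "(\<lambda>n. integral\<^sup>L (M n) f) \<longlonglongrightarrow> integral\<^sup>L N f"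
  proof (rule LIMSEQ_I)
    fix r :: real assume r: "0 < r"
    obtain F where F: "finite F" "F \<subseteq> E" "\<And>\<omega> \<omega>'. \<omega> \<in> E \<rightarrow>\<^sub>E UNIV \<Longrightarrow> \<omega>' \<in> E \<rightarrow>\<^sub>E UNIV \<Longrightarrow>
        (\<forall>e\<in>F. \<omega> e = \<omega>' e) \<Longrightarrow> \<bar>f \<omega> - f \<omega>'\<bar> < r / 3"
      using uniformly_local[OF f, of "r / 3"] r by (metis divide_pos_pos zero_less_numeral)
    define h where "h B = f (\<lambda>e\<in>E. e \<in> B)" for B
    have approx: "\<bar>integral\<^sup>L L f - (\<Sum>A\<in>Pow F. h A * pcyl L F A)\<bar> \<le> r / 3"
      if L: "prob_space L" "sets L = sets (CS E)" for L
    proof -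
      interpret prob_space L by fact
      have sp: "space L = E \<rightarrow>\<^sub>E UNIV" using sets_eq_imp_space_eq[OF L(2)] by (simp add: space_PiM)
      note il = integral_local[OF L F(1,2), of h]
      have int: "integrable L f"
        using fm C sp by (intro integrable_const_bound[of _ C]) (auto simp: measurable_cong_sets[OF L(2) refl])
      have "\<bar>integral\<^sup>L L f - (\<integral>\<omega>. h {e\<in>F. \<omega> e} \<partial>L)\<bar> = \<bar>\<integral>\<omega>. f \<omega> - h {e\<in>F. \<omega> e} \<partial>L\<bar>"
        using int il(1) by simp
      also have "\<dots> \<le> (\<integral>\<omega>. \<bar>f \<omega> - h {e\<in>F. \<omega> e}\<bar> \<partial>L)" by (rule integral_abs_bound)
      also have "\<dots> \<le> (\<integral>\<omega>. r / 3 \<partial>L)"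
      proof (rule integral_mono)
        fix \<omega> assume "\<omega> \<in> space L"
        then have "\<bar>f \<omega> - f (\<lambda>e\<in>E. e \<in> {e\<in>F. \<omega> e})\<bar> < r / 3"
          using F(2) unfolding sp by (intro F(3)) auto
        then show "\<bar>f \<omega> - h {e\<in>F. \<omega> e}\<bar> \<le> r / 3" by (simp add: h_def)
      qed (use int il(1) in auto)
      also have "\<dots> = r / 3" by (simp add: prob_space)
      finally show ?thesis unfolding il(2) .
    qed
    have "(\<lambda>n. \<Sum>A\<in>Pow F. h A * pcyl (M n) F A)
        \<longlonglongrightarrow> (\<Sum>A\<in>Pow F. h A * pcyl N F A)"
      using F by (intro tendsto_sum tendsto_mult tendsto_const conv) auto
    from LIMSEQ_D[OF this, of "r / 3"] r obtain n0 where n0: "\<And>n. n \<ge> n0 \<Longrightarrow>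
        \<bar>(\<Sum>A\<in>Pow F. h A * pcyl (M n) F A)
          - (\<Sum>A\<in>Pow F. h A * pcyl N F A)\<bar> < r / 3"
      by auto
    show "\<exists>no. \<forall>n\<ge>no. norm (integral\<^sup>L (M n) f - integral\<^sup>L N f) < r"
    proof (intro exI[of _ n0] allI impI)
      fix n assume "n \<ge> n0"
      from n0[OF this] approx[OF M(1,2), of n] approx[OF N]
      show "norm (integral\<^sup>L (M n) f - integral\<^sup>L N f) < r" unfolding real_norm_def by linarith
    qed
  qed
qed

text \<open>Cylinders over finitely many edges are both open and closed, so their indicators are
  admissible test functions.\<close>

lemma cylinders_if_weakly_converges:
  fixes M :: "nat \<Rightarrow> ('e \<Rightarrow> bool) measure"
  assumes M: "\<And>n. prob_space (M n)" "\<And>n. sets (M n) = sets (CS E)" and N: "prob_space N" "sets N = sets (CS E)"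
    and conv: "weakly_converges (product_topology (\<lambda>_. discrete_topology UNIV) E) M N"
    and F: "finite F" "F \<subseteq> E"
  shows "(\<lambda>n. pcyl (M n) F A) \<longlonglongrightarrow> pcyl N F A"
proof -
  let ?X = "product_topology (\<lambda>_. discrete_topology (UNIV :: bool set)) E"
  define f :: "('e \<Rightarrow> bool) \<Rightarrow> real" where "f \<omega> = of_bool ({e\<in>F. \<omega> e} = A)" for \<omega>
  have "continuous_map ?X euclideanreal f"
    unfolding continuous_map_def
  proof (intro conjI allI impI)
    fix U :: "real set"
    show "openin ?X {\<omega> \<in> topspace ?X. f \<omega> \<in> U}"
      unfolding openin_product_topology_alt
    proof (intro ballI)
      fix \<omega> assume \<omega>: "\<omega> \<in> {\<omega> \<in> topspace ?X. f \<omega> \<in> U}"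
      show "\<exists>V. finite {i \<in> E. V i \<noteq> topspace (discrete_topology UNIV)} \<and> (\<forall>i\<in>E. openin (discrete_topology UNIV) (V i))
          \<and> \<omega> \<in> Pi\<^sub>E E V \<and> Pi\<^sub>E E V \<subseteq> {\<omega> \<in> topspace ?X. f \<omega> \<in> U}"
      proof (intro exI[of _ "\<lambda>e. if e \<in> F then {\<omega> e} else UNIV"] conjI)
        show "finite {i \<in> E. (if i \<in> F then {\<omega> i} else UNIV) \<noteq> topspace (discrete_topology UNIV)}"
          by (rule finite_subset[OF _ F(1)]) auto
        show "(\<Pi>\<^sub>E e\<in>E. if e \<in> F then {\<omega> e} else UNIV) \<subseteq> {\<omega> \<in> topspace ?X. f \<omega> \<in> U}"
        proof
          fix \<omega>' assume \<omega>': "\<omega>' \<in> (\<Pi>\<^sub>E e\<in>E. if e \<in> F then {\<omega> e} else UNIV)"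
          have "\<omega>' e = \<omega> e" if "e \<in> F" for e
          proof -
            have "e \<in> E" using that F by blast
            then have "\<omega>' e \<in> (if e \<in> F then {\<omega> e} else UNIV)" by (rule PiE_mem[OF \<omega>'])
            then show ?thesis using that by simp
          qed
          then have "{e\<in>F. \<omega>' e} = {e\<in>F. \<omega> e}" by auto
          then show "\<omega>' \<in> {\<omega> \<in> topspace ?X. f \<omega> \<in> U}"
            using \<omega> \<omega>' by (auto simp: f_def PiE_iff)
        qed
      qed (use \<omega> in auto)
    qed
  qed auto
  moreover have "bounded (f ` topspace ?X)"
    by (rule bounded_subset[of "{0..1}"]) (auto simp: f_def)
  ultimately have "(\<lambda>n. integral\<^sup>L (M n) f) \<longlonglongrightarrow> integral\<^sup>L N f"
    using conv unfolding weakly_converges_def by blast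
  moreover have "integral\<^sup>L L f = pcyl L F A"
    if L: "prob_space L" "sets L = sets (CS E)" for L
  proof -
    have "integral\<^sup>L L f = (\<integral>\<omega>. indicator {\<omega> \<in> space L. {e\<in>F. \<omega> e} = A} \<omega> \<partial>L)"
      by (rule Bochner_Integration.integral_cong) (auto simp: f_def indicator_def)
    moreover have "{\<omega> \<in> space L. {e\<in>F. \<omega> e} = A} \<inter> space L = {\<omega> \<in> space L. {e\<in>F. \<omega> e} = A}" by auto
    ultimately show ?thesis by simp
  qed
  ultimately show ?thesis using M N by simp
qed

section \<open>Infinite-volume random-cluster measures\<close>

lemma config_space_CS: "config_space G = CS (edges G)"
  by (simp add: config_space_def)

lemma open_edges_bij: "bij_betw (open_edges H) (edges H \<rightarrow>\<^sub>E UNIV) (Pow (edges H))"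
proof (rule bij_betw_byWitness[where f' = "\<lambda>A. \<lambda>e\<in>edges H. e \<in> A"])
  show "\<forall>\<omega>\<in>edges H \<rightarrow>\<^sub>E UNIV. (\<lambda>e\<in>edges H. e \<in> open_edges H \<omega>) = \<omega>"
  proof
    fix \<omega> :: "'a set \<Rightarrow> bool" assume "\<omega> \<in> edges H \<rightarrow>\<^sub>E UNIV"
    then have "\<omega> e = undefined" if "e \<notin> edges H" for e using that by (auto intro: PiE_arb)
    then show "(\<lambda>e\<in>edges H. e \<in> open_edges H \<omega>) = \<omega>" by (auto simp: fun_eq_iff open_edges_def restrict_def)
  qed
qed (auto simp: open_edges_def)

lemma sum_configs:
  fixes h :: "'a set set \<Rightarrow> real"
  shows "(\<Sum>\<omega>\<in>edges H \<rightarrow>\<^sub>E UNIV. h (open_edges H \<omega>)) = sum h (Pow (edges H))"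
  by (rule sum.reindex_bij_betw[OF open_edges_bij])

context
  fixes G H :: "'a graph" and p q :: real and k :: "('a set \<Rightarrow> bool) \<Rightarrow> nat" and k' :: "'a set set \<Rightarrow> nat"
  assumes H: "finite_graph H" "subgraph H G" and p: "0 \<le> p" "p \<le> 1" and q: "1 \<le> q"
    and k: "\<And>\<omega>. k \<omega> = k' (open_edges H \<omega>)"
begin

private abbreviation "\<Omega> \<equiv> edges H \<rightarrow>\<^sub>E (UNIV :: bool set)"
private abbreviation "ZH \<equiv> sum (rcw p q (edges H) k') (Pow (edges H))"

private lemma finE: "finite (edges H)" by (rule finite_edges[OF H(1)])

private lemma fin\<Omega>: "finite \<Omega>" using finE by (intro finite_PiE) auto

private lemma Zpos: "0 < ZH" using p q finE by (intro rcw_sum_pos) auto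

private lemma weight: "rc_weight p q H k \<omega> = rcw p q (edges H) k' (open_edges H \<omega>)"
proof -
  have "{e \<in> edges H. \<not> \<omega> e} = edges H - open_edges H \<omega>" by (auto simp: open_edges_def)
  then show ?thesis by (simp add: rc_weight_def rcw_def k open_edges_def)
qed

private lemma rc_measure_eq:
  "rc_measure p q H k = point_measure \<Omega> (\<lambda>\<omega>. ennreal (rcw p q (edges H) k' (open_edges H \<omega>) / ZH))"
  by (simp add: rc_measure_def weight sum_configs[of "rcw p q (edges H) k'"])

private lemma ratio_nonneg: "0 \<le> rcw p q (edges H) k' A / ZH"
  using Zpos p q by (simp add: rcw_nonneg)

private lemma sum_ratio: "(\<Sum>\<omega>\<in>\<Omega>. rcw p q (edges H) k' (open_edges H \<omega>) / ZH) = 1"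
  using sum_configs[of "\<lambda>A. rcw p q (edges H) k' A / ZH" H] Zpos by (simp flip: sum_divide_distrib)

private abbreviation "ext \<equiv> \<lambda>\<omega>. restrict (\<lambda>e. e \<in> edges H \<and> \<omega> e) (edges G)"

private lemma ext_measurable: "ext \<in> measurable (rc_measure p q H k) (CS (edges G))"
  by (auto simp: rc_measure_eq space_PiM)

lemma extended_prob_space: "prob_space (extend_measure_closed G H (rc_measure p q H k))"
  unfolding extend_measure_closed_def config_space_CS
proof (rule prob_space.prob_space_distr[OF _ ext_measurable], rule prob_spaceI)
  have "emeasure (rc_measure p q H k) (space (rc_measure p q H k))
    = (\<Sum>\<omega>\<in>\<Omega>. ennreal (rcw p q (edges H) k' (open_edges H \<omega>) / ZH))"
    using fin\<Omega> unfolding rc_measure_eq by (subst emeasure_point_measure_finite) (auto simp: space_point_measure)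
  also have "\<dots> = 1" using ratio_nonneg by (subst sum_ennreal) (auto simp: sum_ratio)
  finally show "emeasure (rc_measure p q H k) (space (rc_measure p q H k)) = 1" .
qed

lemma extended_sets: "sets (extend_measure_closed G H (rc_measure p q H k)) = sets (CS (edges G))"
  by (simp add: extend_measure_closed_def config_space_CS)

lemma extended_local:
  assumes F: "finite F" "F \<subseteq> edges G"
  shows "measure (extend_measure_closed G H (rc_measure p q H k))
      {\<omega> \<in> space (extend_measure_closed G H (rc_measure p q H k)). Q {e\<in>F. \<omega> e}}
    = rcE p q (edges H) k' (\<lambda>A. of_bool (Q (A \<inter> F)))"
proof -
  have ev: "{e\<in>F. ext \<omega> e} = open_edges H \<omega> \<inter> F" for \<omega>
    using F by (auto simp: open_edges_def)
  have "measure (extend_measure_closed G H (rc_measure p q H k))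
      {\<omega> \<in> space (extend_measure_closed G H (rc_measure p q H k)). Q {e\<in>F. \<omega> e}}
    = measure (rc_measure p q H k) (ext -` {\<omega> \<in> space (CS (edges G)). Q {e\<in>F. \<omega> e}} \<inter> space (rc_measure p q H k))"
    unfolding extend_measure_closed_def config_space_CS space_distr
    by (rule measure_distr[OF ext_measurable measurable_local[OF F]])
  also have "ext -` {\<omega> \<in> space (CS (edges G)). Q {e\<in>F. \<omega> e}} \<inter> space (rc_measure p q H k)
      = {\<omega> \<in> \<Omega>. Q (open_edges H \<omega> \<inter> F)}"
    using ev by (auto simp: rc_measure_eq space_point_measure space_PiM)
  also have "measure (rc_measure p q H k) \<dots>
      = (\<Sum>\<omega>\<in>{\<omega> \<in> \<Omega>. Q (open_edges H \<omega> \<inter> F)}. rcw p q (edges H) k' (open_edges H \<omega>) / ZH)"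
    unfolding rc_measure_eq by (subst measure_point_measure_finite_if) (use fin\<Omega> ratio_nonneg in auto)
  also have "\<dots> = (\<Sum>\<omega>\<in>\<Omega>. (\<lambda>A. of_bool (Q (A \<inter> F)) * (rcw p q (edges H) k' A / ZH)) (open_edges H \<omega>))"
    using fin\<Omega> by (intro sum.mono_neutral_cong_left) auto
  also have "\<dots> = (\<Sum>A\<in>Pow (edges H). of_bool (Q (A \<inter> F)) * (rcw p q (edges H) k' A / ZH))"
    by (rule sum_configs)
  also have "\<dots> = rcE p q (edges H) k' (\<lambda>A. of_bool (Q (A \<inter> F)))"
    by (simp add: rcE_def wE_def sum_divide_distrib mult.commute)
  finally show ?thesis .
qed

end

section \<open>Exhaustions and limits that do not depend on them\<close>

definition ind :: "'a graph \<Rightarrow> 'a set \<Rightarrow> 'a graph" where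
  "ind G W = Graph W {e\<in>edges G. e \<subseteq> W}"

lemma ind_simps [simp]: "verts (ind G W) = W" "edges (ind G W) = {e\<in>edges G. e \<subseteq> W}"
  by (simp_all add: ind_def)

lemma induced_ind: "W \<subseteq> verts G \<Longrightarrow> induced_subgraph (ind G W) G"
  by (simp add: induced_subgraph_def)

lemma finite_graph_ind: "simple_graph G \<Longrightarrow> finite W \<Longrightarrow> finite_graph (ind G W)"
  by (auto simp: finite_graph_def simple_graph_def)

lemma induced_is_subgraph: "induced_subgraph H G \<Longrightarrow> subgraph H G"
  by (auto simp: induced_subgraph_def subgraph_def)

lemma ex_induced_exhaustion:
  assumes G: "simple_graph G" "countable (verts G)" "verts G \<noteq> {}"
  shows "\<exists>H. exhausts H G \<and> (\<forall>n. induced_subgraph (H n) G)"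
proof -
  let ?f = "from_nat_into (verts G)"
  define H where "H n = ind G (?f ` {..n})" for n
  have r: "range ?f = verts G" using G by (intro range_from_nat_into) auto
  have ind: "induced_subgraph (H n) G" for n
    unfolding H_def using r by (intro induced_ind) auto
  have sub: "subgraph (H n) (H (Suc n))" for n
    by (auto simp: H_def subgraph_def)
  have "(\<Union>n. verts (H n)) = range ?f" by (auto simp: H_def)
  then have V: "(\<Union>n. verts (H n)) = verts G" by (simp only: r)
  have E: "(\<Union>n. edges (H n)) = edges G"
  proof (intro equalityI subsetI)
    fix e assume e: "e \<in> edges G"
    then obtain x y where xy: "e = {x, y}" "x \<in> verts G" "y \<in> verts G" using simple_edge[OF G(1)] by blast
    then have "x \<in> range ?f" "y \<in> range ?f" by (simp_all only: r)
    then obtain i j where "x = ?f i" "y = ?f j" by blast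
    then have "e \<in> edges (H (max i j))" using e xy by (auto simp: H_def)
    then show "e \<in> (\<Union>n. edges (H n))" by blast
  qed (auto simp: H_def)
  have "finite_graph (H n)" for n unfolding H_def by (intro finite_graph_ind G) auto
  then show ?thesis using ind sub V E unfolding exhausts_def by blast
qed

lemma exhausts_eventually:
  assumes H: "exhausts H G" and X: "finite X" "X \<subseteq> verts G" and Y: "finite Y" "Y \<subseteq> edges G"
  shows "\<forall>\<^sub>F n in sequentially. X \<subseteq> verts (H n) \<and> Y \<subseteq> edges (H n)"
proof -
  have "verts (H n) \<subseteq> verts (H (Suc n))" "edges (H n) \<subseteq> edges (H (Suc n))" for n
    using H by (auto simp: exhausts_def subgraph_def)
  then have vm: "verts (H m) \<subseteq> verts (H n)" and em: "edges (H m) \<subseteq> edges (H n)" if "m \<le> n" for m n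
    using lift_Suc_mono_le[of "\<lambda>n. verts (H n)" m n] lift_Suc_mono_le[of "\<lambda>n. edges (H n)" m n] that by auto
  have 1: "\<forall>\<^sub>F n in sequentially. x \<in> verts (H n)" if "x \<in> X" for x
  proof -
    have "x \<in> (\<Union>n. verts (H n))" using that X H by (auto simp: exhausts_def)
    then show ?thesis using vm unfolding eventually_sequentially by blast
  qed
  have 2: "\<forall>\<^sub>F n in sequentially. e \<in> edges (H n)" if "e \<in> Y" for e
  proof -
    have "e \<in> (\<Union>n. edges (H n))" using that Y H by (auto simp: exhausts_def)
    then show ?thesis using em unfolding eventually_sequentially by blast
  qed
  have "\<forall>\<^sub>F n in sequentially. \<forall>x\<in>X. x \<in> verts (H n)" "\<forall>\<^sub>F n in sequentially. \<forall>x\<in>Y. x \<in> edges (H n)"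
    using 1 2 X Y by (auto intro: eventually_ball_finite)
  then show ?thesis by eventually_elim auto
qed

lemma exhausts_finite: "exhausts H G \<Longrightarrow> finite_graph (H n)"
  by (simp add: exhausts_def)

lemma exhausts_subgraph: "exhausts H G \<Longrightarrow> subgraph (H n) G"
  by (auto simp: exhausts_def subgraph_def)

text \<open>The limit is the supremum of \<open>v\<close> over all good volumes. A sequence that is
  eventually good and whose values eventually dominate that of each good volume must converge to it,
  so all such sequences share one limit.\<close>

lemma tendsto_directed:
  fixes v :: "'k \<Rightarrow> real"
  assumes bdd: "\<And>K. good K \<Longrightarrow> v K \<le> C" and ne: "\<exists>K. good K"
  shows "\<exists>l. \<forall>s :: nat \<Rightarrow> 'k. (\<forall>\<^sub>F n in sequentially. good (s n)) \<longrightarrow>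
      (\<forall>K. good K \<longrightarrow> (\<forall>\<^sub>F n in sequentially. v K \<le> v (s n))) \<longrightarrow> (\<lambda>n. v (s n)) \<longlonglongrightarrow> l"
proof (intro exI allI impI)
  fix s :: "nat \<Rightarrow> 'k"
  assume good: "\<forall>\<^sub>F n in sequentially. good (s n)"
    and ev: "\<forall>K. good K \<longrightarrow> (\<forall>\<^sub>F n in sequentially. v K \<le> v (s n))"
  let ?L = "SUP K\<in>Collect good. v K"
  have b: "bdd_above (v ` Collect good)" using bdd by (auto intro!: bdd_aboveI[of _ C])
  show "(\<lambda>n. v (s n)) \<longlonglongrightarrow> ?L"
  proof (rule order_tendstoI)
    fix a assume "a < ?L"
    then obtain K where "good K" "a < v K" using less_cSUP_iff[OF _ b] ne by auto
    then have "\<forall>\<^sub>F n in sequentially. v K \<le> v (s n)" using ev by blast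
    then show "\<forall>\<^sub>F n in sequentially. a < v (s n)"
      by (rule eventually_mono) (use \<open>a < v K\<close> in linarith)
  next
    fix a assume "?L < a"
    then have "v K < a" if "good K" for K using cSUP_upper[OF _ b] that by fastforce
    then show "\<forall>\<^sub>F n in sequentially. v (s n) < a" by (rule eventually_mono[OF good])
  qed
qed

text \<open>The events that all edges of \<open>B\<close> are open are monotone in the volume; a
  general cylinder is not. It is reached by induction on the number of edges required to be closed:
  such a requirement is dropped, and the cylinder in which that edge is open is subtracted.\<close>

lemma limits_of_cylinders:
  fixes M :: "'s \<Rightarrow> nat \<Rightarrow> ('e \<Rightarrow> bool) measure"
  assumes M: "\<And>s n. s \<in> \<H> \<Longrightarrow> prob_space (M s n)" "\<And>s n. s \<in> \<H> \<Longrightarrow> sets (M s n) = sets (CS E)"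
    and inc: "\<And>B. finite B \<Longrightarrow> B \<subseteq> E \<Longrightarrow> \<exists>l. \<forall>s\<in>\<H>. (\<lambda>n. pcyl (M s n) B B) \<longlonglongrightarrow> l"
    and F: "finite F" "F \<subseteq> E" "A \<subseteq> F"
  shows "\<exists>l. \<forall>s\<in>\<H>. (\<lambda>n. pcyl (M s n) F A) \<longlonglongrightarrow> l"
  using F
proof (induction "card (F - A)" arbitrary: F A)
  case 0
  then have "F = A" by auto
  then show ?case using inc[of F] 0 by simp
next
  case (Suc m)
  then obtain e where e: "e \<in> F" "e \<notin> A" by (metis Diff_iff card.empty all_not_in_conv nat.distinct(1))
  have "F - A = insert e (F - {e} - A)" using e by auto
  then have "card (F - A) = Suc (card (F - {e} - A))" using Suc.prems by (metis Diff_insert_absorb Diff_iff card_insert_disjoint finite_Diff insertI1 e(1))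
  then have c1: "m = card (F - {e} - A)" using Suc.hyps(2) by simp
  moreover have "F - insert e A = F - {e} - A" by auto
  ultimately have c2: "m = card (F - insert e A)" by simp
  obtain l1 where l1: "\<forall>s\<in>\<H>. (\<lambda>n. pcyl (M s n) (F - {e}) A) \<longlonglongrightarrow> l1"
    using Suc.hyps(1)[OF c1] Suc.prems e by auto
  obtain l2 where l2: "\<forall>s\<in>\<H>. (\<lambda>n. pcyl (M s n) F (insert e A)) \<longlonglongrightarrow> l2"
    using Suc.hyps(1)[OF c2] Suc.prems e by auto
  have "(\<lambda>n. pcyl (M s n) F A) \<longlonglongrightarrow> l1 - l2" if s: "s \<in> \<H>" for s
  proof -
    have "pcyl (M s n) F A
      = pcyl (M s n) (F - {e}) A
        - pcyl (M s n) F (insert e A)" for n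
    proof -
      interpret prob_space "M s n" using M(1)[OF s] .
      have sp: "space (M s n) = space (CS E)" using M(2)[OF s] by (rule sets_eq_imp_space_eq)
      have m: "{\<omega> \<in> space (M s n). {x\<in>F. \<omega> x} = B} \<in> sets (M s n)" for B
        using measurable_local[OF Suc.prems(1,2), of "\<lambda>C. C = B"] by (simp add: sp M(2)[OF s])
      have m2: "{\<omega> \<in> space (M s n). {x\<in>F - {e}. \<omega> x} = A} \<in> sets (M s n)"
        using measurable_local[of "F - {e}" E "\<lambda>C. C = A"] Suc.prems by (auto simp: sp M(2)[OF s])
      have "{\<omega> \<in> space (M s n). {x\<in>F. \<omega> x} = A}
        = {\<omega> \<in> space (M s n). {x\<in>F - {e}. \<omega> x} = A} - {\<omega> \<in> space (M s n). {x\<in>F. \<omega> x} = insert e A}"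
        using e by auto
      moreover have "{\<omega> \<in> space (M s n). {x\<in>F. \<omega> x} = insert e A} \<subseteq> {\<omega> \<in> space (M s n). {x\<in>F - {e}. \<omega> x} = A}"
        using e by auto
      ultimately show ?thesis using finite_measure_Diff[OF m2 m] by simp
    qed
    then show ?thesis using l1 l2 s by (simp add: tendsto_diff)
  qed
  then show ?case by blast
qed

text \<open>A definite description can be used only after existence and uniqueness. The limits of
  the cylinder probabilities extend to a measure, their convergence is weak convergence, and two
  weak limits of the same sequence agree on cylinders.\<close>

lemma the_weak_limit:
  fixes M :: "'s \<Rightarrow> nat \<Rightarrow> ('e \<Rightarrow> bool) measure" and \<H> :: "'s set" and E :: "'e set"
  defines "L \<equiv> (THE \<mu>. prob_space \<mu> \<and> sets \<mu> = sets (CS E) \<and>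
      (\<forall>s. s \<in> \<H> \<longrightarrow> weakly_converges (product_topology (\<lambda>_. discrete_topology UNIV) E) (M s) \<mu>))"
  assumes M: "\<And>s n. s \<in> \<H> \<Longrightarrow> prob_space (M s n)" "\<And>s n. s \<in> \<H> \<Longrightarrow> sets (M s n) = sets (CS E)"
    and inc: "\<And>B. finite B \<Longrightarrow> B \<subseteq> E \<Longrightarrow> \<exists>l. \<forall>s\<in>\<H>. (\<lambda>n. pcyl (M s n) B B) \<longlonglongrightarrow> l"
    and ne: "\<H> \<noteq> {}"
  shows "prob_space L" "sets L = sets (CS E)"
    and "s \<in> \<H> \<Longrightarrow> finite F \<Longrightarrow> F \<subseteq> E \<Longrightarrow>
      (\<lambda>n. ploc (M s n) F Q) \<longlonglongrightarrow> ploc L F Q"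
proof -
  obtain s0 where s0: "s0 \<in> \<H>" using ne by auto
  have "\<exists>l. \<forall>s\<in>\<H>. (\<lambda>n. pcyl (M s n) F A) \<longlonglongrightarrow> l"
    if "finite F" "F \<subseteq> E" "A \<subseteq> F" for F A
    by (rule limits_of_cylinders[OF M inc that])
  note ex = someI_ex[OF this]
  define a where "a F A = (SOME l. \<forall>s\<in>\<H>. (\<lambda>n. pcyl (M s n) F A) \<longlonglongrightarrow> l)" for F A
  have a: "(\<lambda>n. pcyl (M s n) F A) \<longlonglongrightarrow> a F A"
    if "finite F" "F \<subseteq> E" "A \<subseteq> F" "s \<in> \<H>" for F A s
    using ex[OF that(1-3)] that(4) unfolding a_def by blast
  note a0 = a[OF _ _ _ s0]
  have "\<exists>\<mu>. prob_space \<mu> \<and> sets \<mu> = sets (CS E) \<and>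
    (\<forall>F A. finite F \<longrightarrow> F \<subseteq> E \<longrightarrow> A \<subseteq> F \<longrightarrow> pcyl \<mu> F A = a F A)"
  proof (rule ex_measure_with_cylinders)
    fix F A assume "finite F" "F \<subseteq> E" "A \<subseteq> F"
    then show "0 \<le> a F A" using LIMSEQ_le_const[OF a0, of F A 0] by auto
  next
    have "(\<lambda>n. 1) \<longlonglongrightarrow> a {} {}"
      using a0[of "{}" "{}"] prob_space.prob_space[OF M(1)[OF s0]] by simp
    then show "a {} {} = 1" using LIMSEQ_unique tendsto_const by blast
  next
    fix F A e assume F: "finite F" "insert e F \<subseteq> E" "e \<notin> F" "A \<subseteq> F"
    have "pcyl (M s0 n) F A
      = pcyl (M s0 n) (insert e F) A
        + pcyl (M s0 n) (insert e F) (insert e A)" for n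
    proof -
      interpret prob_space "M s0 n" using M(1)[OF s0] .
      have sp: "space (M s0 n) = space (CS E)" using M(2)[OF s0] by (rule sets_eq_imp_space_eq)
      have m: "{\<omega> \<in> space (M s0 n). {x\<in>insert e F. \<omega> x} = B} \<in> sets (M s0 n)" for B
        using measurable_local[of "insert e F" E "\<lambda>C. C = B"] F by (simp add: sp M(2)[OF s0])
      have "{\<omega> \<in> space (M s0 n). {x\<in>F. \<omega> x} = A}
        = {\<omega> \<in> space (M s0 n). {x\<in>insert e F. \<omega> x} = A} \<union> {\<omega> \<in> space (M s0 n). {x\<in>insert e F. \<omega> x} = insert e A}"
        using F by auto
      moreover have "{\<omega> \<in> space (M s0 n). {x\<in>insert e F. \<omega> x} = A} \<inter> {\<omega> \<in> space (M s0 n). {x\<in>insert e F. \<omega> x} = insert e A} = {}"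
        using F by auto
      ultimately show ?thesis using finite_measure_Union[OF m m] by simp
    qed
    then have eq: "(\<lambda>n. pcyl (M s0 n) F A)
      = (\<lambda>n. pcyl (M s0 n) (insert e F) A
        + pcyl (M s0 n) (insert e F) (insert e A))"
      by (rule ext)
    have "(\<lambda>n. pcyl (M s0 n) F A) \<longlonglongrightarrow> a (insert e F) A + a (insert e F) (insert e A)"
      unfolding eq by (intro tendsto_add a0) (use F in auto)
    moreover have "(\<lambda>n. pcyl (M s0 n) F A) \<longlonglongrightarrow> a F A"
      using F by (intro a0) auto
    ultimately show "a F A = a (insert e F) A + a (insert e F) (insert e A)"
      by (rule LIMSEQ_unique[rotated])
  qed
  then obtain \<mu> where \<mu>: "prob_space \<mu>" "sets \<mu> = sets (CS E)"
    "\<And>F A. finite F \<Longrightarrow> F \<subseteq> E \<Longrightarrow> A \<subseteq> F \<Longrightarrow> pcyl \<mu> F A = a F A"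
    by blast
  have wc: "weakly_converges (product_topology (\<lambda>_. discrete_topology UNIV) E) (M s) \<mu>" if "s \<in> \<H>" for s
    by (rule weakly_converges_if_cylinders) (use that M \<mu> a in auto)
  have "L = \<mu>" unfolding L_def
  proof (rule the_equality)
    show "prob_space \<mu> \<and> sets \<mu> = sets (CS E) \<and>
      (\<forall>s. s \<in> \<H> \<longrightarrow> weakly_converges (product_topology (\<lambda>_. discrete_topology UNIV) E) (M s) \<mu>)"
      using \<mu> wc by auto
  next
    fix \<nu> assume \<nu>: "prob_space \<nu> \<and> sets \<nu> = sets (CS E) \<and>
      (\<forall>s. s \<in> \<H> \<longrightarrow> weakly_converges (product_topology (\<lambda>_. discrete_topology UNIV) E) (M s) \<nu>)"
    show "\<nu> = \<mu>"
    proof (rule measure_eq_if_cylinders_eq[of _ E])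
      fix F A assume F: "finite F" "F \<subseteq> E" "A \<subseteq> F"
      have "(\<lambda>n. pcyl (M s0 n) F A) \<longlonglongrightarrow> pcyl \<nu> F A"
        using \<nu> s0 M F by (intro cylinders_if_weakly_converges[of "M s0" E]) auto
      then show "pcyl \<nu> F A = pcyl \<mu> F A"
        using LIMSEQ_unique[OF _ a0[OF F]] \<mu>(3)[OF F] by simp
    qed (use \<nu> \<mu> in auto)
  qed
  then show "prob_space L" "sets L = sets (CS E)" using \<mu> by auto
  assume s: "s \<in> \<H>" and F: "finite F" "F \<subseteq> E"
  show "(\<lambda>n. ploc (M s n) F Q) \<longlonglongrightarrow> ploc L F Q"
    unfolding prob_local_sum[OF M(1)[OF s] M(2)[OF s] F] prob_local_sum[OF \<open>prob_space L\<close> \<open>sets L = _\<close> F]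
    using a[OF F _ s] \<mu>(3)[OF F] \<open>L = \<mu>\<close> by (intro tendsto_sum) auto
qed

lemma gE_const:
  assumes "finite_graph H" "0 \<le> p" "p \<le> 1" "1 \<le> q"
  shows "gE p q H B (\<lambda>_. c) = c"
  unfolding gE_def rcE_def using assms finite_edges by (intro wE_const rcw_sum_pos) auto

lemma gE_le:
  assumes "finite_graph H" "0 \<le> p" "p \<le> 1" "1 \<le> q" "\<And>A. A \<subseteq> edges H \<Longrightarrow> f A \<le> g A"
  shows "gE p q H B f \<le> gE p q H B g"
  unfolding gE_def rcE_def using assms by (intro wE_mono rcw_nonneg) auto

lemma gE_free_mono:
  assumes "finite_graph H" "finite_graph H'" "subgraph H H'" "0 \<le> p" "p \<le> 1" "1 \<le> q" "incr_on (edges H') f"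
  shows "gE p q H {} f \<le> gE p q H' {} f"
proof -
  have sub: "edges H \<subseteq> edges H'" using assms by (simp add: subgraph_def)
  have "incr_on (edges H) f" using assms(7) sub by (auto simp: incr_on_def)
  then have "gE p q H {} f * gE p q H' {} (\<lambda>A. 1) \<le> gE p q H' {} (\<lambda>A. f (A \<inter> edges H) * 1)"
    using gE_volume_free[OF assms(1-6), of f "\<lambda>_. 1"] by simp
  also have "\<dots> \<le> gE p q H' {} f"
    using assms by (intro gE_le) (auto intro!: incr_onD[OF assms(7)])
  finally show ?thesis using assms by (simp add: gE_const)
qed

lemma gE_wired_mono:
  assumes "simple_graph G" "induced_subgraph H G" "induced_subgraph H' G" "verts H \<subseteq> verts H'"
    and "finite_graph H" "finite_graph H'" "0 \<le> p" "p \<le> 1" "1 \<le> q" "incr_on (edges H) f"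
    and "\<And>A. A \<subseteq> edges H' \<Longrightarrow> f (A \<inter> edges H) = f A"
  shows "gE p q H' (boundary G H') f \<le> gE p q H (boundary G H) f"
proof -
  have "gE p q H' (boundary G H') f \<le> gE p q H' (boundary G H') (\<lambda>A. f (A \<inter> edges H))"
    using assms by (intro gE_le) auto
  also have "\<dots> \<le> gE p q H (boundary G H) f" by (rule gE_volume_wired[OF assms(1-10)])
  finally show ?thesis .
qed

section \<open>Existence of the free and wired infinite-volume measures\<close>

locale rc_graph =
  fixes G :: "'a graph" and q :: real
  assumes simple: "simple_graph G" and countable: "countable (verts G)" and nonempty: "verts G \<noteq> {}"
    and q: "1 \<le> q"
begin

lemma incr_contains: "incr_on X (\<lambda>A. of_bool (B \<subseteq> A))"
  by (auto simp: incr_on_def)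

context
  fixes p :: real
  assumes p: "0 \<le> p" "p \<le> 1"
begin

private abbreviation "Mf H n \<equiv> extend_measure_closed G (H n) (free_finite p q (H n))"
private abbreviation "Mw H n \<equiv> extend_measure_closed G (H n) (wired_finite p q G (H n))"

private lemma Mf:
  assumes "exhausts H G"
  shows "prob_space (Mf H n)" "sets (Mf H n) = sets (CS (edges G))"
    "finite F \<Longrightarrow> F \<subseteq> edges G \<Longrightarrow> ploc (Mf H n) F Q
      = gE p q (H n) {} (\<lambda>A. of_bool (Q (A \<inter> F)))"
proof -
  note H = exhausts_finite[OF assms, of n] exhausts_subgraph[OF assms, of n]
  note k = free_count_eq_ncl[OF H(1)]
  show "prob_space (Mf H n)" "sets (Mf H n) = sets (CS (edges G))"
    unfolding free_finite_def by (rule extended_prob_space[OF H p q], rule k, rule extended_sets[OF H p q], rule k)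
  show "finite F \<Longrightarrow> F \<subseteq> edges G \<Longrightarrow> ploc (Mf H n) F Q
      = gE p q (H n) {} (\<lambda>A. of_bool (Q (A \<inter> F)))"
    unfolding free_finite_def gE_def by (rule extended_local[OF H p q], rule k)
qed

private lemma Mw:
  assumes "exhausts H G"
  shows "prob_space (Mw H n)" "sets (Mw H n) = sets (CS (edges G))"
    "finite F \<Longrightarrow> F \<subseteq> edges G \<Longrightarrow> ploc (Mw H n) F Q
      = gE p q (H n) (boundary G (H n)) (\<lambda>A. of_bool (Q (A \<inter> F)))"
proof -
  note H = exhausts_finite[OF assms, of n] exhausts_subgraph[OF assms, of n]
  note k = wired_count_eq_ncl[OF H(1) boundary_subset[of G]]
  show "prob_space (Mw H n)" "sets (Mw H n) = sets (CS (edges G))"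
    unfolding wired_finite_def by (rule extended_prob_space[OF H p q], rule k, rule extended_sets[OF H p q], rule k)
  show "finite F \<Longrightarrow> F \<subseteq> edges G \<Longrightarrow> ploc (Mw H n) F Q
      = gE p q (H n) (boundary G (H n)) (\<lambda>A. of_bool (Q (A \<inter> F)))"
    unfolding wired_finite_def gE_def by (rule extended_local[OF H p q], rule k)
qed

private lemma free_inc:
  assumes B: "finite B" "B \<subseteq> edges G"
  shows "\<exists>l. \<forall>H\<in>{H. exhausts H G}. (\<lambda>n. pcyl (Mf H n) B B) \<longlonglongrightarrow> l"
proof -
  let ?v = "\<lambda>K. gE p q K {} (\<lambda>A. of_bool (B \<subseteq> A))"
  let ?good = "\<lambda>K. finite_graph K \<and> subgraph K G"
  have "\<exists>l. \<forall>s :: nat \<Rightarrow> _. (\<forall>\<^sub>F n in sequentially. ?good (s n)) \<longrightarrow>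
      (\<forall>K. ?good K \<longrightarrow> (\<forall>\<^sub>F n in sequentially. ?v K \<le> ?v (s n))) \<longrightarrow> (\<lambda>n. ?v (s n)) \<longlonglongrightarrow> l"
  proof (rule tendsto_directed)
    fix K assume "?good K"
    then have "?v K \<le> gE p q K {} (\<lambda>_. 1)" using p q by (intro gE_le) auto
    then show "?v K \<le> 1" using \<open>?good K\<close> p q by (simp add: gE_const)
  next
    show "\<exists>K. ?good K" using ex_induced_exhaustion[OF simple countable nonempty] exhausts_finite exhausts_subgraph by blast
  qed
  then obtain l where l: "\<And>s :: nat \<Rightarrow> _. (\<forall>\<^sub>F n in sequentially. ?good (s n)) \<Longrightarrow>
      (\<forall>K. ?good K \<longrightarrow> (\<forall>\<^sub>F n in sequentially. ?v K \<le> ?v (s n))) \<Longrightarrow> (\<lambda>n. ?v (s n)) \<longlonglongrightarrow> l" by blast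
  have "(\<lambda>n. pcyl (Mf H n) B B) \<longlonglongrightarrow> l" if H: "exhausts H G" for H
  proof -
    have "pcyl (Mf H n) B B = ?v (H n)" for n
      using Mf(3)[OF H B, of n "\<lambda>C. C = B"] by (simp add: Int_absorb1 inf.absorb_iff2 Int_commute)
    moreover have "(\<lambda>n. ?v (H n)) \<longlonglongrightarrow> l"
    proof (rule l)
      show "\<forall>\<^sub>F n in sequentially. ?good (H n)" using exhausts_finite[OF H] exhausts_subgraph[OF H] by auto
      show "\<forall>K. ?good K \<longrightarrow> (\<forall>\<^sub>F n in sequentially. ?v K \<le> ?v (H n))"
      proof (intro allI impI)
        fix K assume K: "?good K"
        have "\<forall>\<^sub>F n in sequentially. verts K \<subseteq> verts (H n) \<and> edges K \<subseteq> edges (H n)"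
          using K finite_edges by (intro exhausts_eventually[OF H]) (auto simp: finite_graph_def subgraph_def)
        then show "\<forall>\<^sub>F n in sequentially. ?v K \<le> ?v (H n)"
        proof eventually_elim
          case (elim n)
          then show ?case using K exhausts_finite[OF H] p q
            by (intro gE_free_mono incr_contains) (auto simp: subgraph_def)
        qed
      qed
    qed
    ultimately show ?thesis by simp
  qed
  then show ?thesis by blast
qed

private lemma wired_inc:
  assumes B: "finite B" "B \<subseteq> edges G"
  shows "\<exists>l. \<forall>H\<in>{H. exhausts H G \<and> (\<forall>n. induced_subgraph (H n) G)}.
    (\<lambda>n. pcyl (Mw H n) B B) \<longlonglongrightarrow> l"
proof -
  let ?w = "\<lambda>K. gE p q K (boundary G K) (\<lambda>A. of_bool (B \<subseteq> A))"
  \<comment> \<open>Wired probabilities of increasing events decrease as the volume grows, hence the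
    sign. The comparison requires the event to live on the smaller volume, which is why a good
    \<open>K\<close> must contain the edges of \<open>B\<close>.\<close>
  let ?v = "\<lambda>K. - ?w K"
  let ?good = "\<lambda>K. finite_graph K \<and> induced_subgraph K G \<and> B \<subseteq> edges K"
  have ev: "\<forall>\<^sub>F n in sequentially. ?good (H n)" if H: "exhausts H G" "\<forall>n. induced_subgraph (H n) G" for H
    using exhausts_eventually[OF H(1) _ _ B, of "{}"] exhausts_finite[OF H(1)] H(2) by auto
  have "\<exists>l. \<forall>s :: nat \<Rightarrow> _. (\<forall>\<^sub>F n in sequentially. ?good (s n)) \<longrightarrow>
      (\<forall>K. ?good K \<longrightarrow> (\<forall>\<^sub>F n in sequentially. ?v K \<le> ?v (s n))) \<longrightarrow> (\<lambda>n. ?v (s n)) \<longlonglongrightarrow> l"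
  proof (rule tendsto_directed)
    fix K assume "?good K"
    then have "gE p q K (boundary G K) (\<lambda>_. 0) \<le> ?w K" using p q by (intro gE_le) auto
    then show "?v K \<le> 0" using \<open>?good K\<close> p q by (simp add: gE_const)
  next
    obtain H where "exhausts H G" "\<forall>n. induced_subgraph (H n) G"
      using ex_induced_exhaustion[OF simple countable nonempty] by blast
    from eventually_happens'[OF _ ev[OF this]] show "\<exists>K. ?good K" by auto
  qed
  then obtain l where l: "\<And>s :: nat \<Rightarrow> _. (\<forall>\<^sub>F n in sequentially. ?good (s n)) \<Longrightarrow>
      (\<forall>K. ?good K \<longrightarrow> (\<forall>\<^sub>F n in sequentially. ?v K \<le> ?v (s n))) \<Longrightarrow> (\<lambda>n. ?v (s n)) \<longlonglongrightarrow> l" by blast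
  have "(\<lambda>n. pcyl (Mw H n) B B) \<longlonglongrightarrow> - l"
    if H: "exhausts H G" "\<forall>n. induced_subgraph (H n) G" for H
  proof -
    have "pcyl (Mw H n) B B = ?w (H n)" for n
      using Mw(3)[OF H(1) B, of n "\<lambda>C. C = B"] by (simp add: Int_absorb1 inf.absorb_iff2 Int_commute)
    moreover have "(\<lambda>n. ?v (H n)) \<longlonglongrightarrow> l"
    proof (rule l[OF ev[OF H]], intro allI impI)
      fix K assume K: "?good K"
      have "\<forall>\<^sub>F n in sequentially. verts K \<subseteq> verts (H n) \<and> edges K \<subseteq> edges (H n)"
        using K finite_edges by (intro exhausts_eventually[OF H(1)]) (auto simp: finite_graph_def induced_subgraph_def)
      then show "\<forall>\<^sub>F n in sequentially. ?v K \<le> ?v (H n)"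
      proof eventually_elim
        case (elim n)
        have "?w (H n) \<le> ?w K"
          using K elim exhausts_finite[OF H(1)] H(2) p q simple
          by (intro gE_wired_mono incr_contains) (auto simp: of_bool_def)
        then show ?case by simp
      qed
    qed
    ultimately show ?thesis using tendsto_minus[of _ l] by fastforce
  qed
  then show ?thesis by blast
qed

private lemma exh_ne: "{H. exhausts H G \<and> (\<forall>n. induced_subgraph (H n) G)} \<noteq> {}" "{H. exhausts H G} \<noteq> {}"
  using ex_induced_exhaustion[OF simple countable nonempty] by auto

lemma free_rc_prob: "prob_space (free_rc p q G)"
  and free_rc_sets: "sets (free_rc p q G) = sets (CS (edges G))"
  and free_rc_limit: "exhausts H G \<Longrightarrow> finite F \<Longrightarrow> F \<subseteq> edges G \<Longrightarrow>
    (\<lambda>n. gE p q (H n) {} (\<lambda>A. of_bool (Q (A \<inter> F)))) \<longlonglongrightarrow>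
      ploc (free_rc p q G) F Q"
proof -
  note L = the_weak_limit[of "{H. exhausts H G}" Mf "edges G", OF _ _ free_inc exh_ne(2)]
  have eq: "free_rc p q G = (THE \<mu>. prob_space \<mu> \<and> sets \<mu> = sets (CS (edges G)) \<and>
      (\<forall>s. s \<in> {H. exhausts H G} \<longrightarrow> weakly_converges (product_topology (\<lambda>_. discrete_topology UNIV) (edges G)) (Mf s) \<mu>))"
    by (simp add: free_rc_def config_topology_def config_space_CS)
  show "prob_space (free_rc p q G)" "sets (free_rc p q G) = sets (CS (edges G))"
    unfolding eq using L(1,2) Mf(1,2) by auto
  show "exhausts H G \<Longrightarrow> finite F \<Longrightarrow> F \<subseteq> edges G \<Longrightarrow>
    (\<lambda>n. gE p q (H n) {} (\<lambda>A. of_bool (Q (A \<inter> F)))) \<longlonglongrightarrow>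
      ploc (free_rc p q G) F Q"
    unfolding eq using L(3)[of H F Q] Mf by simp
qed

lemma wired_rc_prob: "prob_space (wired_rc p q G)"
  and wired_rc_sets: "sets (wired_rc p q G) = sets (CS (edges G))"
  and wired_rc_limit: "exhausts H G \<Longrightarrow> (\<And>n. induced_subgraph (H n) G) \<Longrightarrow> finite F \<Longrightarrow> F \<subseteq> edges G \<Longrightarrow>
    (\<lambda>n. gE p q (H n) (boundary G (H n)) (\<lambda>A. of_bool (Q (A \<inter> F)))) \<longlonglongrightarrow>
      ploc (wired_rc p q G) F Q"
proof -
  note L = the_weak_limit[of "{H. exhausts H G \<and> (\<forall>n. induced_subgraph (H n) G)}" Mw "edges G", OF _ _ wired_inc exh_ne(1)]
  have eq: "wired_rc p q G = (THE \<mu>. prob_space \<mu> \<and> sets \<mu> = sets (CS (edges G)) \<and>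
      (\<forall>s. s \<in> {H. exhausts H G \<and> (\<forall>n. induced_subgraph (H n) G)} \<longrightarrow>
        weakly_converges (product_topology (\<lambda>_. discrete_topology UNIV) (edges G)) (Mw s) \<mu>))"
    by (simp add: wired_rc_def config_topology_def config_space_CS)
  show "prob_space (wired_rc p q G)" "sets (wired_rc p q G) = sets (CS (edges G))"
    unfolding eq using L(1,2) Mw(1,2) by auto
  show "exhausts H G \<Longrightarrow> (\<And>n. induced_subgraph (H n) G) \<Longrightarrow> finite F \<Longrightarrow> F \<subseteq> edges G \<Longrightarrow>
    (\<lambda>n. gE p q (H n) (boundary G (H n)) (\<lambda>A. of_bool (Q (A \<inter> F)))) \<longlonglongrightarrow>
      ploc (wired_rc p q G) F Q"
    unfolding eq using L(3)[of H F Q] Mw by simp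
qed

end

end

section \<open>Exploring clusters\<close>

definition cl :: "'a set \<Rightarrow> 'a set set \<Rightarrow> 'a set" where
  "cl K A = (adj A)\<^sup>* `` K"

lemma cl_mono: "A \<subseteq> A' \<Longrightarrow> cl K A \<subseteq> cl K A'"
  unfolding cl_def by (intro Image_mono rtrancl_mono adj_mono order_refl)

text \<open>\<open>X\<close> holds the open edges among the revealed edges \<open>D\<close>, and
  \<open>cl K X\<close> is the part of the cluster of \<open>K\<close> found so far. The number
  \<open>m\<close> bounds the remaining queries and makes the recursion structural.\<close>

fun explore :: "'a set set \<Rightarrow> 'a set \<Rightarrow> nat \<Rightarrow> 'a set set \<Rightarrow> 'a set set \<Rightarrow> 'a set dtree" where
  "explore F K 0 D X = Leaf"
| "explore F K (Suc m) D X =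
    (if \<exists>e\<in>F - D. e \<inter> cl K X \<noteq> {}
     then let e = (SOME e. e \<in> F - D \<and> e \<inter> cl K X \<noteq> {})
          in Node e (explore F K m (insert e D) X) (explore F K m (insert e D) (insert e X))
     else Leaf)"

lemma explore_cases:
  obtains "explore F K (Suc m) D X = Leaf" "\<forall>e\<in>F - D. e \<inter> cl K X = {}"
  | e where "e \<in> F - D" "e \<inter> cl K X \<noteq> {}"
    "explore F K (Suc m) D X = Node e (explore F K m (insert e D) X) (explore F K m (insert e D) (insert e X))"
proof (cases "\<exists>e\<in>F - D. e \<inter> cl K X \<noteq> {}")
  case True
  define e where "e = (SOME e. e \<in> F - D \<and> e \<inter> cl K X \<noteq> {})"
  have "e \<in> F - D \<and> e \<inter> cl K X \<noteq> {}"
    unfolding e_def by (rule someI_ex) (use True in blast)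
  moreover have "explore F K (Suc m) D X = Node e (explore F K m (insert e D) X) (explore F K m (insert e D) (insert e X))"
    using True by (simp add: Let_def e_def)
  ultimately show ?thesis using that(2) by blast
next
  case False
  then have "\<forall>e\<in>F - D. e \<inter> cl K X = {}" by blast
  then show ?thesis using False by (intro that(1)) auto
qed

declare explore.simps(2) [simp del]

locale exploration = monotone_measure E w for E :: "'a set set" and w +
  fixes F :: "'a set set" and K :: "'a set"
  assumes FE: "F \<subseteq> E"
begin

lemma ce_of_bool_nonneg: "0 \<le> ce D X (\<lambda>A. of_bool (Q A))"
proof -
  have "0 \<le> w A" if "A \<in> cyl E D X" for A using that wpos[of A] by (auto simp: cyl_def)
  then show ?thesis unfolding wE_def by (intro divide_nonneg_nonneg sum_nonneg mult_nonneg_nonneg) auto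
qed

lemma explore_ok: "dtree_ok E D (explore F K m D X)"
proof (induction m arbitrary: D X)
  case (Suc m)
  show ?case
    by (rule explore_cases[of F K m D X]) (use Suc FE in auto)
qed simp

lemma explore_outside: "x \<notin> F \<Longrightarrow> revealment x (explore F K m D X) D X = 0"
proof (induction m arbitrary: D X)
  case (Suc m)
  show ?case
    by (rule explore_cases[of F K m D X]) (use Suc in auto)
qed simp

text \<open>An edge is queried only when it touches the cluster found so far, which is contained in
  the cluster of \<open>K\<close> in \<open>A \<inter> F\<close>. The conditional bounds for the two
  answers are reassembled by \<open>ce_split\<close>.\<close>

lemma explore_revealment:
  assumes "D \<subseteq> F" "X \<subseteq> D" "x \<in> F - D"
  shows "revealment x (explore F K m D X) D X \<le> ce D X (\<lambda>A. of_bool (x \<inter> cl K (A \<inter> F) \<noteq> {}))"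
  using assms
proof (induction m arbitrary: D X)
  case 0
  show ?case by (simp add: ce_of_bool_nonneg)
next
  case (Suc m)
  show ?case
  proof (rule explore_cases[of F K m D X])
    assume "explore F K (Suc m) D X = Leaf"
    then show ?thesis by (simp add: ce_of_bool_nonneg)
  next
    fix e assume e: "e \<in> F - D" "e \<inter> cl K X \<noteq> {}"
      and eq: "explore F K (Suc m) D X = Node e (explore F K m (insert e D) X) (explore F K m (insert e D) (insert e X))"
    have DE: "D \<subseteq> E" "e \<in> E - D" using Suc.prems FE e by auto
    show ?thesis
    proof (cases "x = e")
      case True
      have "ce D X (\<lambda>A. of_bool (x \<inter> cl K (A \<inter> F) \<noteq> {})) = ce D X (\<lambda>A. 1)"
      proof (rule wE_cong)
        fix A assume "A \<in> cyl E D X"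
        then have "X \<subseteq> A \<inter> F" using Suc.prems by (auto simp: cyl_def)
        then have "cl K X \<subseteq> cl K (A \<inter> F)" by (rule cl_mono)
        then have "x \<inter> cl K (A \<inter> F) \<noteq> {}" using e True by blast
        then show "of_bool (x \<inter> cl K (A \<inter> F) \<noteq> {}) = (1::real)" by simp
      qed
      also have "\<dots> = 1" using DE Suc.prems by (intro wE_const cyl_pos) auto
      finally have "ce D X (\<lambda>A. of_bool (x \<inter> cl K (A \<inter> F) \<noteq> {})) = 1" .
      moreover have "revealment x (explore F K m (insert e D) Y) (insert e D) Y = 0" for Y
        using True explore_ok by (intro revealment_decided) auto
      ultimately show ?thesis using True by (simp add: eq)
    next
      case False
      have "revealment x (explore F K (Suc m) D X) D X
        = (1 - pr D X e) * revealment x (explore F K m (insert e D) X) (insert e D) X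
          + pr D X e * revealment x (explore F K m (insert e D) (insert e X)) (insert e D) (insert e X)"
        using False by (simp add: eq)
      also have "\<dots> \<le> (1 - pr D X e) * ce (insert e D) X (\<lambda>A. of_bool (x \<inter> cl K (A \<inter> F) \<noteq> {}))
          + pr D X e * ce (insert e D) (insert e X) (\<lambda>A. of_bool (x \<inter> cl K (A \<inter> F) \<noteq> {}))"
        using pr_bounds[of D X e] Suc.prems False e by (intro add_mono mult_left_mono Suc.IH) auto
      also have "\<dots> = ce D X (\<lambda>A. of_bool (x \<inter> cl K (A \<inter> F) \<noteq> {}))"
        using DE Suc.prems by (intro ce_split[symmetric]) auto
      finally show ?thesis .
    qed
  qed
qed

text \<open>With at least \<open>card (F - D)\<close> queries available, the exploration stops only
  after every edge of \<open>F\<close> touching the cluster has been revealed. The hypothesis says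
  that \<open>g\<close> is then known from the open edges found.\<close>

lemma explore_determined:
  assumes g: "\<And>X A. X \<subseteq> F \<Longrightarrow> X \<subseteq> A \<Longrightarrow> A \<subseteq> E \<Longrightarrow>
      (\<And>e. e \<in> F \<inter> A \<Longrightarrow> e \<inter> cl K X \<noteq> {} \<Longrightarrow> e \<in> X) \<Longrightarrow> g A = g X"
    and "D \<subseteq> F" "X \<subseteq> D" "card (F - D) \<le> m"
  shows "determined g (explore F K m D X) D X"
  using assms(2-)
proof (induction m arbitrary: D X)
  case 0
  have "finite F" using fin FE by (rule finite_subset[rotated])
  then have "F = D" using 0 by auto
  have "g A = g X" if "A \<in> cyl E D X" for A
    using that \<open>F = D\<close> 0 by (intro g) (auto simp: cyl_def)
  then show ?case by auto
next
  case (Suc m)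
  show ?case
  proof (rule explore_cases[of F K m D X])
    assume L: "explore F K (Suc m) D X = Leaf" "\<forall>e\<in>F - D. e \<inter> cl K X = {}"
    have "g A = g X" if "A \<in> cyl E D X" for A
    proof (rule g)
      fix e assume e: "e \<in> F \<inter> A" "e \<inter> cl K X \<noteq> {}"
      then have "e \<in> D" using L(2) by blast
      then show "e \<in> X" using that e by (auto simp: cyl_def)
    qed (use that Suc.prems in \<open>auto simp: cyl_def\<close>)
    then show ?thesis unfolding L(1) by auto
  next
    fix e assume e: "e \<in> F - D" "e \<inter> cl K X \<noteq> {}"
      and eq: "explore F K (Suc m) D X = Node e (explore F K m (insert e D) X) (explore F K m (insert e D) (insert e X))"
    have "finite F" using fin FE by (rule finite_subset[rotated])
    then have "card (F - D) = Suc (card (F - insert e D))"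
      using e by (metis Diff_insert card_Suc_Diff1 finite_Diff)
    then have "card (F - insert e D) \<le> m" using Suc.prems by simp
    then show ?thesis unfolding eq using Suc.prems e by (auto intro!: Suc.IH)
  qed
qed

end

section \<open>Distances and one-arm events\<close>

locale lf_graph = rc_graph G q for G :: "'a graph" and q +
  assumes connected: "connected_graph G" and lf: "locally_finite G"
begin

abbreviation "V \<equiv> verts G"
abbreviation d :: "'a \<Rightarrow> 'a \<Rightarrow> nat" where "d \<equiv> graph_dist G"

lemma edge_verts: "{x, y} \<in> edges G \<Longrightarrow> x \<in> V \<and> y \<in> V"
  using bspec[OF simple[unfolded simple_graph_def], of "{x, y}"] by simp

lemma d_path: "x \<in> V \<Longrightarrow> y \<in> V \<Longrightarrow> (x, y) \<in> adj (edges G) ^^ d x y"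
proof -
  assume "x \<in> V" "y \<in> V"
  then have "(x, y) \<in> (adj (edges G))\<^sup>*" using connected by (auto simp: connected_graph_def)
  then have "\<exists>n. (x, y) \<in> adj (edges G) ^^ n" by (rule rtrancl_imp_relpow)
  then show ?thesis unfolding graph_dist_def by (rule LeastI_ex)
qed

lemma d_le: "(x, y) \<in> adj (edges G) ^^ n \<Longrightarrow> d x y \<le> n"
  unfolding graph_dist_def by (rule Least_le)

lemma d_self [simp]: "d x x = 0"
  using d_le[of x x 0] by simp

lemma d_triangle: "x \<in> V \<Longrightarrow> y \<in> V \<Longrightarrow> z \<in> V \<Longrightarrow> d x z \<le> d x y + d y z"
  by (rule d_le) (use d_path[of x y] d_path[of y z] in \<open>auto simp: relpow_add\<close>)

lemma relpow_adj_sym: "(x, y) \<in> adj A ^^ n \<Longrightarrow> (y, x) \<in> adj A ^^ n"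
proof (induction n arbitrary: y)
  case (Suc n)
  then obtain z where z: "(x, z) \<in> adj A ^^ n" "(z, y) \<in> adj A" by auto
  from z(2) have "(y, z) \<in> adj A" by (rule symD[OF sym_adj])
  then show ?case using Suc.IH[OF z(1)] by (metis relpow_Suc_I2)
qed auto

lemma d_sym: "x \<in> V \<Longrightarrow> y \<in> V \<Longrightarrow> d x y = d y x"
  using d_le[OF relpow_adj_sym[OF d_path[of x y]]] d_le[OF relpow_adj_sym[OF d_path[of y x]]] by simp

lemma d_eq_0: "x \<in> V \<Longrightarrow> y \<in> V \<Longrightarrow> d x y = 0 \<Longrightarrow> x = y"
  using d_path[of x y] by simp

lemma d_edge: "{x, y} \<in> edges G \<Longrightarrow> d x y \<le> 1"
  by (rule d_le) (auto simp: adj_def)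

definition bl :: "'a \<Rightarrow> nat \<Rightarrow> 'a set" where
  "bl x n = {y\<in>V. d x y \<le> n}"

lemma finite_neighbours: "y \<in> V \<Longrightarrow> finite {z. {y, z} \<in> edges G}"
proof -
  assume y: "y \<in> V"
  have "finite e" if "e \<in> edges G" for e
    using that simple unfolding simple_graph_def by (metis card.infinite zero_neq_numeral)
  then have "finite (\<Union>{e\<in>edges G. y \<in> e})"
    using lf y by (intro finite_Union) (auto simp: locally_finite_def)
  then show ?thesis by (rule finite_subset[rotated]) auto
qed

lemma finite_bl: "x \<in> V \<Longrightarrow> finite (bl x n)"
proof (induction n)
  case 0
  then have "bl x 0 \<subseteq> {x}" using d_eq_0[of x] by (auto simp: bl_def)
  then show ?case by (rule finite_subset) simp
next
  case (Suc n)
  have "bl x (Suc n) \<subseteq> bl x n \<union> (\<Union>y\<in>bl x n. {z. {y, z} \<in> edges G})"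
  proof
    fix z assume z: "z \<in> bl x (Suc n)"
    show "z \<in> bl x n \<union> (\<Union>y\<in>bl x n. {z. {y, z} \<in> edges G})"
    proof (cases "d x z \<le> n")
      case False
      then have "(x, z) \<in> adj (edges G) ^^ Suc n"
        using z d_path[of x z] Suc.prems by (auto simp: bl_def le_Suc_eq)
      then obtain y where y: "(x, y) \<in> adj (edges G) ^^ n" "(y, z) \<in> adj (edges G)" by auto
      then have "{y, z} \<in> edges G" by (simp add: adj_def)
      then have "y \<in> bl x n" using d_le[OF y(1)] edge_verts by (auto simp: bl_def)
      then show ?thesis using \<open>{y, z} \<in> edges G\<close> by auto
    qed (use z in \<open>auto simp: bl_def\<close>)
  qed
  moreover have "finite (bl x n \<union> (\<Union>y\<in>bl x n. {z. {y, z} \<in> edges G}))"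
    using Suc finite_neighbours by (auto simp: bl_def)
  ultimately show ?case by (rule finite_subset)
qed

section \<open>Balls, arm events and their wired probabilities\<close>

definition Lam :: "'a \<Rightarrow> nat \<Rightarrow> 'a graph" where
  "Lam x n = ind G (bl x n)"

lemma verts_Lam [simp]: "verts (Lam x n) = bl x n" by (simp add: Lam_def)

lemma bl_subset: "bl x n \<subseteq> V" by (auto simp: bl_def)

lemma finite_Lam: "x \<in> V \<Longrightarrow> finite_graph (Lam x n)"
  unfolding Lam_def by (intro finite_graph_ind simple finite_bl)

lemma induced_Lam: "induced_subgraph (Lam x n) G"
  unfolding Lam_def by (intro induced_ind bl_subset)

lemma edges_Lam: "edges (Lam x n) = {e\<in>edges G. e \<subseteq> bl x n}"
  by (simp add: Lam_def)

lemma edges_Lam_G: "edges (Lam x n) \<subseteq> edges G" by (auto simp: edges_Lam)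

lemma bl_mono: "x \<in> V \<Longrightarrow> y \<in> V \<Longrightarrow> d x y + m \<le> n \<Longrightarrow> bl y m \<subseteq> bl x n"
  using d_triangle[of x y] by (fastforce simp: bl_def)

lemma edges_Lam_mono: "x \<in> V \<Longrightarrow> y \<in> V \<Longrightarrow> d x y + m \<le> n \<Longrightarrow> edges (Lam y m) \<subseteq> edges (Lam x n)"
  using bl_mono[of x y m n] by (auto simp: edges_Lam)

text \<open>Only edges of the ball are used, which makes this a local event; by \<open>reachI\<close> nothing is lost.\<close>

definition reach :: "'a \<Rightarrow> nat \<Rightarrow> 'a set set \<Rightarrow> bool" where
  "reach x n A \<longleftrightarrow> (\<exists>y\<in>V. d x y = n \<and> (x, y) \<in> (adj (A \<inter> edges (Lam x n)))\<^sup>*)"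

lemma reach_mono_set: "reach x n A \<Longrightarrow> A \<subseteq> A' \<Longrightarrow> reach x n A'"
  unfolding reach_def using rtrancl_mono[OF adj_mono[of "A \<inter> edges (Lam x n)" "A' \<inter> edges (Lam x n)"]] by blast

lemma reach_local: "edges (Lam x n) \<subseteq> F \<Longrightarrow> reach x n (A \<inter> F) \<longleftrightarrow> reach x n A"
  unfolding reach_def by (simp add: Int_assoc Int_absorb1)

lemma incr_reach: "incr_on E (\<lambda>A. of_bool (reach x n A))"
  by (auto simp: incr_on_def dest: reach_mono_set)

text \<open>The distance from \<open>x\<close> changes by at most one along an edge. The first
  vertex of the path at distance \<open>n\<close> is therefore reached through edges of the ball of
  radius \<open>n\<close>.\<close>

lemma reachI:
  assumes "x \<in> V" "A \<subseteq> edges G" "(x, y) \<in> (adj A)\<^sup>*" "n \<le> d x y"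
  shows "reach x n A"
proof -
  have "reach x n A \<or> (y \<in> V \<and> d x y < n \<and> (x, y) \<in> (adj (A \<inter> edges (Lam x n)))\<^sup>*)"
    using assms(3)
  proof (induction rule: rtrancl_induct)
    case base
    show ?case
    proof (cases "n = 0")
      case True
      then have "reach x n A" unfolding reach_def using assms(1) by (intro bexI[of _ x]) auto
      then show ?thesis ..
    qed (use assms in auto)
  next
    case (step y z)
    show ?case
    proof (cases "reach x n A")
      case False
      then have y: "y \<in> V" "d x y < n" "(x, y) \<in> (adj (A \<inter> edges (Lam x n)))\<^sup>*" using step.IH by auto
      have yz: "{y, z} \<in> A" using step.hyps(2) by (simp add: adj_def)
      then have G: "{y, z} \<in> edges G" using assms(2) by auto
      have z: "z \<in> V" "d x z \<le> n"
        using edge_verts[OF G] d_triangle[of x y z] d_edge[OF G] assms(1) y by auto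
      have "{y, z} \<in> A \<inter> edges (Lam x n)" using G yz y z by (auto simp: edges_Lam bl_def)
      then have "(y, z) \<in> adj (A \<inter> edges (Lam x n))" by (simp add: adj_def)
      with y(3) have xz: "(x, z) \<in> (adj (A \<inter> edges (Lam x n)))\<^sup>*" by (rule rtrancl_into_rtrancl)
      then show ?thesis using z by (cases "d x z = n") (auto simp: reach_def)
    qed simp
  qed
  then show ?thesis using assms(4) by auto
qed

lemma reach_antimono: "x \<in> V \<Longrightarrow> reach x n A \<Longrightarrow> m \<le> n \<Longrightarrow> reach x m A"
proof -
  assume *: "x \<in> V" "reach x n A" "m \<le> n"
  then obtain y where "d x y = n" "(x, y) \<in> (adj (A \<inter> edges (Lam x n)))\<^sup>*" by (auto simp: reach_def)
  then have "reach x m (A \<inter> edges (Lam x n))" using * edges_Lam_G by (intro reachI[of x _ y]) auto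
  then show ?thesis by (rule reach_mono_set) auto
qed

lemma reach_0: "x \<in> V \<Longrightarrow> reach x 0 A"
  unfolding reach_def by (intro bexI[of _ x]) auto

definition wexp :: "real \<Rightarrow> 'a graph \<Rightarrow> ('a set set \<Rightarrow> real) \<Rightarrow> real" where
  "wexp p H f = gE p q H (boundary G H) f"

text \<open>The wired ball has twice the radius of the arm, so that for a vertex of the inner ball and \<open>j \<le> n/2\<close>
  it contains the ball on which the arm event of length \<open>j\<close> from that vertex is compared.\<close>

definition \<theta> :: "real \<Rightarrow> 'a \<Rightarrow> nat \<Rightarrow> real" where
  "\<theta> p x n = wexp p (Lam x (2 * n)) (\<lambda>A. of_bool (reach x n A))"

lemma wexp_mono:
  assumes "0 \<le> p" "p \<le> 1" "induced_subgraph H G" "finite_graph H" "induced_subgraph H' G" "finite_graph H'"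
    "verts H \<subseteq> verts H'" "incr_on (edges H) f" "\<And>A. f (A \<inter> edges H) = f A"
  shows "wexp p H' f \<le> wexp p H f"
  unfolding wexp_def using assms simple q by (intro gE_wired_mono) auto

lemma wexp_le:
  assumes "0 \<le> p" "p \<le> 1" "finite_graph H" "\<And>A. A \<subseteq> edges H \<Longrightarrow> f A \<le> g A"
  shows "wexp p H f \<le> wexp p H g"
  unfolding wexp_def using assms q by (intro gE_le) auto

lemma wexp_const: "finite_graph H \<Longrightarrow> 0 \<le> p \<Longrightarrow> p \<le> 1 \<Longrightarrow> wexp p H (\<lambda>_. c) = c"
  unfolding wexp_def using q by (intro gE_const)

lemma wexp_bounds:
  assumes "0 \<le> p" "p \<le> 1" "finite_graph H"
  shows "0 \<le> wexp p H (\<lambda>A. of_bool (Q A))" "wexp p H (\<lambda>A. of_bool (Q A)) \<le> 1"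
  using wexp_le[OF assms, of "\<lambda>_. 0" "\<lambda>A. of_bool (Q A)"] wexp_le[OF assms, of "\<lambda>A. of_bool (Q A)" "\<lambda>_. 1"]
  by (auto simp: wexp_const assms)

text \<open>A longer arm contains a shorter one, and for increasing events the wired measure of a
  larger volume is dominated by that of \<open>Lam u (2 * n)\<close>.\<close>

lemma wexp_reach_le_\<theta>:
  assumes p: "0 \<le> p" "p \<le> 1" and u: "u \<in> V" "n \<le> m" and H: "induced_subgraph H G" "finite_graph H" "bl u (2 * n) \<subseteq> verts H"
  shows "wexp p H (\<lambda>A. of_bool (reach u m A)) \<le> \<theta> p u n"
proof -
  have "wexp p H (\<lambda>A. of_bool (reach u m A)) \<le> wexp p H (\<lambda>A. of_bool (reach u n A))"
    using p H reach_antimono[OF u(1) _ u(2)] by (intro wexp_le) auto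
  also have "\<dots> \<le> \<theta> p u n"
    unfolding \<theta>_def
  proof (rule wexp_mono)
    show "of_bool (reach u n (A \<inter> edges (Lam u (2 * n)))) = (of_bool (reach u n A) :: real)" for A
      using edges_Lam_mono[OF u(1) u(1), of n "2 * n"] by (simp add: reach_local)
  qed (use p H u in \<open>auto simp: finite_Lam induced_Lam incr_reach\<close>)
  finally show ?thesis .
qed

lemma \<theta>_bounds:
  assumes "0 \<le> p" "p \<le> 1" "x \<in> V" shows "0 \<le> \<theta> p x n" "\<theta> p x n \<le> 1"
  unfolding \<theta>_def using assms finite_Lam by (auto intro!: wexp_bounds)

lemma \<theta>_0: "0 \<le> p \<Longrightarrow> p \<le> 1 \<Longrightarrow> x \<in> V \<Longrightarrow> \<theta> p x 0 = 1"
  unfolding \<theta>_def by (simp add: reach_0 wexp_const finite_Lam)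

lemma \<theta>_antimono:
  assumes "0 \<le> p" "p \<le> 1" "x \<in> V" "m \<le> n" shows "\<theta> p x n \<le> \<theta> p x m"
proof -
  have "bl x (2 * m) \<subseteq> bl x (2 * n)" using assms by (intro bl_mono) auto
  then show ?thesis
    unfolding \<theta>_def[of _ _ n] using assms by (intro wexp_reach_le_\<theta>) (auto simp: induced_Lam finite_Lam)
qed

lemma \<theta>_mono_p:
  assumes "0 \<le> p" "p \<le> p'" "p' \<le> 1" "x \<in> V" shows "\<theta> p x n \<le> \<theta> p' x n"
  unfolding \<theta>_def wexp_def using assms q by (intro gE_mono finite_Lam incr_reach) auto

section \<open>The differential inequality\<close>

lemma monotone_rc:
  fixes H :: "'a graph"
  assumes "finite_graph H" "0 < p" "p < 1"
  shows "monotone_measure (edges H) (rcw p q (edges H) (ncl (verts H) B))"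
proof
  have "closes_more (\<lambda>A. ncl (verts H) B (A \<union> {})) (\<lambda>A. ncl (verts H) B (A \<union> {})) (edges H)"
  proof (rule ncl_closes_more)
    fix A A' and x y :: 'a assume "A \<subseteq> A'" "(x, y) \<in> conn B (A \<union> {})"
    then show "(x, y) \<in> conn B (A' \<union> {})" using conn_mono[of A A' B B] by auto
  next
    fix e assume "e \<in> edges H"
    then show "\<exists>x y. e = {x, y} \<and> x \<in> verts H \<inter> verts H \<and> y \<in> verts H \<inter> verts H"
      using simple_edge[of H e] assms(1) unfolding finite_graph_def by blast
  qed (use assms in \<open>auto simp: finite_graph_def\<close>)
  then have k: "closes_more (ncl (verts H) B) (ncl (verts H) B) (edges H)" by simp
  show "finite (edges H)" using finite_edges assms by auto
  fix A C assume "A \<subseteq> edges H" "C \<subseteq> edges H"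
  then show "rcw p q (edges H) (ncl (verts H) B) A * rcw p q (edges H) (ncl (verts H) B) C
    \<le> rcw p q (edges H) (ncl (verts H) B) (A \<union> C) * rcw p q (edges H) (ncl (verts H) B) (A \<inter> C)"
    using finite_edges[OF assms(1)] assms q by (intro rcw_lattice k) auto
qed (use assms q in \<open>auto simp: rcw_pos\<close>)

definition covar :: "real \<Rightarrow> 'a graph \<Rightarrow> ('a set set \<Rightarrow> real) \<Rightarrow> real" where
  "covar p H f = (\<Sum>e\<in>edges H. wexp p H (\<lambda>A. f A * of_bool (e \<in> A)) - wexp p H f * wexp p H (\<lambda>A. of_bool (e \<in> A)))"

text \<open>With truncated subtraction \<open>(m - k) + (k - m)\<close> is the absolute difference
  of \<open>m\<close> and \<open>k\<close>. As \<open>k\<close> varies each value occurs at most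
  twice, once on either side of \<open>m\<close>.\<close>

lemma sum_abs_shift:
  fixes g :: "nat \<Rightarrow> real"
  assumes "\<And>j. 0 \<le> g j" "m \<le> n"
  shows "(\<Sum>k\<in>{1..n}. g ((m - k) + (k - m))) \<le> 2 * (\<Sum>j\<le>n. g j)"
proof -
  have "(\<Sum>k\<in>{1..n}. g ((m - k) + (k - m))) \<le> (\<Sum>k\<in>{1..m} \<union> {m..n}. g ((m - k) + (k - m)))"
    using assms by (intro sum_mono2) auto
  also have "\<dots> \<le> (\<Sum>k\<in>{1..m}. g ((m - k) + (k - m))) + (\<Sum>k\<in>{m..n}. g ((m - k) + (k - m)))"
    using assms by (subst sum.union_inter[symmetric]) (auto intro!: sum_nonneg)
  also have "(\<Sum>k\<in>{1..m}. g ((m - k) + (k - m))) = sum g ((\<lambda>k. m - k) ` {1..m})"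
    by (subst sum.reindex) (auto simp: inj_on_def)
  also have "\<dots> \<le> (\<Sum>j\<le>n. g j)" using assms by (intro sum_mono2) auto
  also have "(\<Sum>k\<in>{m..n}. g ((m - k) + (k - m))) = sum g ((\<lambda>k. k - m) ` {m..n})"
    by (subst sum.reindex) (auto simp: inj_on_def)
  also have "\<dots> \<le> (\<Sum>j\<le>n. g j)" using assms by (intro sum_mono2) auto
  finally show ?thesis by simp
qed

text \<open>Each value of \<open>j div 2\<close> occurs at most twice, and the largest one,
  \<open>n div 2\<close>, is below \<open>n\<close>.\<close>

lemma sum_half:
  fixes T :: "nat \<Rightarrow> real"
  assumes "\<And>j. 0 \<le> T j" "1 \<le> n"
  shows "(\<Sum>j\<le>n. T (j div 2)) \<le> 2 * (\<Sum>i<n. T i)"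
proof -
  have *: "(\<Sum>j\<le>2 * m + 1. T (j div 2)) = 2 * (\<Sum>i\<le>m. T i)" for m
    by (induction m) (simp_all add: algebra_simps)
  have "(\<Sum>j\<le>n. T (j div 2)) \<le> (\<Sum>j\<le>2 * (n div 2) + 1. T (j div 2))"
    using assms by (intro sum_mono2) auto
  also have "\<dots> = 2 * (\<Sum>i\<le>n div 2. T i)" by (rule *)
  also have "(\<Sum>i\<le>n div 2. T i) \<le> (\<Sum>i<n. T i)"
    using assms by (intro sum_mono2) auto
  finally show ?thesis by simp
qed

text \<open>By the triangle inequality every vertex of the sphere of radius \<open>k\<close> around
  \<open>x\<close> has distance at least the absolute difference of \<open>d x u\<close> and
  \<open>k\<close> from \<open>u\<close>.\<close>

lemma reach_from_sphere:
  assumes "x \<in> V" "u \<in> cl {y\<in>V. d x y = k} A" "A \<subseteq> edges G"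
  shows "u \<in> V \<and> reach u ((d x u - k) + (k - d x u)) A"
proof -
  obtain z where z: "z \<in> V" "d x z = k" "(z, u) \<in> (adj A)\<^sup>*" using assms by (auto simp: cl_def)
  have u: "u \<in> V" using z(3,1)
    by (induction rule: rtrancl_induct) (use assms(3) edge_verts in \<open>auto simp: adj_def\<close>)
  have uz: "(u, z) \<in> (adj A)\<^sup>*" using z(3) by (rule symD[OF sym_rtrancl[OF sym_adj]])
  have "d x u \<le> k + d z u" "k \<le> d x u + d u z"
    using d_triangle[of x z u] d_triangle[of x u z] assms z u by auto
  then have "(d x u - k) + (k - d x u) \<le> d u z" using d_sym[OF z(1) u] by auto
  then show ?thesis using reachI[OF u assms(3) uz] u by auto
qed

text \<open>OSSS with the arm event as both functions, summed over the radius \<open>k\<close> of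
  the sphere from which the exploration starts. For one \<open>k\<close> the edges near the sphere
  have large revealment; the sum over \<open>k\<close> levels this out to partial sums of arm
  probabilities. The \<open>8\<close> is a product of three factors \<open>2\<close>: the endpoints
  of an edge, \<open>sum_abs_shift\<close> and \<open>sum_half\<close>.\<close>

theorem one_arm_inequality:
  assumes p: "0 < p" "p < 1" and x: "x \<in> V" and n: "1 \<le> n"
    and T: "\<And>u i. u \<in> V \<Longrightarrow> \<theta> p u i \<le> T i"
  shows "real n * (\<theta> p x n * (1 - \<theta> p x n)) \<le> 8 * (\<Sum>i<n. T i) * covar p (Lam x (2 * n)) (\<lambda>A. of_bool (reach x n A))"
proof -
  let ?H = "Lam x (2 * n)" and ?F = "edges (Lam x n)" and ?B = "boundary G (Lam x (2 * n))"
  let ?E = "edges ?H" and ?K = "\<lambda>k. {y\<in>V. d x y = k}"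
  let ?f = "\<lambda>A. of_bool (reach x n A) :: real"
  let ?w = "rcw p q ?E (ncl (verts ?H) ?B)"
  have T0: "0 \<le> T i" for i using T[OF x, of i] \<theta>_bounds[of p x i] p x by auto
  have FE: "?F \<subseteq> ?E" using x by (intro edges_Lam_mono) auto
  have finH: "finite_graph ?H" by (rule finite_Lam[OF x])
  interpret monotone_measure ?E ?w by (rule monotone_rc[OF finH p])
  have wexp: "wE ?w (Pow ?E) g = wexp p ?H g" for g by (simp add: wexp_def gE_def rcE_def)
  define rev where "rev k e = revealment e (explore ?F (?K k) (card ?F) {} {}) {} {}" for k e
  have cv: "cv {} {} g e = wexp p ?H (\<lambda>A. g A * of_bool (e \<in> A)) - wexp p ?H g * wexp p ?H (\<lambda>A. of_bool (e \<in> A))" for g e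
    by (simp only: cv_def pr_def cyl_empty wexp)
  have main: "\<theta> p x n * (1 - \<theta> p x n) \<le> (\<Sum>e\<in>?E. rev k e * cv {} {} ?f e)" if k: "k \<in> {1..n}" for k
  proof -
    interpret exploration ?E ?w ?F "?K k" by unfold_locales (rule FE)
    have "wE ?w (Pow ?E) (\<lambda>A. ?f A * ?f A) - wE ?w (Pow ?E) ?f * wE ?w (Pow ?E) ?f \<le> (\<Sum>e\<in>?E. rev k e * cv {} {} ?f e)"
      unfolding rev_def
    proof (rule OSSS)
      show "determined ?f (explore ?F (?K k) (card ?F) {} {}) {} {}"
      proof (rule explore_determined)
        fix X A assume X: "X \<subseteq> ?F" "X \<subseteq> A" "A \<subseteq> ?E"
          and cl: "\<And>e. e \<in> ?F \<inter> A \<Longrightarrow> e \<inter> cl (?K k) X \<noteq> {} \<Longrightarrow> e \<in> X"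
        have "reach x n X" if r: "reach x n A"
        proof -
          \<comment> \<open>An arm to distance \<open>n\<close> meets the sphere of radius
            \<open>k\<close> at some \<open>z\<close>. Then \<open>x\<close> and \<open>y\<close>
            lie in the explored cluster of \<open>z\<close>, and the hypothesis \<open>cl\<close>
            puts every open edge of that cluster into \<open>X\<close>.\<close>
          obtain y where y: "y \<in> V" "d x y = n" "(x, y) \<in> (adj (A \<inter> ?F))\<^sup>*" using r by (auto simp: reach_def)
          have "reach x k (A \<inter> ?F)" using k y x edges_Lam_G by (intro reachI[of x _ y]) auto
          then obtain z where z: "z \<in> ?K k" "(x, z) \<in> (adj (A \<inter> ?F \<inter> edges (Lam x k)))\<^sup>*" by (auto simp: reach_def)
          have in_X: "(z, v) \<in> (adj X)\<^sup>*" if "(z, v) \<in> (adj (A \<inter> ?F))\<^sup>*" for v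
            using that
          proof (induction rule: rtrancl_induct)
            case (step v v')
            have "v \<in> cl (?K k) X" using step.IH z(1) unfolding cl_def by blast
            moreover have "{v, v'} \<in> ?F \<inter> A" using step.hyps(2) by (auto simp: adj_def)
            ultimately have "{v, v'} \<in> X" using cl[of "{v, v'}"] by blast
            then show ?case using step.IH by (auto simp: adj_def intro: rtrancl_into_rtrancl)
          qed simp
          have xz: "(x, z) \<in> (adj (A \<inter> ?F))\<^sup>*"
            using z(2) rtrancl_mono[OF adj_mono[of "A \<inter> ?F \<inter> edges (Lam x k)" "A \<inter> ?F"]] by blast
          then have zx: "(z, x) \<in> (adj (A \<inter> ?F))\<^sup>*" by (rule symD[OF sym_rtrancl[OF sym_adj]])
          then have "(z, y) \<in> (adj (A \<inter> ?F))\<^sup>*" using y(3) by (rule rtrancl_trans)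
          then have "(z, y) \<in> (adj X)\<^sup>*" "(z, x) \<in> (adj X)\<^sup>*" using in_X zx by auto
          moreover from this(2) have "(x, z) \<in> (adj X)\<^sup>*" by (rule symD[OF sym_rtrancl[OF sym_adj]])
          ultimately have "(x, y) \<in> (adj X)\<^sup>*" by (metis rtrancl_trans)
          have "X \<subseteq> edges G" using X(1) edges_Lam_G by (rule subset_trans)
          then show ?thesis using reachI[OF x _ \<open>(x, y) \<in> (adj X)\<^sup>*\<close>] y(2) by simp
        qed
        then have "reach x n A \<longleftrightarrow> reach x n X" using reach_mono_set X by blast
        then show "?f A = ?f X" by simp
      qed auto
    qed (auto simp: incr_reach explore_ok)
    moreover have "(\<lambda>A. ?f A * ?f A) = ?f" by (auto simp: fun_eq_iff)
    ultimately show ?thesis by (simp only: wexp \<theta>_def right_diff_distrib mult_1_right)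
  qed
  have point: "(\<Sum>k\<in>{1..n}. wexp p ?H (\<lambda>A. of_bool (u \<in> cl (?K k) (A \<inter> ?F)))) \<le> 4 * (\<Sum>i<n. T i)"
    if u: "u \<in> bl x n" for u
  proof -
    have uV: "u \<in> V" "d x u \<le> n" using u by (auto simp: bl_def)
    let ?g = "\<lambda>j. wexp p ?H (\<lambda>A. of_bool (reach u j A))"
    have g: "?g j \<le> T (j div 2)" if "j \<le> n" for j
    proof -
      \<comment> \<open>Since \<open>d x u \<le> n\<close> and \<open>2 * (j div 2) \<le> n\<close>,
        the comparison ball fits into the wired ball of radius \<open>2 * n\<close>. This is the
        reason for halving \<open>j\<close>.\<close>
      have "bl u (2 * (j div 2)) \<subseteq> bl x (2 * n)" using uV x that by (intro bl_mono) auto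
      then have "?g j \<le> \<theta> p u (j div 2)"
        using uV p x by (intro wexp_reach_le_\<theta>) (auto simp: induced_Lam finite_Lam)
      then show ?thesis using T[OF uV(1), of "j div 2"] by simp
    qed
    have "(\<Sum>k\<in>{1..n}. wexp p ?H (\<lambda>A. of_bool (u \<in> cl (?K k) (A \<inter> ?F)))) \<le> (\<Sum>k\<in>{1..n}. ?g ((d x u - k) + (k - d x u)))"
    proof (intro sum_mono wexp_le)
      fix k A
      have "reach u ((d x u - k) + (k - d x u)) A" if "u \<in> cl (?K k) (A \<inter> ?F)"
        using reach_from_sphere[OF x that] edges_Lam_G reach_mono_set by blast
      then show "of_bool (u \<in> cl (?K k) (A \<inter> ?F)) \<le> (of_bool (reach u ((d x u - k) + (k - d x u)) A) :: real)"
        by auto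
    qed (use p finH in auto)
    also have "\<dots> \<le> 2 * (\<Sum>j\<le>n. ?g j)"
      using uV p finH by (intro sum_abs_shift) (auto intro: wexp_bounds)
    also have "(\<Sum>j\<le>n. ?g j) \<le> (\<Sum>j\<le>n. T (j div 2))" using g by (intro sum_mono) auto
    also have "\<dots> \<le> 2 * (\<Sum>i<n. T i)" using T0 n by (intro sum_half) auto
    finally show ?thesis by simp
  qed
  have rev: "(\<Sum>k\<in>{1..n}. rev k e) \<le> 8 * (\<Sum>i<n. T i)" if e: "e \<in> ?E" for e
  proof (cases "e \<in> ?F")
    case True
    then obtain u v where uv: "e = {u, v}" "u \<in> bl x n" "v \<in> bl x n"
      using simple_edge[OF simple] edges_Lam_G by (auto simp: edges_Lam) (metis insert_subset)
    have "rev k e \<le> wexp p ?H (\<lambda>A. of_bool (u \<in> cl (?K k) (A \<inter> ?F))) + wexp p ?H (\<lambda>A. of_bool (v \<in> cl (?K k) (A \<inter> ?F)))" for k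
    proof -
      interpret exploration ?E ?w ?F "?K k" by unfold_locales (rule FE)
      have "rev k e \<le> wE ?w (Pow ?E) (\<lambda>A. of_bool (e \<inter> cl (?K k) (A \<inter> ?F) \<noteq> {}))"
        using explore_revealment[of "{}" "{}" e "card ?F"] True by (simp add: rev_def cyl_empty)
      also have "\<dots> \<le> wexp p ?H (\<lambda>A. of_bool (u \<in> cl (?K k) (A \<inter> ?F)) + of_bool (v \<in> cl (?K k) (A \<inter> ?F)))"
        unfolding wexp using p finH by (intro wexp_le) (auto simp: uv)
      finally show ?thesis by (simp add: wexp_def gE_def rcE_def wE_add)
    qed
    then have "(\<Sum>k\<in>{1..n}. rev k e) \<le> (\<Sum>k\<in>{1..n}. wexp p ?H (\<lambda>A. of_bool (u \<in> cl (?K k) (A \<inter> ?F))))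
        + (\<Sum>k\<in>{1..n}. wexp p ?H (\<lambda>A. of_bool (v \<in> cl (?K k) (A \<inter> ?F))))"
      by (simp add: sum_mono flip: sum.distrib)
    also have "\<dots> \<le> 8 * (\<Sum>i<n. T i)" using point[OF uv(2)] point[OF uv(3)] by simp
    finally show ?thesis .
  next
    case False
    have "rev k e = 0" for k
    proof -
      interpret exploration ?E ?w ?F "?K k" by unfold_locales (rule FE)
      show ?thesis unfolding rev_def by (rule explore_outside[OF False])
    qed
    then show ?thesis using T0 by (simp add: sum_nonneg)
  qed
  have "real n * (\<theta> p x n * (1 - \<theta> p x n)) = (\<Sum>k\<in>{1..n}. \<theta> p x n * (1 - \<theta> p x n))" by simp
  also have "\<dots> \<le> (\<Sum>k\<in>{1..n}. \<Sum>e\<in>?E. rev k e * cv {} {} ?f e)" by (intro sum_mono main)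
  also have "\<dots> = (\<Sum>e\<in>?E. (\<Sum>k\<in>{1..n}. rev k e) * cv {} {} ?f e)"
    by (subst sum.swap) (simp add: sum_distrib_right)
  also have "\<dots> \<le> (\<Sum>e\<in>?E. 8 * (\<Sum>i<n. T i) * cv {} {} ?f e)"
    by (intro sum_mono mult_right_mono rev cv_nonneg) (auto simp: incr_reach)
  also have "\<dots> = 8 * (\<Sum>i<n. T i) * covar p ?H ?f"
    unfolding covar_def cv by (simp only: sum_distrib_left)
  finally show ?thesis .
qed

end

section \<open>Dependence on the edge parameter\<close>

text \<open>In the variable \<open>h = ln (p / (1 - p))\<close> the weight of a configuration is proportional to
  \<open>exp (h * card A) * q ^ k A\<close>, so derivatives of expectations are covariances with \<open>card A\<close>.\<close>

definition logistic :: "real \<Rightarrow> real" where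
  "logistic h = exp h / (1 + exp h)"

lemma logistic_bounds: "0 < logistic h" "logistic h < 1"
  by (auto simp: logistic_def divide_simps add_pos_pos)

lemma logistic_mono: "h \<le> h' \<Longrightarrow> logistic h \<le> logistic h'"
proof -
  have "1 + exp x > 0" for x :: real by (simp add: add_pos_pos)
  then show "h \<le> h' \<Longrightarrow> logistic h \<le> logistic h'"
    by (simp add: logistic_def frac_le_eq divide_le_eq algebra_simps pos_divide_le_eq pos_le_divide_eq)
qed

lemma logistic_strict_mono: "h < h' \<Longrightarrow> logistic h < logistic h'"
proof -
  have "1 + exp x > 0" for x :: real by (simp add: add_pos_pos)
  then show "h < h' \<Longrightarrow> logistic h < logistic h'"
    by (simp add: logistic_def pos_divide_less_eq pos_less_divide_eq algebra_simps)
qed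

lemma logistic_surj:
  assumes "0 < p" "p < 1" shows "\<exists>h. p = logistic h"
proof
  have "exp (ln (p / (1 - p))) = p / (1 - p)" using assms by simp
  moreover have "1 + p / (1 - p) = 1 / (1 - p)" using assms by (simp add: field_simps)
  ultimately show "p = logistic (ln (p / (1 - p)))"
    using assms unfolding logistic_def by simp
qed

definition pf :: "real \<Rightarrow> 'e set \<Rightarrow> ('e set \<Rightarrow> nat) \<Rightarrow> ('e set \<Rightarrow> real) \<Rightarrow> real \<Rightarrow> real" where
  "pf q E k f h = (\<Sum>A\<in>Pow E. q ^ k A * f A * exp (h * real (card A)))"

lemma pf_pos: "finite E \<Longrightarrow> 1 \<le> q \<Longrightarrow> 0 < pf q E k (\<lambda>_. 1) h"
  unfolding pf_def by (intro sum_pos) auto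

text \<open>The factor \<open>(1 - logistic h) ^ card E\<close> is common to all configurations and
  cancels.\<close>

lemma rcE_logistic:
  assumes "finite E"
  shows "rcE (logistic h) q E k f = pf q E k f h / pf q E k (\<lambda>_. 1) h"
proof -
  let ?p = "logistic h" and ?c = "(1 - logistic h) ^ card E"
  have 1: "1 - ?p = 1 / (1 + exp h)"
  proof -
    have "1 + exp h \<noteq> 0" using exp_gt_zero[of h] by linarith
    then show ?thesis by (simp add: logistic_def field_simps)
  qed
  then have 2: "?p = (1 - ?p) * exp h" by (simp add: logistic_def)
  have w: "rcw ?p q E k A = ?c * (q ^ k A * exp (h * real (card A)))" if "A \<in> Pow E" for A
  proof -
    have c: "card A + card (E - A) = card E"
      using that assms card_mono[of E A] by (auto simp: card_Diff_subset finite_subset)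
    have "?p ^ card A * (1 - ?p) ^ card (E - A) = ((1 - ?p) * exp h) ^ card A * (1 - ?p) ^ card (E - A)"
      by (subst (1) 2) simp
    also have "\<dots> = (1 - ?p) ^ (card A + card (E - A)) * exp h ^ card A"
      by (simp add: power_mult_distrib power_add)
    also have "exp h ^ card A = exp (h * real (card A))" by (simp add: exp_of_nat2_mult)
    finally show ?thesis by (simp add: rcw_def c mult_ac)
  qed
  have "1 - ?p \<noteq> 0" using logistic_bounds[of h] by simp
  then have c0: "?c \<noteq> 0" by (rule power_not_zero)
  have num: "(\<Sum>A\<in>Pow E. rcw ?p q E k A * f A) = ?c * pf q E k f h"
    using w by (simp add: pf_def sum_distrib_left mult_ac)
  have den: "(\<Sum>A\<in>Pow E. rcw ?p q E k A) = ?c * pf q E k (\<lambda>_. 1) h"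
    using w by (simp add: pf_def sum_distrib_left)
  show ?thesis unfolding rcE_def wE_def num den by (rule mult_divide_mult_cancel_left[OF c0])
qed

lemma pf_deriv: "(pf q E k f has_real_derivative pf q E k (\<lambda>A. f A * real (card A)) h) (at h)"
  unfolding pf_def by (auto intro!: derivative_eq_intros sum.cong)

lemma rcE_deriv:
  assumes "finite E" "1 \<le> q"
  shows "((\<lambda>h. rcE (logistic h) q E k f) has_real_derivative
     (\<Sum>e\<in>E. rcE (logistic h) q E k (\<lambda>A. f A * of_bool (e \<in> A))
        - rcE (logistic h) q E k f * rcE (logistic h) q E k (\<lambda>A. of_bool (e \<in> A)))) (at h)"
proof -
  let ?N = "\<lambda>f h. pf q E k f h" and ?D = "pf q E k (\<lambda>_. 1)" and ?R = "rcE (logistic h) q E k"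
  have D: "?D h \<noteq> 0" using pf_pos[OF assms, of k h] by simp
  have "((\<lambda>h. ?N f h / ?D h) has_real_derivative
      (?N (\<lambda>A. f A * real (card A)) h * ?D h - ?N f h * ?N (\<lambda>A. 1 * real (card A)) h) / (?D h * ?D h)) (at h)"
    by (intro DERIV_divide pf_deriv D)
  moreover have "(?N (\<lambda>A. f A * real (card A)) h * ?D h - ?N f h * ?N (\<lambda>A. 1 * real (card A)) h) / (?D h * ?D h)
     = ?R (\<lambda>A. f A * real (card A)) - ?R f * ?R (\<lambda>A. real (card A))"
    using D by (simp add: rcE_logistic[OF assms(1)] field_simps)
  moreover have "?R (\<lambda>A. g A * real (card A)) = (\<Sum>e\<in>E. ?R (\<lambda>A. g A * of_bool (e \<in> A)))" for g
  proof -
    have "real (card A) = (\<Sum>e\<in>E. of_bool (e \<in> A))" if "A \<in> Pow E" for A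
    proof -
      have "E \<inter> {e. e \<in> A} = A" using that by auto
      then show ?thesis using assms(1) by simp
    qed
    then have "?R (\<lambda>A. g A * real (card A)) = ?R (\<lambda>A. \<Sum>e\<in>E. g A * of_bool (e \<in> A))"
      unfolding rcE_def by (intro wE_cong) (simp add: sum_distrib_left)
    then show ?thesis by (simp only: rcE_def wE_sum)
  qed
  note this[of f] this[of "\<lambda>_. 1"]
  ultimately show ?thesis
    by (simp add: rcE_logistic[OF assms(1), symmetric] sum_subtractf sum_distrib_left del: of_bool_eq_iff)
qed

section \<open>Dichotomy for a family of differential inequalities\<close>

lemma harmonic_le_ln: "1 \<le> n \<Longrightarrow> (\<Sum>i\<in>{1..n}. 1 / real i) \<le> 1 + ln (real n)"
proof (induction n rule: dec_induct)
  case (step n)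
  have "1 - inverse (real (Suc n) / real n) \<le> ln (real (Suc n) / real n)"
    using step.hyps ln_one_minus_pos_upper_bound[of "1 / real (Suc n)"] ln_inverse[of "real (Suc n) / real n"]
    by (simp add: field_simps)
  moreover have "1 - inverse (real (Suc n) / real n) = 1 / real (Suc n)" using step.hyps by (simp add: field_simps)
  moreover have "ln (real (Suc n) / real n) = ln (real (Suc n)) - ln (real n)" using step.hyps by (simp add: ln_div)
  ultimately show ?case using step.IH by (simp add: add.commute)
qed simp

locale sharp_family =
  fixes f f' :: "nat \<Rightarrow> real \<Rightarrow> real" and a b c M :: real
  assumes c: "0 < c" and M: "0 < M"
    and deriv: "\<And>n h. a \<le> h \<Longrightarrow> h \<le> b \<Longrightarrow> (f n has_real_derivative f' n h) (at h)"
    and nonneg: "\<And>n h. a \<le> h \<Longrightarrow> h \<le> b \<Longrightarrow> 0 \<le> f n h" and le_M: "\<And>n h. a \<le> h \<Longrightarrow> h \<le> b \<Longrightarrow> f n h \<le> M"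
    and f_0: "\<And>h. a \<le> h \<Longrightarrow> h \<le> b \<Longrightarrow> f 0 h = M"
    and mono: "\<And>n h h'. a \<le> h \<Longrightarrow> h \<le> h' \<Longrightarrow> h' \<le> b \<Longrightarrow> f n h \<le> f n h'"
    and ineq: "\<And>n h. 1 \<le> n \<Longrightarrow> a \<le> h \<Longrightarrow> h \<le> b \<Longrightarrow> c * real n * f n h \<le> (\<Sum>i<n. f i h) * f' n h"
begin

definition Sm :: "nat \<Rightarrow> real \<Rightarrow> real" where "Sm n h = (\<Sum>i<n. f i h)"

lemma Sm_mono: "a \<le> h \<Longrightarrow> h \<le> h' \<Longrightarrow> h' \<le> b \<Longrightarrow> Sm n h \<le> Sm n h'"
  unfolding Sm_def by (intro sum_mono mono)

lemma Sm_ge: "1 \<le> n \<Longrightarrow> a \<le> h \<Longrightarrow> h \<le> b \<Longrightarrow> M \<le> Sm n h"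
proof -
  assume *: "1 \<le> n" "a \<le> h" "h \<le> b"
  have "(\<Sum>i<1. f i h) \<le> Sm n h" unfolding Sm_def using * nonneg by (intro sum_mono2) auto
  then show ?thesis using * f_0 by simp
qed

lemma f'_nonneg: "1 \<le> n \<Longrightarrow> a \<le> h \<Longrightarrow> h \<le> b \<Longrightarrow> 0 \<le> f' n h"
proof -
  assume *: "1 \<le> n" "a \<le> h" "h \<le> b"
  have "0 \<le> c * real n * f n h" using c nonneg * by simp
  also have "\<dots> \<le> Sm n h * f' n h" unfolding Sm_def by (rule ineq[OF *])
  finally show ?thesis using Sm_ge[OF *] M by (simp add: zero_le_mult_iff)
qed

text \<open>On \<open>[h, t]\<close> the partial sum stays below \<open>s\<close>, so
  \<open>ineq\<close> gives a logarithmic derivative of at least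
  \<open>\<kappa> = c * n / s\<close>. Hence \<open>f n x * exp (- \<kappa> * x)\<close> is
  nondecreasing, and at \<open>t\<close> the bound \<open>M\<close> is available.\<close>

lemma exponential_bound:
  assumes n: "1 \<le> n" and h: "a \<le> h" "h \<le> t" "t \<le> b" and s: "Sm n t \<le> s"
  shows "f n h \<le> M * exp (- (c * real n * (t - h) / s))"
proof -
  have spos: "0 < s" using Sm_ge[OF n, of t] h s M by simp
  define \<kappa> where "\<kappa> = c * real n / s"
  have "f n h * exp (- \<kappa> * h) \<le> f n t * exp (- \<kappa> * t)"
  proof (rule DERIV_nonneg_imp_nondecreasing[OF h(2)])
    fix x assume x: "h \<le> x" "x \<le> t"
    then have x': "a \<le> x" "x \<le> b" using h by auto
    have "c * real n * f n x \<le> Sm n x * f' n x" unfolding Sm_def by (rule ineq[OF n x'])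
    also have "\<dots> \<le> s * f' n x"
      using Sm_mono[of x t n] x x' h s f'_nonneg[OF n x'] by (intro mult_right_mono) auto
    finally have "\<kappa> * f n x \<le> f' n x" using spos by (simp add: \<kappa>_def field_simps)
    then have "0 \<le> (f' n x - \<kappa> * f n x) * exp (- \<kappa> * x)" by simp
    moreover have "((\<lambda>x. f n x * exp (- \<kappa> * x)) has_real_derivative (f' n x - \<kappa> * f n x) * exp (- \<kappa> * x)) (at x)"
      by (rule derivative_eq_intros deriv[OF x'] refl)+ (simp add: algebra_simps)
    ultimately show "\<exists>y. ((\<lambda>x. f n x * exp (- \<kappa> * x)) has_real_derivative y) (at x) \<and> 0 \<le> y" by blast
  qed
  then have "f n h * exp (- \<kappa> * h) * exp (\<kappa> * h) \<le> f n t * exp (- \<kappa> * t) * exp (\<kappa> * h)"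
    by (rule mult_right_mono) simp
  then have "f n h \<le> f n t * exp (- (\<kappa> * (t - h)))"
    by (simp add: mult.assoc exp_add[symmetric] algebra_simps)
  also have "\<dots> \<le> M * exp (- (\<kappa> * (t - h)))" using le_M[of t n] h by (intro mult_right_mono) auto
  finally show ?thesis by (simp add: \<kappa>_def)
qed

text \<open>Otherwise \<open>exponential_bound\<close> applies with \<open>s = sqrt n\<close> for
  all large \<open>n\<close> and bounds \<open>f n a\<close> by a constant times
  \<open>exp (- (c * (t - a) * sqrt n))\<close>, which is summable.\<close>

lemma often_large:
  assumes "\<not> summable (\<lambda>n. f n a)" "a < t" "t \<le> b"
  shows "\<exists>\<^sub>F n in sequentially. sqrt (real n) < Sm n t"
proof (rule ccontr)
  assume "\<not> (\<exists>\<^sub>F n in sequentially. sqrt (real n) < Sm n t)"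
  then have "\<forall>\<^sub>F n in sequentially. Sm n t \<le> sqrt (real n)"
    by (simp add: frequently_def not_less)
  then have ev: "\<forall>\<^sub>F n in sequentially. norm (f n a) \<le> M * exp (- (c * (t - a) * sqrt (real n)))"
    using eventually_ge_at_top[of 1]
  proof eventually_elim
    case (elim n)
    have "f n a \<le> M * exp (- (c * real n * (t - a) / sqrt (real n)))"
      using elim assms by (intro exponential_bound) auto
    also have "c * real n * (t - a) / sqrt (real n) = c * (t - a) * sqrt (real n)"
      using elim real_div_sqrt[of "real n"] by (simp add: field_simps)
    finally show ?case using nonneg[of a n] assms by simp
  qed
  define k where "k = c * (t - a)"
  have k: "0 < k" using c assms by (simp add: k_def)
  have "(\<lambda>n. exp (- (k * sqrt (real n)))) \<in> O(\<lambda>n. 1 / real n ^ 2)"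
    using k by real_asymp
  then have "(\<lambda>n. M * exp (- (c * (t - a) * sqrt (real n)))) \<in> O(\<lambda>n. 1 / real n ^ 2)"
    using M by (simp add: k_def)
  moreover have "summable (\<lambda>n. norm (1 / real n ^ 2))"
    using inverse_power_summable[of 2, where 'a = real] by (simp add: inverse_eq_divide)
  ultimately have "summable (\<lambda>n. M * exp (- (c * (t - a) * sqrt (real n))))"
    by (rule summable_comparison_test_bigo[rotated])
  then have "summable (\<lambda>n. f n a)" by (rule summable_comparison_test_ev[OF ev])
  then show False using assms by simp
qed

text \<open>The sum of \<open>f i / i\<close> has derivative at least \<open>c * ln (Sm n / M)\<close>, of order \<open>ln n\<close> by
  \<open>often_large\<close>, but it would be \<open>o(ln n)\<close> if \<open>f n b\<close> tended to zero.\<close>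

lemma not_null:
  assumes ns: "\<not> summable (\<lambda>n. f n a)" and ab: "a < b"
  shows "\<not> (\<lambda>n. f n b) \<longlonglongrightarrow> 0"
proof
  assume lim: "(\<lambda>n. f n b) \<longlonglongrightarrow> 0"
  \<comment> \<open>The interval is split: between \<open>a\<close> and \<open>m\<close> the partial
    sums are made large by \<open>often_large\<close>, and between \<open>m\<close> and
    \<open>b\<close> the derivative bound is integrated.\<close>
  define m where "m = (a + b) / 2"
  have m: "a < m" "m < b" using ab by (auto simp: m_def)
  define \<kappa> where "\<kappa> = (b - m) * c"
  have \<kappa>: "0 < \<kappa>" using m c by (simp add: \<kappa>_def)
  define W where "W n h = (\<Sum>i\<in>{1..n}. f i h / real i)" for n h
  have low: "\<kappa> * (ln (Sm n m) - ln M) \<le> W n b" if n: "1 \<le> n" for n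
  proof -
    define W' where "W' h = (\<Sum>i\<in>{1..n}. f' i h / real i)" for h
    have dW: "(W n has_real_derivative W' h) (at h)" if "a \<le> h" "h \<le> b" for h
      unfolding W_def W'_def by (rule DERIV_sum) (use deriv that in \<open>auto intro!: DERIV_cdivide\<close>)
    have W': "c * (ln (Sm n m) - ln M) \<le> W' h" if h: "m \<le> h" "h \<le> b" for h
    proof -
      have h': "a \<le> h" using h m by simp
      \<comment> \<open>From \<open>ln (1 + y) \<le> y\<close>. The term \<open>f i / Sm i\<close>
        supplied by \<open>ineq\<close> thus dominates an increment of \<open>ln (Sm i)\<close>, and
        these increments telescope.\<close>
      have "ln (Sm (Suc i) h) - ln (Sm i h) \<le> f i h / Sm i h" if "1 \<le> i" for i
      proof -
        have pos: "0 < Sm i h" using Sm_ge[OF that h' h(2)] M by simp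
        have "ln (Sm (Suc i) h) - ln (Sm i h) = ln (1 + f i h / Sm i h)"
        proof -
          have "Sm (Suc i) h = Sm i h + f i h" by (simp add: Sm_def)
          moreover from this have "0 < Sm (Suc i) h" using pos nonneg[OF h' h(2), of i] by simp
          moreover have "(Sm i h + f i h) / Sm i h = 1 + f i h / Sm i h" using pos by (simp add: field_simps)
          ultimately show ?thesis using pos ln_div[of "Sm (Suc i) h" "Sm i h"] by simp
        qed
        also have "\<dots> \<le> f i h / Sm i h" using pos nonneg[OF h' h(2), of i] by (intro ln_add_one_self_le_self) auto
        finally show ?thesis .
      qed
      then have "(\<Sum>i\<in>{1..n}. ln (Sm (Suc i) h) - ln (Sm i h)) \<le> (\<Sum>i\<in>{1..n}. f i h / Sm i h)"
        by (intro sum_mono) auto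
      also have "(\<Sum>i\<in>{1..n}. ln (Sm (Suc i) h) - ln (Sm i h)) = ln (Sm (Suc n) h) - ln (Sm 1 h)"
        using n sum_Suc_diff[of 1 n "\<lambda>i. ln (Sm i h)"] by simp
      finally have 1: "ln (Sm (Suc n) h) - ln M \<le> (\<Sum>i\<in>{1..n}. f i h / Sm i h)"
        using f_0[OF h' h(2)] by (simp add: Sm_def)
      have "Sm n m \<le> Sm n h" using m h by (intro Sm_mono) auto
      also have "\<dots> \<le> Sm (Suc n) h" using nonneg[OF h' h(2)] by (simp add: Sm_def)
      finally have "ln (Sm n m) \<le> ln (Sm (Suc n) h)" using Sm_ge[OF n, of m] M m by simp
      with 1 have "c * (ln (Sm n m) - ln M) \<le> c * (\<Sum>i\<in>{1..n}. f i h / Sm i h)" using c by simp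
      also have "\<dots> = (\<Sum>i\<in>{1..n}. c * (f i h / Sm i h))" by (rule sum_distrib_left)
      also have "\<dots> \<le> W' h" unfolding W'_def
      proof (rule sum_mono)
        fix i assume i: "i \<in> {1..n}"
        then have pos: "0 < Sm i h" using Sm_ge[of i h] h' h M by simp
        have "c * real i * f i h \<le> Sm i h * f' i h" unfolding Sm_def using i h' h by (intro ineq) auto
        then show "c * (f i h / Sm i h) \<le> f' i h / real i" using pos i by (simp add: field_simps)
      qed
      finally show ?thesis .
    qed
    have "\<exists>z. m < z \<and> z < b \<and> W n b - W n m = (b - m) * W' z"
      using m dW by (intro MVT2) auto
    then obtain z where z: "m < z" "z < b" "W n b - W n m = (b - m) * W' z" by blast
    have "\<kappa> * (ln (Sm n m) - ln M) = (b - m) * (c * (ln (Sm n m) - ln M))" by (simp add: \<kappa>_def)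
    also have "\<dots> \<le> (b - m) * W' z" using W'[of z] z m by (intro mult_left_mono) auto
    also have "\<dots> \<le> W n b"
    proof -
      have "0 \<le> W n m" unfolding W_def using nonneg m by (intro sum_nonneg divide_nonneg_nonneg) auto
      then show ?thesis using z by linarith
    qed
    finally show ?thesis .
  qed
  \<comment> \<open>With \<open>\<kappa> / 4\<close> the upper bound for \<open>W n b\<close> grows
    like \<open>\<kappa> / 4 * ln n\<close>. The lower bound, used when
    \<open>Sm n m > sqrt n\<close>, grows like \<open>\<kappa> / 2 * ln n\<close>; \<open>R\<close>
    below is the value of \<open>ln n\<close> beyond which the two are incompatible.\<close>
  obtain n0 where n0: "\<And>n. n \<ge> n0 \<Longrightarrow> f n b < \<kappa> / 4"
    using order_tendstoD(2)[OF lim, of "\<kappa> / 4"] \<kappa> by (auto simp: eventually_sequentially)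
  define C where "C = (\<Sum>i\<in>{1..n0}. M / real i)"
  have up: "W n b \<le> C + \<kappa> / 4 * (1 + ln (real n))" if n: "1 \<le> n" for n
  proof -
    have "W n b \<le> (\<Sum>i\<in>{1..n}. (if i \<le> n0 then M / real i else 0) + \<kappa> / 4 * (1 / real i))"
      unfolding W_def
    proof (rule sum_mono)
      fix i assume i: "i \<in> {1..n}"
      show "f i b / real i \<le> (if i \<le> n0 then M / real i else 0) + \<kappa> / 4 * (1 / real i)"
      proof (cases "i \<le> n0")
        case True
        have "f i b / real i \<le> M / real i" using le_M ab by (intro divide_right_mono) auto
        then show ?thesis using True \<kappa> by (simp add: add_increasing2)
      next
        case False
        then have "f i b / real i \<le> (\<kappa> / 4) / real i" using n0[of i] by (intro divide_right_mono) auto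
        then show ?thesis using False by simp
      qed
    qed
    also have "\<dots> = (\<Sum>i\<in>{1..n}. if i \<le> n0 then M / real i else 0) + \<kappa> / 4 * (\<Sum>i\<in>{1..n}. 1 / real i)"
      by (simp only: sum.distrib sum_distrib_left)
    also have "(\<Sum>i\<in>{1..n}. if i \<le> n0 then M / real i else 0) = (\<Sum>i\<in>{1..n} \<inter> {..n0}. M / real i)"
      by (simp add: sum.If_cases) (rule sum.cong, auto)
    also have "\<dots> \<le> C" unfolding C_def using M by (intro sum_mono2) auto
    also have "(\<Sum>i\<in>{1..n}. 1 / real i) \<le> 1 + ln (real n)" by (rule harmonic_le_ln[OF n])
    finally show ?thesis using \<kappa> by simp
  qed
  define R where "R = (C + \<kappa> / 4 + \<kappa> * ln M) / (\<kappa> / 4)"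
  have "\<forall>\<^sub>F n in sequentially. R < ln (real n)"
    by (rule eventually_compose_filterlim[OF eventually_gt_at_top filterlim_compose[OF ln_at_top filterlim_real_sequentially]])
  then have ev: "\<forall>\<^sub>F n in sequentially. R < ln (real n) \<and> 1 \<le> n"
    using eventually_ge_at_top[of "1::nat"] by (rule eventually_conj)
  have "\<exists>n. sqrt (real n) < Sm n m \<and> R < ln (real n) \<and> 1 \<le> n"
  proof (rule ccontr)
    assume "\<not> ?thesis"
    then have "\<forall>\<^sub>F n in sequentially. \<not> sqrt (real n) < Sm n m" using ev by (auto elim: eventually_mono)
    then show False using often_large[OF ns m(1)] m by (simp add: frequently_def)
  qed
  then obtain n where n: "sqrt (real n) < Sm n m" "R < ln (real n)" "1 \<le> n" by blast
  have "ln (real n) / 2 = ln (sqrt (real n))" using n by (simp add: ln_sqrt)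
  also have "\<dots> \<le> ln (Sm n m)" using n by (intro ln_mono) auto
  finally have "\<kappa> * (ln (real n) / 2 - ln M) \<le> \<kappa> * (ln (Sm n m) - ln M)" using \<kappa> by simp
  also have "\<dots> \<le> C + \<kappa> / 4 * (1 + ln (real n))" using low[OF n(3)] up[OF n(3)] by simp
  finally have *: "\<kappa> * (ln (real n) / 2 - ln M) \<le> C + \<kappa> / 4 * (1 + ln (real n))" .
  have "\<kappa> * (ln (real n) / 2 - ln M) = \<kappa> * ln (real n) / 2 - \<kappa> * ln M"
    "\<kappa> / 4 * (1 + ln (real n)) = \<kappa> / 4 + \<kappa> * ln (real n) / 4"
    by (simp_all add: algebra_simps)
  then have "\<kappa> * ln (real n) / 4 \<le> C + \<kappa> / 4 + \<kappa> * ln M" using * by linarith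
  then have "ln (real n) \<le> R" using \<kappa> by (simp add: R_def field_simps)
  then show False using n(2) by simp
qed

end

section \<open>Automorphisms\<close>

definition gim :: "('a \<Rightarrow> 'a) \<Rightarrow> 'a graph \<Rightarrow> 'a graph" where
  "gim \<sigma> H = Graph (\<sigma> ` verts H) ((`) \<sigma> ` edges H)"

lemma gim_simps [simp]: "verts (gim \<sigma> H) = \<sigma> ` verts H" "edges (gim \<sigma> H) = (`) \<sigma> ` edges H"
  by (simp_all add: gim_def)

lemma adj_image: "(x, y) \<in> adj A \<Longrightarrow> (\<sigma> x, \<sigma> y) \<in> adj ((`) \<sigma> ` A)"
  by (auto simp: adj_def intro!: image_eqI[of _ _ "{x, y}"])

lemma rtrancl_adj_image: "(x, y) \<in> (adj A)\<^sup>* \<Longrightarrow> (\<sigma> x, \<sigma> y) \<in> (adj ((`) \<sigma> ` A))\<^sup>*"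
  by (induction rule: rtrancl_induct) (auto intro: rtrancl_into_rtrancl adj_image)

lemma inj_set_image: "inj \<sigma> \<Longrightarrow> inj ((`) \<sigma>)"
  by (simp add: inj_def[of "(`) \<sigma>"] inj_image_eq_iff)

lemma conn_image: "(x, y) \<in> conn B A \<Longrightarrow> (\<sigma> x, \<sigma> y) \<in> conn (\<sigma> ` B) ((`) \<sigma> ` A)"
  unfolding conn_def
  by (induction rule: rtrancl_induct) (auto intro: rtrancl_into_rtrancl adj_image)

lemma image_image_inv: "bij \<sigma> \<Longrightarrow> (`) (inv \<sigma>) ` (`) \<sigma> ` A = A"
  by (simp add: image_image bij_is_inj)

lemma conn_image_iff:
  assumes "bij \<sigma>" shows "(\<sigma> x, \<sigma> y) \<in> conn (\<sigma> ` B) ((`) \<sigma> ` A) \<longleftrightarrow> (x, y) \<in> conn B A"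
proof
  assume "(\<sigma> x, \<sigma> y) \<in> conn (\<sigma> ` B) ((`) \<sigma> ` A)"
  from conn_image[OF this, of "inv \<sigma>"] show "(x, y) \<in> conn B A"
    using assms by (simp add: image_image_inv bij_is_inj)
qed (rule conn_image)

lemma ncl_image:
  assumes "bij \<sigma>" shows "ncl (\<sigma> ` W) (\<sigma> ` B) ((`) \<sigma> ` A) = ncl W B A"
proof -
  have "conn (\<sigma> ` B) ((`) \<sigma> ` A) `` {\<sigma> x} = \<sigma> ` (conn B A `` {x})" for x
  proof (intro equalityI subsetI)
    fix y assume y: "y \<in> conn (\<sigma> ` B) ((`) \<sigma> ` A) `` {\<sigma> x}"
    obtain z where z: "y = \<sigma> z" using assms by (metis bij_pointE)
    then show "y \<in> \<sigma> ` (conn B A `` {x})" using y by (simp add: conn_image_iff[OF assms])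
  qed (auto simp: conn_image_iff[OF assms])
  then have "(\<lambda>x. conn (\<sigma> ` B) ((`) \<sigma> ` A) `` {x}) ` \<sigma> ` W = (`) \<sigma> ` (\<lambda>x. conn B A `` {x}) ` W"
    by (simp add: image_image)
  moreover have "inj_on ((`) \<sigma>) X" for X
    using inj_set_image[OF bij_is_inj[OF assms]] by (rule inj_on_subset) simp
  ultimately show ?thesis by (simp add: ncl_def card_image)
qed

text \<open>Relabelling by a bijection preserves the numbers of open edges, closed edges and
  clusters, hence all weights.\<close>

lemma gE_image:
  assumes "bij \<sigma>"
  shows "gE p q (gim \<sigma> H) (\<sigma> ` B) f = gE p q H B (\<lambda>A. f ((`) \<sigma> ` A))"
proof -
  let ?s = "(`) ((`) \<sigma>)"
  have inj1: "inj ((`) \<sigma>)" by (rule inj_set_image[OF bij_is_inj[OF assms]])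
  then have inj2: "inj ?s" by (rule inj_set_image)
  have Pow: "Pow (edges (gim \<sigma> H)) = ?s ` Pow (edges H)" by (simp add: image_Pow_surj)
  have w: "rcw p q (edges (gim \<sigma> H)) (ncl (verts (gim \<sigma> H)) (\<sigma> ` B)) (?s A) = rcw p q (edges H) (ncl (verts H) B) A"
    for A
  proof -
    have "card (?s A) = card A" using inj1 by (simp add: card_image inj_on_subset)
    moreover have "edges (gim \<sigma> H) - ?s A = ?s (edges H - A)" using inj1 by (simp add: image_set_diff)
    then have "card (edges (gim \<sigma> H) - ?s A) = card (edges H - A)"
      using inj1 by (simp add: card_image inj_on_subset)
    ultimately show ?thesis by (simp add: rcw_def ncl_image[OF assms])
  qed
  show ?thesis
    unfolding gE_def rcE_def wE_def Pow using inj_on_subset[OF inj2, of "Pow (edges H)"]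
    by (subst (1 2) sum.reindex) (auto simp: w simp del: gim_simps)
qed

section \<open>Invariance of arm probabilities under automorphisms\<close>

context lf_graph
begin

text \<open>A bijection of the whole type rather than of the vertices only, so that
  \<open>inv\<close> and images of arbitrary sets are well behaved.\<close>

definition aut :: "('a \<Rightarrow> 'a) \<Rightarrow> bool" where
  "aut \<sigma> \<longleftrightarrow> bij \<sigma> \<and> \<sigma> ` V = V \<and> (`) \<sigma> ` edges G = edges G"

lemma aut_inv: "aut \<sigma> \<Longrightarrow> aut (inv \<sigma>)"
proof -
  assume a: "aut \<sigma>"
  then have b: "bij \<sigma>" and V: "\<sigma> ` V = V" and E: "(`) \<sigma> ` edges G = edges G" by (auto simp: aut_def)
  have "inv \<sigma> ` \<sigma> ` V = V" using b by (simp add: image_image bij_is_inj)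
  then have 1: "inv \<sigma> ` V = V" unfolding V .
  have "(`) (inv \<sigma>) ` (`) \<sigma> ` edges G = edges G" using b by (rule image_image_inv)
  then have 2: "(`) (inv \<sigma>) ` edges G = edges G" unfolding E .
  show ?thesis using 1 2 b by (simp add: aut_def bij_imp_bij_inv)
qed

lemma aut_inv_eq: "aut \<sigma> \<Longrightarrow> inv \<sigma> (\<sigma> x) = x" "aut \<sigma> \<Longrightarrow> \<sigma> (inv \<sigma> x) = x"
  by (auto simp: aut_def bij_is_inj bij_is_surj surj_f_inv_f)

lemma aut_vert: "aut \<sigma> \<Longrightarrow> \<sigma> x \<in> V \<longleftrightarrow> x \<in> V"
  by (metis aut_def aut_inv aut_inv_eq(1) imageI)

lemma aut_edge: "aut \<sigma> \<Longrightarrow> \<sigma> ` e \<in> edges G \<longleftrightarrow> e \<in> edges G"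
proof -
  assume a: "aut \<sigma>"
  have "inv \<sigma> ` \<sigma> ` e = e" using a by (simp add: image_image aut_inv_eq)
  then show ?thesis using a aut_inv[OF a] unfolding aut_def by (metis imageI)
qed

lemma aut_edge2: "aut \<sigma> \<Longrightarrow> {\<sigma> x, \<sigma> y} \<in> edges G \<longleftrightarrow> {x, y} \<in> edges G"
  using aut_edge[of \<sigma> "{x, y}"] by simp

lemma d_aut_le:
  assumes "aut \<sigma>" "x \<in> V" "y \<in> V" shows "d (\<sigma> x) (\<sigma> y) \<le> d x y"
proof (rule d_le)
  have "(\<sigma> x, \<sigma> y) \<in> adj (edges G) ^^ n" if "(x, y) \<in> adj (edges G) ^^ n" for n y
    using that
  proof (induction n arbitrary: y)
    case (Suc n)
    then obtain z where z: "(x, z) \<in> adj (edges G) ^^ n" "(z, y) \<in> adj (edges G)" by auto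
    have "(\<sigma> z, \<sigma> y) \<in> adj (edges G)" using z(2) by (simp add: adj_def aut_edge2[OF assms(1)])
    then show ?case using Suc.IH[OF z(1)] by auto
  qed simp
  then show "(\<sigma> x, \<sigma> y) \<in> adj (edges G) ^^ d x y" using d_path[OF assms(2,3)] .
qed

lemma d_aut: "aut \<sigma> \<Longrightarrow> x \<in> V \<Longrightarrow> y \<in> V \<Longrightarrow> d (\<sigma> x) (\<sigma> y) = d x y"
  using d_aut_le[of \<sigma> x y] d_aut_le[OF aut_inv, of \<sigma> "\<sigma> x" "\<sigma> y"] by (simp add: aut_vert aut_inv_eq)

lemma bl_aut: "aut \<sigma> \<Longrightarrow> x \<in> V \<Longrightarrow> bl (\<sigma> x) n = \<sigma> ` bl x n"
proof (intro equalityI subsetI)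
  fix y assume a: "aut \<sigma>" "x \<in> V" "y \<in> bl (\<sigma> x) n"
  have "y = \<sigma> (inv \<sigma> y)" using a by (simp add: aut_inv_eq)
  moreover have "inv \<sigma> y \<in> bl x n"
    using a d_aut[OF a(1,2), of "inv \<sigma> y"] aut_vert[OF aut_inv[OF a(1)], of y] by (auto simp: bl_def aut_inv_eq)
  ultimately show "y \<in> \<sigma> ` bl x n" by blast
qed (auto simp: bl_def aut_vert d_aut)

lemma ind_aut: "aut \<sigma> \<Longrightarrow> ind G (\<sigma> ` W) = gim \<sigma> (ind G W)"
proof -
  assume a: "aut \<sigma>"
  have "{e\<in>edges G. e \<subseteq> \<sigma> ` W} = (`) \<sigma> ` {e\<in>edges G. e \<subseteq> W}"
  proof (intro equalityI subsetI)
    fix e assume e: "e \<in> {e\<in>edges G. e \<subseteq> \<sigma> ` W}"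
    have "e = \<sigma> ` inv \<sigma> ` e" using a by (simp add: image_image aut_inv_eq)
    moreover have "inv \<sigma> ` e \<in> edges G" using aut_edge[OF aut_inv[OF a]] e by simp
    moreover have "inv \<sigma> ` e \<subseteq> W" using e a by (auto simp: aut_inv_eq)
    ultimately show "e \<in> (`) \<sigma> ` {e\<in>edges G. e \<subseteq> W}" by blast
  qed (use a in \<open>auto simp: aut_edge\<close>)
  then show ?thesis by (simp add: ind_def gim_def)
qed

lemma Lam_aut: "aut \<sigma> \<Longrightarrow> x \<in> V \<Longrightarrow> Lam (\<sigma> x) n = gim \<sigma> (Lam x n)"
  unfolding Lam_def by (simp add: bl_aut ind_aut)

lemma boundary_aut: "aut \<sigma> \<Longrightarrow> boundary G (gim \<sigma> H) = \<sigma> ` boundary G H"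
proof (intro equalityI subsetI)
  fix v assume a: "aut \<sigma>" "v \<in> boundary G (gim \<sigma> H)"
  then obtain x u where x: "v = \<sigma> x" "x \<in> verts H" and u: "u \<in> V" "u \<notin> \<sigma> ` verts H" "{u, \<sigma> x} \<in> edges G"
    by (auto simp: boundary_def)
  have "{inv \<sigma> u, x} \<in> edges G" using u(3) aut_edge2[OF a(1), of "inv \<sigma> u" x] a by (simp add: aut_inv_eq)
  moreover have "inv \<sigma> u \<in> V - verts H" using u aut_vert[OF aut_inv[OF a(1)], of u] a aut_inv_eq(2)[OF a(1), of u]
    by (metis DiffI imageI)
  ultimately show "v \<in> \<sigma> ` boundary G H" using x by (auto simp: boundary_def)
next
  fix v assume a: "aut \<sigma>" "v \<in> \<sigma> ` boundary G H"
  then obtain x u where x: "v = \<sigma> x" "x \<in> verts H" "u \<in> V" "u \<notin> verts H" "{u, x} \<in> edges G" by (auto simp: boundary_def)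
  have "\<sigma> u \<notin> \<sigma> ` verts H" using x(4) aut_inv_eq(1)[OF a(1)] by (metis imageE)
  moreover have "\<sigma> u \<in> V" "{\<sigma> u, \<sigma> x} \<in> edges G" using x a by (auto simp: aut_vert aut_edge2)
  ultimately show "v \<in> boundary G (gim \<sigma> H)" using x(2) unfolding boundary_def x(1) by auto
qed

lemma reach_aut_imp:
  assumes a: "aut \<sigma>" and x: "x \<in> V" and r: "reach x n A" shows "reach (\<sigma> x) n ((`) \<sigma> ` A)"
proof -
  obtain y where y: "y \<in> V" "d x y = n" "(x, y) \<in> (adj (A \<inter> edges (Lam x n)))\<^sup>*" using r by (auto simp: reach_def)
  have "(\<sigma> x, \<sigma> y) \<in> (adj ((`) \<sigma> ` (A \<inter> edges (Lam x n))))\<^sup>*" by (rule rtrancl_adj_image[OF y(3)])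
  moreover have "(`) \<sigma> ` (A \<inter> edges (Lam x n)) \<subseteq> (`) \<sigma> ` A \<inter> edges (Lam (\<sigma> x) n)"
    using a x by (auto simp: Lam_aut)
  ultimately have "(\<sigma> x, \<sigma> y) \<in> (adj ((`) \<sigma> ` A \<inter> edges (Lam (\<sigma> x) n)))\<^sup>*"
    using rtrancl_mono[OF adj_mono] by blast
  then show ?thesis unfolding reach_def using a x y by (intro bexI[of _ "\<sigma> y"]) (auto simp: d_aut aut_vert)
qed

lemma reach_aut: "aut \<sigma> \<Longrightarrow> x \<in> V \<Longrightarrow> reach (\<sigma> x) n ((`) \<sigma> ` A) \<longleftrightarrow> reach x n A"
  using reach_aut_imp[of \<sigma> x n A] reach_aut_imp[OF aut_inv, of \<sigma> "\<sigma> x" n "(`) \<sigma> ` A"]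
  by (auto simp: aut_inv_eq aut_vert image_image_inv aut_def)

lemma \<theta>_aut: "aut \<sigma> \<Longrightarrow> x \<in> V \<Longrightarrow> \<theta> p (\<sigma> x) n = \<theta> p x n"
  unfolding \<theta>_def wexp_def by (simp add: Lam_aut boundary_aut gE_image reach_aut aut_def[THEN iffD1, THEN conjunct1])

section \<open>Local events in infinite volume\<close>

lemma incr_restrict: "incr_on F f \<Longrightarrow> incr_on E (\<lambda>A. f (A \<inter> F))"
  unfolding incr_on_def by (meson Int_lower2 Int_mono order_refl)

definition Pw :: "real \<Rightarrow> 'a set set \<Rightarrow> ('a set set \<Rightarrow> bool) \<Rightarrow> real" where
  "Pw p F Q = measure (wired_rc p q G) {\<omega> \<in> space (wired_rc p q G). Q {e\<in>F. \<omega> e}}"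

definition Pf :: "real \<Rightarrow> 'a set set \<Rightarrow> ('a set set \<Rightarrow> bool) \<Rightarrow> real" where
  "Pf p F Q = measure (free_rc p q G) {\<omega> \<in> space (free_rc p q G). Q {e\<in>F. \<omega> e}}"

lemma exhausts_Lam:
  assumes x: "x \<in> V" and r: "strict_mono r" shows "exhausts (\<lambda>n. Lam x (r n)) G"
proof -
  have le: "n \<le> r n" for n using strict_mono_imp_increasing[OF r] .
  have "r n \<le> r (Suc n)" for n using r by (simp add: strict_mono_less_eq)
  then have "subgraph (Lam x (r n)) (Lam x (r (Suc n)))" for n
    unfolding subgraph_def using x bl_mono[OF x x, of "r n" "r (Suc n)"] edges_Lam_mono[OF x x, of "r n" "r (Suc n)"] by auto
  moreover have "(\<Union>n. bl x (r n)) = V"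
  proof (intro equalityI subsetI)
    fix y assume "y \<in> V"
    then have "y \<in> bl x (r (d x y))" using le by (auto simp: bl_def)
    then show "y \<in> (\<Union>n. bl x (r n))" by blast
  qed (auto simp: bl_def)
  moreover have "(\<Union>n. edges (Lam x (r n))) = edges G"
  proof (intro equalityI subsetI)
    fix e assume e: "e \<in> edges G"
    then obtain u v where uv: "e = {u, v}" "u \<in> V" "v \<in> V" using simple_edge[OF simple] by blast
    have "d x u \<le> r (d x u + d x v)" "d x v \<le> r (d x u + d x v)" using le[of "d x u + d x v"] by auto
    then have "e \<in> edges (Lam x (r (d x u + d x v)))" using e uv by (auto simp: edges_Lam bl_def)
    then show "e \<in> (\<Union>n. edges (Lam x (r n)))" by blast
  qed (auto simp: edges_Lam)
  ultimately show ?thesis using finite_Lam[OF x] by (simp add: exhausts_def)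
qed

context
  fixes p :: real assumes p: "0 \<le> p" "p \<le> 1"
begin

lemma Pw_limit:
  assumes "exhausts H G" "\<And>n. induced_subgraph (H n) G" "finite F" "F \<subseteq> edges G"
  shows "(\<lambda>n. wexp p (H n) (\<lambda>A. of_bool (Q (A \<inter> F)))) \<longlonglongrightarrow> Pw p F Q"
  unfolding Pw_def wexp_def by (rule wired_rc_limit[OF p assms])

lemma Pf_limit:
  assumes "exhausts H G" "finite F" "F \<subseteq> edges G"
  shows "(\<lambda>n. gE p q (H n) {} (\<lambda>A. of_bool (Q (A \<inter> F)))) \<longlonglongrightarrow> Pf p F Q"
  unfolding Pf_def by (rule free_rc_limit[OF p assms])

text \<open>Wired probabilities of increasing events decrease along an exhaustion, so every finite
  volume bounds the limit from above.\<close>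

lemma Pw_le_wexp:
  assumes H: "induced_subgraph H G" "finite_graph H" and F: "F \<subseteq> edges H" and Q: "incr_on F (\<lambda>A. of_bool (Q A) :: real)"
  shows "Pw p F Q \<le> wexp p H (\<lambda>A. of_bool (Q (A \<inter> F)))"
proof -
  obtain K where K: "exhausts K G" "\<And>n. induced_subgraph (K n) G"
    using ex_induced_exhaustion[OF simple countable nonempty] by blast
  have HG: "verts H \<subseteq> V" "edges H \<subseteq> edges G" using H by (auto simp: induced_subgraph_def)
  have F': "finite F" "F \<subseteq> edges G" using F HG finite_edges[OF H(2)] by (auto intro: finite_subset)
  have "\<forall>\<^sub>F n in sequentially. verts H \<subseteq> verts (K n) \<and> {} \<subseteq> edges (K n)"
    using H HG by (intro exhausts_eventually[OF K(1)]) (auto simp: finite_graph_def)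
  then have "\<forall>\<^sub>F n in sequentially. wexp p (K n) (\<lambda>A. of_bool (Q (A \<inter> F))) \<le> wexp p H (\<lambda>A. of_bool (Q (A \<inter> F)))"
  proof eventually_elim
    case (elim n)
    have "A \<inter> edges H \<inter> F = A \<inter> F" for A using F by auto
    then show ?case using elim p H K exhausts_finite[OF K(1)] Q
      by (intro wexp_mono incr_restrict[OF Q]) auto
  qed
  then show ?thesis by (rule tendsto_upperbound[OF Pw_limit[OF K F', of Q]]) simp
qed

text \<open>Free probabilities of increasing events increase along an exhaustion, so every finite
  volume bounds the limit from below.\<close>

lemma Pf_ge_gE:
  assumes H: "subgraph H G" "finite_graph H" and F: "F \<subseteq> edges H" and Q: "incr_on F (\<lambda>A. of_bool (Q A) :: real)"
  shows "gE p q H {} (\<lambda>A. of_bool (Q (A \<inter> F))) \<le> Pf p F Q"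
proof -
  obtain K where K: "exhausts K G" "\<And>n. induced_subgraph (K n) G"
    using ex_induced_exhaustion[OF simple countable nonempty] by blast
  have HG: "verts H \<subseteq> V" "edges H \<subseteq> edges G" using H by (auto simp: subgraph_def)
  have F': "finite F" "F \<subseteq> edges G" using F HG finite_edges[OF H(2)] by (auto intro: finite_subset)
  have "\<forall>\<^sub>F n in sequentially. verts H \<subseteq> verts (K n) \<and> edges H \<subseteq> edges (K n)"
    using H HG finite_edges[OF H(2)] by (intro exhausts_eventually[OF K(1)]) (auto simp: finite_graph_def)
  then have "\<forall>\<^sub>F n in sequentially. gE p q H {} (\<lambda>A. of_bool (Q (A \<inter> F))) \<le> gE p q (K n) {} (\<lambda>A. of_bool (Q (A \<inter> F)))"
  proof eventually_elim
    case (elim n)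
    then show ?case using p H q exhausts_finite[OF K(1)] Q
      by (intro gE_free_mono incr_restrict[OF Q]) (auto simp: subgraph_def)
  qed
  then show ?thesis by (rule tendsto_lowerbound[OF Pf_limit[OF K(1) F', of Q]]) simp
qed

lemma Pf_le_Pw:
  assumes F: "finite F" "F \<subseteq> edges G" and Q: "incr_on F (\<lambda>A. of_bool (Q A) :: real)"
  shows "Pf p F Q \<le> Pw p F Q"
proof -
  obtain K where K: "exhausts K G" "\<And>n. induced_subgraph (K n) G"
    using ex_induced_exhaustion[OF simple countable nonempty] by blast
  have "gE p q (K n) {} (\<lambda>A. of_bool (Q (A \<inter> F))) \<le> wexp p (K n) (\<lambda>A. of_bool (Q (A \<inter> F)))" for n
    unfolding wexp_def using p q exhausts_finite[OF K(1)] by (intro gE_mono incr_restrict[OF Q]) auto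
  then show ?thesis using LIMSEQ_le[OF Pf_limit[OF K(1) F, of Q] Pw_limit[OF K F, of Q]] by blast
qed

lemma Pw_reach_le:
  assumes x: "x \<in> V" shows "Pw p (edges (Lam x n)) (reach x n) \<le> \<theta> p x n"
proof -
  have "Pw p (edges (Lam x n)) (reach x n) \<le> wexp p (Lam x (2 * n)) (\<lambda>A. of_bool (reach x n (A \<inter> edges (Lam x n))))"
    using x by (intro Pw_le_wexp induced_Lam finite_Lam edges_Lam_mono incr_reach) auto
  then show ?thesis by (simp add: \<theta>_def reach_local)
qed

text \<open>For \<open>n \<ge> m\<close> an arm of length \<open>n\<close> contains one of length
  \<open>m\<close>, so \<open>\<theta> p x n\<close> bounds the probability of the shorter arm in
  the wired ball of radius \<open>2 * n\<close> from below. Then \<open>n\<close> tends to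
  infinity.\<close>

lemma Pw_reach_ge:
  assumes x: "x \<in> V" and L: "\<And>n. L \<le> \<theta> p x n" shows "L \<le> Pw p (edges (Lam x m)) (reach x m)"
proof -
  have "exhausts (\<lambda>n. Lam x (2 * n)) G" by (rule exhausts_Lam[OF x]) (auto simp: strict_mono_def)
  then have lim: "(\<lambda>n. wexp p (Lam x (2 * n)) (\<lambda>A. of_bool (reach x m (A \<inter> edges (Lam x m))))) \<longlonglongrightarrow> Pw p (edges (Lam x m)) (reach x m)"
    using induced_Lam finite_edges[OF finite_Lam[OF x]] edges_Lam_G by (rule Pw_limit)
  have "\<forall>\<^sub>F n in sequentially. L \<le> wexp p (Lam x (2 * n)) (\<lambda>A. of_bool (reach x m (A \<inter> edges (Lam x m))))"
    using eventually_ge_at_top[of m]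
  proof eventually_elim
    case (elim n)
    have "L \<le> \<theta> p x n" by (rule L)
    also have "\<dots> \<le> wexp p (Lam x (2 * n)) (\<lambda>A. of_bool (reach x m (A \<inter> edges (Lam x m))))"
      unfolding \<theta>_def using p x reach_antimono[OF x _ elim] by (intro wexp_le) (auto simp: finite_Lam reach_local)
    finally show ?case .
  qed
  then show ?thesis by (rule tendsto_lowerbound[OF lim]) simp
qed

lemma connection_bound:
  assumes x: "x \<in> V" and y: "y \<in> V"
  shows "measure (wired_rc p q G) {\<omega> \<in> space (wired_rc p q G). joined G \<omega> x y} \<le> \<theta> p x (d x y)"
proof -
  let ?M = "wired_rc p q G" and ?F = "edges (Lam x (d x y))"
  interpret prob_space ?M by (rule wired_rc_prob[OF p])
  have F: "finite ?F" "?F \<subseteq> edges G" using finite_edges[OF finite_Lam[OF x]] edges_Lam_G by auto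
  have sp: "space ?M = space (CS (edges G))" by (rule sets_eq_imp_space_eq[OF wired_rc_sets[OF p]])
  have "measure ?M {\<omega> \<in> space ?M. joined G \<omega> x y} \<le> measure ?M {\<omega> \<in> space ?M. reach x (d x y) {e\<in>?F. \<omega> e}}"
  proof (rule finite_measure_mono)
    show "{\<omega> \<in> space ?M. joined G \<omega> x y} \<subseteq> {\<omega> \<in> space ?M. reach x (d x y) {e\<in>?F. \<omega> e}}"
    proof clarify
      fix \<omega> assume j: "joined G \<omega> x y"
      have "reach x (d x y) (open_edges G \<omega>)"
        by (rule reachI[OF x _ j[unfolded joined_def]]) (auto simp: open_edges_def)
      then have "reach x (d x y) (open_edges G \<omega> \<inter> ?F)" by (simp add: reach_local)
      moreover have "open_edges G \<omega> \<inter> ?F = {e\<in>?F. \<omega> e}" using F by (auto simp: open_edges_def)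
      ultimately show "reach x (d x y) {e\<in>?F. \<omega> e}" by simp
    qed
    show "{\<omega> \<in> space ?M. reach x (d x y) {e\<in>?F. \<omega> e}} \<in> events"
      unfolding sp wired_rc_sets[OF p] by (rule measurable_local[OF F])
  qed
  also have "\<dots> \<le> \<theta> p x (d x y)" using Pw_reach_le[OF x, of "d x y"] by (simp add: Pw_def)
  finally show ?thesis .
qed

end

text \<open>For \<open>p < 1\<close> the empty configuration has positive weight, and it contains no
  arm of positive length.\<close>

lemma \<theta>_less_1:
  assumes p: "0 \<le> p" "p < 1" and x: "x \<in> V" and n: "1 \<le> n" shows "\<theta> p x n < 1"
proof -
  let ?H = "Lam x (2 * n)"
  let ?w = "rcw p q (edges ?H) (ncl (verts ?H) (boundary G ?H))" and ?E = "edges ?H"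
  have fin: "finite ?E" by (rule finite_edges[OF finite_Lam[OF x]])
  have Z: "0 < sum ?w (Pow ?E)" using p q fin by (intro rcw_sum_pos) auto
  have "\<not> reach x n {}"
  proof
    assume "reach x n {}"
    then obtain y where "d x y = n" "(x, y) \<in> (adj {})\<^sup>*" by (auto simp: reach_def)
    then show False using n by (auto simp: adj_def)
  qed
  then have "(\<Sum>A\<in>Pow ?E. ?w A * of_bool (reach x n A)) < sum ?w (Pow ?E)"
    using fin p q by (intro sum_strict_mono_ex1) (auto simp: rcw_nonneg intro!: bexI[of _ "{}"], auto simp: rcw_def)
  then show ?thesis using Z by (simp add: \<theta>_def wexp_def gE_def rcE_def wE_def)
qed

end

section \<open>Periodic graphs and the critical point\<close>

locale periodic_graph = lf_graph G q for G :: "'a graph" and q +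
  fixes \<tau> :: "int \<times> int \<Rightarrow> 'a \<Rightarrow> 'a" and D :: "'a set"
  assumes \<tau>_aut: "aut (\<tau> z)" and \<tau>_add: "\<tau> z (\<tau> z' x) = \<tau> (z + z') x"
    and D: "finite D" "D \<subseteq> V" "D \<noteq> {}" and cover: "V = (\<Union>z. \<tau> z ` D)"
    and disjoint: "x \<in> D \<Longrightarrow> y \<in> D \<Longrightarrow> \<tau> z x = \<tau> z' y \<Longrightarrow> z = z'"
begin

text \<open>A sum over the fundamental domain, since a maximum would not be differentiable in the parameter.\<close>

definition arm :: "nat \<Rightarrow> real \<Rightarrow> real" where
  "arm n p = (\<Sum>u\<in>D. \<theta> p u n)"

lemma \<theta>_le_arm:
  assumes "0 \<le> p" "p \<le> 1" "x \<in> V" shows "\<theta> p x n \<le> arm n p"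
proof -
  obtain z u where u: "u \<in> D" "x = \<tau> z u" using assms(3) cover by auto
  have "u \<in> V" using u D by auto
  then have "\<theta> p x n = \<theta> p u n" using u by (simp add: \<theta>_aut[OF \<tau>_aut])
  also have "\<dots> \<le> arm n p"
    unfolding arm_def using u D assms by (intro member_le_sum \<theta>_bounds) auto
  finally show ?thesis .
qed

text \<open>OSSS produces the variance \<open>\<theta> * (1 - \<theta>)\<close>, and a uniform lower
  bound on the second factor makes the inequality linear in \<open>\<theta>\<close>. Periodicity
  leaves finitely many vertices to consider, and monotonicity leaves \<open>n = 1\<close> and the
  largest parameter.\<close>

lemma \<theta>_1_bound:
  assumes p: "0 \<le> p" "p < 1"
  shows "\<exists>\<rho>>0. \<forall>p' x n. 0 \<le> p' \<longrightarrow> p' \<le> p \<longrightarrow> x \<in> V \<longrightarrow> 1 \<le> n \<longrightarrow> \<theta> p' x n \<le> 1 - \<rho>"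
proof -
  define m where "m = Max ((\<lambda>u. \<theta> p u 1) ` D)"
  have "m < 1" unfolding m_def using D p by (subst Max_less_iff) (auto intro!: \<theta>_less_1)
  moreover have "\<theta> p' x n \<le> m" if *: "0 \<le> p'" "p' \<le> p" "x \<in> V" "1 \<le> n" for p' x n
  proof -
    obtain z u where u: "u \<in> D" "x = \<tau> z u" using *(3) cover by auto
    then have uV: "u \<in> V" using D by auto
    have "\<theta> p' x n \<le> \<theta> p' x 1" using * p by (intro \<theta>_antimono) auto
    also have "\<dots> \<le> \<theta> p x 1" using * p by (intro \<theta>_mono_p) auto
    also have "\<dots> = \<theta> p u 1" using u uV by (simp add: \<theta>_aut[OF \<tau>_aut])
    also have "\<dots> \<le> m" unfolding m_def using u D by (intro Max_ge) auto
    finally show ?thesis .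
  qed
  ultimately show ?thesis by (intro exI[of _ "1 - m"]) auto
qed

text \<open>Bounding every \<open>\<theta> p u i\<close> by \<open>arm i p\<close> and summing the
  one-arm inequality over \<open>D\<close> gives a closed inequality for \<open>arm\<close>. Its
  constant is \<open>\<rho> / 8\<close>, where \<open>\<rho>\<close> bounds
  \<open>1 - \<theta>\<close> from below up to the parameter \<open>logistic b\<close>.\<close>

lemma sharp_arm:
  assumes "a \<le> b"
  shows "\<exists>c f'. sharp_family (\<lambda>n h. arm n (logistic h)) f' a b c (real (card D))"
proof -
  have lb: "0 \<le> logistic h" "logistic h \<le> 1" "0 < logistic h" "logistic h < 1" for h
    using logistic_bounds[of h] by auto
  obtain \<rho> where \<rho>: "0 < \<rho>" "\<And>p' x n. 0 \<le> p' \<Longrightarrow> p' \<le> logistic b \<Longrightarrow> x \<in> V \<Longrightarrow> 1 \<le> n \<Longrightarrow> \<theta> p' x n \<le> 1 - \<rho>"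
    using \<theta>_1_bound[of "logistic b"] lb by blast
  define C where "C n h u = covar (logistic h) (Lam u (2 * n)) (\<lambda>A. of_bool (reach u n A))" for n h u
  define f' where "f' n h = (\<Sum>u\<in>D. C n h u)" for n h
  have "sharp_family (\<lambda>n h. arm n (logistic h)) f' a b (\<rho> / 8) (real (card D))"
  proof
    show "0 < \<rho> / 8" using \<rho> by simp
    show "0 < real (card D)" using D by (simp add: card_gt_0_iff)
  next
    fix n h
    have "((\<lambda>h. \<theta> (logistic h) u n) has_real_derivative C n h u) (at h)" if "u \<in> D" for u
      unfolding \<theta>_def C_def covar_def wexp_def gE_def
      using that D finite_edges[OF finite_Lam] q by (intro rcE_deriv) auto
    then show "((\<lambda>h. arm n (logistic h)) has_real_derivative f' n h) (at h)"
      unfolding arm_def f'_def by (rule DERIV_sum)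
    show "0 \<le> arm n (logistic h)" unfolding arm_def using D lb by (intro sum_nonneg \<theta>_bounds) auto
    have "arm n (logistic h) \<le> (\<Sum>u\<in>D. 1)" unfolding arm_def using D lb by (intro sum_mono \<theta>_bounds) auto
    then show "arm n (logistic h) \<le> real (card D)" by simp
    have "arm 0 (logistic h) = (\<Sum>u\<in>D. 1)"
      unfolding arm_def using D lb by (intro sum.cong \<theta>_0) auto
    then show "arm 0 (logistic h) = real (card D)" by simp
  next
    fix n h h' assume "h \<le> (h'::real)"
    then show "arm n (logistic h) \<le> arm n (logistic h')"
      unfolding arm_def using D lb logistic_mono by (intro sum_mono \<theta>_mono_p) auto
  next
    fix n h assume n: "1 \<le> (n::nat)" and h: "h \<le> b"
    let ?p = "logistic h"
    have "\<rho> / 8 * real n * arm n ?p = (\<Sum>u\<in>D. real n * (\<theta> ?p u n * \<rho>) / 8)"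
      unfolding arm_def by (simp add: sum_distrib_left mult_ac)
    also have "\<dots> \<le> (\<Sum>u\<in>D. (\<Sum>i<n. arm i ?p) * C n h u)"
    proof (rule sum_mono)
      fix u assume u: "u \<in> D"
      then have uV: "u \<in> V" using D by auto
      have "\<theta> ?p u n \<le> 1 - \<rho>" using \<rho>(2)[of ?p u n] lb logistic_mono[OF h] uV n by auto
      then have "real n * (\<theta> ?p u n * \<rho>) \<le> real n * (\<theta> ?p u n * (1 - \<theta> ?p u n))"
        using \<theta>_bounds(1)[of ?p u n] lb uV by (intro mult_left_mono) auto
      also have "\<dots> \<le> 8 * (\<Sum>i<n. arm i ?p) * C n h u"
        unfolding C_def using lb uV n \<theta>_le_arm by (intro one_arm_inequality) auto
      finally show "real n * (\<theta> ?p u n * \<rho>) / 8 \<le> (\<Sum>i<n. arm i ?p) * C n h u" by simp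
    qed
    finally show "\<rho> / 8 * real n * arm n ?p \<le> (\<Sum>i<n. arm i ?p) * f' n h"
      by (simp add: f'_def sum_distrib_left)
  qed
  then show ?thesis by blast
qed

lemma arm_mono: "0 \<le> p \<Longrightarrow> p \<le> p' \<Longrightarrow> p' \<le> 1 \<Longrightarrow> arm n p \<le> arm n p'"
  unfolding arm_def using D by (intro sum_mono \<theta>_mono_p) auto

lemma arm_nonneg: "0 \<le> p \<Longrightarrow> p \<le> 1 \<Longrightarrow> 0 \<le> arm n p"
  unfolding arm_def using D by (intro sum_nonneg \<theta>_bounds) auto

text \<open>The dichotomy separates parameters by summability of the arm probabilities. Inserting
  \<open>0\<close> keeps the set nonempty; parameters are restricted to the open interval, where the
  logistic coordinate exists.\<close>

definition p_c :: real where
  "p_c = Sup (insert 0 {p. 0 < p \<and> p < 1 \<and> summable (\<lambda>n. arm n p)})"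

lemma p_c_bdd: "bdd_above (insert 0 {p. 0 < p \<and> p < 1 \<and> summable (\<lambda>n. arm n p)})"
  by (rule bdd_aboveI[of _ 1]) auto

lemma p_c_bounds: "0 \<le> p_c" "p_c \<le> 1"
proof -
  show "0 \<le> p_c" unfolding p_c_def using p_c_bdd by (intro cSup_upper) auto
  show "p_c \<le> 1" unfolding p_c_def by (intro cSup_least) auto
qed

text \<open>\<open>exponential_bound\<close> with \<open>s\<close> the whole sum at a summable
  parameter \<open>p1 > p\<close>. The intermediate \<open>p'\<close> is strictly positive, so that
  it has a logistic coordinate even when \<open>p = 0\<close>.\<close>

lemma subcritical_decay:
  assumes p: "0 \<le> p" "p < p_c"
  shows "\<exists>C \<kappa>. 0 < \<kappa> \<and> 0 < C \<and> (\<forall>n\<ge>1. arm n p \<le> C * exp (- (\<kappa> * real n)))"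
proof -
  have "\<exists>p1\<in>insert 0 {p. 0 < p \<and> p < 1 \<and> summable (\<lambda>n. arm n p)}. p < p1"
    using p(2) p_c_bdd unfolding p_c_def by (subst (asm) less_cSup_iff) auto
  then obtain p1 where p1: "0 < p1" "p1 < 1" "summable (\<lambda>n. arm n p1)" "p < p1" using p by auto
  define p' where "p' = (p + p1) / 2"
  have p': "0 < p'" "p' < 1" "p < p'" "p' < p1" using p p1 by (auto simp: p'_def)
  obtain a b where ab: "p' = logistic a" "p1 = logistic b" using logistic_surj p' p1 by metis
  have less: "a < b" using p'(4) logistic_mono[of b a] unfolding ab by (cases "a < b") auto
  obtain c f' where "sharp_family (\<lambda>n h. arm n (logistic h)) f' a b c (real (card D))"
    using sharp_arm less by (metis less_imp_le)
  then interpret sharp_family "\<lambda>n h. arm n (logistic h)" f' a b c "real (card D)" .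
  define s where "s = suminf (\<lambda>n. arm n p1)"
  have Sm: "Sm n b \<le> s" for n
    unfolding Sm_def s_def ab(2)[symmetric] using p1 by (intro sum_le_suminf arm_nonneg) auto
  have s: "0 < s" using Sm[of 1] Sm_ge[of 1 b] M less by simp
  have "arm n p \<le> real (card D) * exp (- (c * (b - a) / s * real n))" if n: "1 \<le> n" for n
  proof -
    have "arm n p \<le> arm n (logistic a)" unfolding ab(1)[symmetric] using p p' by (intro arm_mono) auto
    also have "\<dots> \<le> real (card D) * exp (- (c * real n * (b - a) / s))"
      using n less by (intro exponential_bound Sm) auto
    finally show ?thesis by (simp add: mult_ac)
  qed
  moreover have "0 < c * (b - a) / s" using c less s by simp
  ultimately show ?thesis using M by blast
qed

text \<open>Summability fails at \<open>p0\<close>, strictly between \<open>p_c\<close> and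
  \<open>p\<close>, so \<open>arm n p\<close> does not tend to zero. It is a finite sum of
  nonincreasing sequences, one of which must then have a positive limit.\<close>

lemma supercritical_arm:
  assumes p: "p_c < p" "p < 1"
  shows "\<exists>u\<in>D. \<exists>L>0. \<forall>n. L \<le> \<theta> p u n"
proof -
  define p0 where "p0 = (p_c + p) / 2"
  have p0: "p_c < p0" "p0 < p" "0 < p0" "p0 < 1" using p p_c_bounds by (auto simp: p0_def)
  have ns: "\<not> summable (\<lambda>n. arm n p0)"
  proof
    assume "summable (\<lambda>n. arm n p0)"
    then have "p0 \<le> p_c" unfolding p_c_def using p0 p_c_bdd by (intro cSup_upper) auto
    then show False using p0 by simp
  qed
  have p': "0 < p" using p0 by simp
  obtain a b where ab: "p0 = logistic a" "p = logistic b" using logistic_surj p0 p p' by metis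
  have less: "a < b" using p0(2) logistic_mono[of b a] unfolding ab by (cases "a < b") auto
  obtain c f' where "sharp_family (\<lambda>n h. arm n (logistic h)) f' a b c (real (card D))"
    using sharp_arm less by (metis less_imp_le)
  then interpret sharp_family "\<lambda>n h. arm n (logistic h)" f' a b c "real (card D)" .
  have nn: "\<not> (\<lambda>n. arm n p) \<longlonglongrightarrow> 0" using not_null[OF ns[unfolded ab(1)] less] unfolding ab(2) .
  have dec: "decseq (\<lambda>n. \<theta> p u n)" if "u \<in> D" for u
    unfolding decseq_def using that D p p' by (auto intro!: \<theta>_antimono)
  have "\<exists>L. (\<lambda>n. \<theta> p u n) \<longlonglongrightarrow> L \<and> (\<forall>n. L \<le> \<theta> p u n)" if "u \<in> D" for u
  proof -
    have "\<forall>i. 0 \<le> \<theta> p u i" using that D p p' by (intro allI \<theta>_bounds) auto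
    from decseq_convergent[OF dec[OF that] this] show ?thesis by blast
  qed
  then obtain L where L: "\<And>u. u \<in> D \<Longrightarrow> (\<lambda>n. \<theta> p u n) \<longlonglongrightarrow> L u" "\<And>u n. u \<in> D \<Longrightarrow> L u \<le> \<theta> p u n" by metis
  have "\<exists>u\<in>D. 0 < L u"
  proof (rule ccontr)
    assume "\<not> (\<exists>u\<in>D. 0 < L u)"
    moreover have "0 \<le> L u" if "u \<in> D" for u
      using L(1)[OF that] by (rule LIMSEQ_le_const) (use that D p p' in \<open>auto intro!: \<theta>_bounds\<close>)
    ultimately have "L u = 0" if "u \<in> D" for u using that by force
    then have "(\<lambda>n. arm n p) \<longlonglongrightarrow> (\<Sum>u\<in>D. 0)"
      unfolding arm_def using L(1) by (intro tendsto_sum) auto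
    then show False using nn by simp
  qed
  then show ?thesis using L by blast
qed

theorem subcritical:
  assumes p: "0 \<le> p" "p < p_c"
  shows "\<exists>c>0. \<forall>x\<in>V. \<forall>y\<in>V.
    measure (wired_rc p q G) {\<omega> \<in> space (wired_rc p q G). joined G \<omega> x y} \<le> exp (- c * real (d x y))"
proof -
  have p1: "p < 1" "p \<le> 1" using p p_c_bounds by auto
  obtain C \<kappa> where C: "0 < \<kappa>" "0 < C" "\<And>n. 1 \<le> n \<Longrightarrow> arm n p \<le> C * exp (- (\<kappa> * real n))"
    using subcritical_decay[OF p] by blast
  obtain \<rho> where \<rho>: "0 < \<rho>" "\<And>x n. x \<in> V \<Longrightarrow> 1 \<le> n \<Longrightarrow> \<theta> p x n \<le> 1 - \<rho>"
    using \<theta>_1_bound[OF p(1) p1(1)] p(1) by blast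
  \<comment> \<open>The prefactor \<open>C\<close> has to be absorbed into the rate. Beyond
    \<open>N\<close> half of \<open>\<kappa>\<close> pays for it; for
    \<open>1 \<le> n \<le> N\<close> the uniform bound \<open>r < 1\<close> does. The
    \<open>1 / 2\<close> keeps \<open>r\<close> positive, as \<open>ln r\<close> requires.\<close>
  define r where "r = max (1 - \<rho>) (1 / 2)"
  have r: "0 < r" "r < 1" using \<rho> by (auto simp: r_def)
  define N where "N = max 1 (2 * ln (max C 1) / \<kappa>)"
  define c where "c = min (\<kappa> / 2) (- ln r / N)"
  have N: "1 \<le> N" "2 * ln (max C 1) / \<kappa> \<le> N" by (auto simp: N_def)
  have c: "0 < c" using C r N divide_neg_pos[of "ln r" N] by (auto simp: c_def)
  have bound: "\<theta> p x n \<le> exp (- c * real n)" if x: "x \<in> V" for x n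
  proof (cases "n = 0")
    case True
    then show ?thesis using \<theta>_bounds(2)[OF p(1) p1(2) x, of 0] by simp
  next
    case False
    show ?thesis
    proof (cases "real n \<le> N")
      case True
      have "\<theta> p x n \<le> r" using \<rho>(2)[OF x, of n] False by (simp add: r_def)
      also have "r = exp (ln r)" using r by simp
      also have "\<dots> \<le> exp (- c * real n)"
      proof -
        have "c * real n \<le> c * N" using True c by (intro mult_left_mono) auto
        also have "\<dots> \<le> (- ln r / N) * N" using N by (intro mult_right_mono) (auto simp: c_def)
        also have "\<dots> = - ln r" using N by simp
        finally show ?thesis by simp
      qed
      finally show ?thesis .
    next
      case False
      then have n: "N < real n" "1 \<le> n" using N by auto
      have "\<theta> p x n \<le> C * exp (- (\<kappa> * real n))"
        using \<theta>_le_arm[OF p(1) p1(2) x, of n] C(3)[OF n(2)] by simp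
      also have "\<dots> \<le> max C 1 * exp (- (\<kappa> * real n))" by (intro mult_right_mono) auto
      also have "\<dots> = exp (ln (max C 1) - \<kappa> * real n)" by (simp add: exp_diff exp_minus field_simps)
      also have "\<dots> \<le> exp (- c * real n)"
      proof -
        have "2 * ln (max C 1) / \<kappa> \<le> real n" using N n by simp
        then have "ln (max C 1) \<le> \<kappa> / 2 * real n" using C by (simp add: field_simps)
        moreover have "c \<le> \<kappa> / 2" unfolding c_def by (rule min.cobounded1)
        then have "c * real n \<le> \<kappa> / 2 * real n" by (rule mult_right_mono) simp
        ultimately show ?thesis by simp
      qed
      finally show ?thesis .
    qed
  qed
  show ?thesis
    using c connection_bound[OF p(1) p1(2)] bound order_trans by (intro exI[of _ c]) blast
qed

end

section \<open>Comparing free and wired measures\<close>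

text \<open>Wiring merges the clusters meeting \<open>B\<close> into one, and there are at most
  \<open>card B\<close> of them.\<close>

lemma ncl_wiring_bounds:
  assumes H: "finite_graph H" and B: "B \<subseteq> verts H" and A: "A \<subseteq> edges H"
  shows "ncl (verts H) B A \<le> ncl (verts H) {} A" "ncl (verts H) {} A \<le> ncl (verts H) B A + card B"
proof -
  define \<omega> where "\<omega> e = (e \<in> A)" for e
  have o: "open_edges H \<omega> = A" using A by (auto simp: open_edges_def \<omega>_def)
  let ?C = "clusters H \<omega>"
  have im: "?C = (\<lambda>x. conn {} A `` {x}) ` verts H"
    using clusters_eq_image[of H B \<omega>] H B by (simp add: o finite_graph_def)
  have fin: "finite ?C" using H by (simp add: im finite_graph_def)
  let ?m = "{C\<in>?C. C \<inter> B \<noteq> {}}"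
  have split: "card ?C = card {C\<in>?C. C \<inter> B = {}} + card ?m"
  proof -
    have "?C = {C\<in>?C. C \<inter> B = {}} \<union> ?m" by auto
    then have "card ?C = card ({C\<in>?C. C \<inter> B = {}} \<union> ?m)" by (rule arg_cong)
    also have "\<dots> = card {C\<in>?C. C \<inter> B = {}} + card ?m" using fin by (intro card_Un_disjoint) auto
    finally show ?thesis .
  qed
  have f: "ncl (verts H) {} A = card ?C" using free_count_eq_ncl[OF H, of \<omega>] by (simp add: o free_count_def)
  have w: "ncl (verts H) B A = card {C\<in>?C. C \<inter> B = {}} + (if \<exists>C\<in>?C. C \<inter> B \<noteq> {} then 1 else 0)"
    using wired_count_eq_ncl[OF H B, of \<omega>] by (simp add: o wired_count_def)
  have "1 \<le> card ?m" if "\<exists>C\<in>?C. C \<inter> B \<noteq> {}"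
    using that fin by (auto simp: Suc_le_eq card_gt_0_iff)
  then show "ncl (verts H) B A \<le> ncl (verts H) {} A" unfolding f w split by auto
  have finB: "finite B" using H B by (auto simp: finite_graph_def intro: finite_subset)
  have "?m \<subseteq> (\<lambda>x. conn {} A `` {x}) ` B"
  proof
    fix C assume "C \<in> ?m"
    then obtain x b where "C = conn {} A `` {x}" "b \<in> B" "(x, b) \<in> conn {} A" unfolding im by auto
    moreover from this(3) have "conn {} A `` {x} = conn {} A `` {b}" by (simp add: conn_class_eq)
    ultimately show "C \<in> (\<lambda>x. conn {} A `` {x}) ` B" by auto
  qed
  then have "card ?m \<le> card B" using finB by (meson card_image_le card_mono finite_imageI order_trans)
  then show "ncl (verts H) {} A \<le> ncl (verts H) B A + card B" unfolding f w split by simp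
qed

text \<open>This is what turns monotonicity in \<open>h\<close> of the expected number of open edges
  into convexity of the free energy.\<close>

lemma ln_pf_deriv:
  assumes "finite E" "1 \<le> q"
  shows "((\<lambda>h. ln (pf q E k (\<lambda>_. 1) h)) has_real_derivative rcE (logistic h) q E k (\<lambda>A. real (card A))) (at h)"
proof -
  have "((\<lambda>h. ln (pf q E k (\<lambda>_. 1) h)) has_real_derivative
      1 / pf q E k (\<lambda>_. 1) h * pf q E k (\<lambda>A. 1 * real (card A)) h) (at h)"
    by (rule DERIV_chain'[OF pf_deriv DERIV_ln_divide]) (rule pf_pos[OF assms])
  then show ?thesis by (simp add: rcE_logistic[OF assms(1)])
qed

lemma incr_card: "finite E \<Longrightarrow> incr_on E (\<lambda>A. real (card A))"
  unfolding incr_on_def by (auto intro!: card_mono intro: finite_subset)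

text \<open>By convexity the wired slope at \<open>h1\<close> is at most the wired secant over
  \<open>[h1, h2]\<close>, and the free secant is at most the free slope at \<open>h2\<close>. The
  wired secant exceeds the free one by at most the last term, since the free partition function is
  at least the wired one and at most \<open>q ^ card B\<close> times it.\<close>

lemma free_energy_comparison:
  assumes H: "finite_graph H" and B: "B \<subseteq> verts H" and q: "1 \<le> q" and h: "h1 < h2"
  shows "gE (logistic h1) q H B (\<lambda>A. real (card A))
    \<le> gE (logistic h2) q H {} (\<lambda>A. real (card A)) + real (card B) * ln q / (h2 - h1)"
proof -
  let ?E = "edges H" and ?c = "\<lambda>A :: 'a set set. real (card A)"
  let ?Z = "\<lambda>B. pf q ?E (ncl (verts H) B) (\<lambda>_. 1)"
  have E: "finite ?E" by (rule finite_edges[OF H])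
  have mono: "gE (logistic h) q H C ?c \<le> gE (logistic h') q H C ?c" if "h \<le> h'" for h h' C
    using that logistic_bounds[of h] logistic_bounds[of h'] logistic_mono[OF that] H q
    by (intro gE_mono incr_card E) auto
  have mvt: "\<exists>z. h1 < z \<and> z < h2 \<and> ln (?Z C h2) - ln (?Z C h1) = (h2 - h1) * gE (logistic z) q H C ?c" for C
    unfolding gE_def using ln_pf_deriv[OF E q] by (intro MVT2 h) auto
  obtain z where z: "h1 < z" "ln (?Z B h2) - ln (?Z B h1) = (h2 - h1) * gE (logistic z) q H B ?c"
    using mvt by blast
  obtain z' where z': "z' < h2" "ln (?Z {} h2) - ln (?Z {} h1) = (h2 - h1) * gE (logistic z') q H {} ?c"
    using mvt by blast
  have pos: "0 < ?Z C h" for C h by (rule pf_pos[OF E q])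
  have 1: "ln (?Z B h2) \<le> ln (?Z {} h2)"
  proof -
    have "?Z B h2 \<le> ?Z {} h2" unfolding pf_def
      using ncl_wiring_bounds(1)[OF H B] q by (intro sum_mono mult_right_mono power_increasing) auto
    then show ?thesis using pos by simp
  qed
  have 2: "ln (?Z {} h1) \<le> ln (?Z B h1) + real (card B) * ln q"
  proof -
    have "?Z {} h1 \<le> (\<Sum>A\<in>Pow ?E. q ^ (ncl (verts H) B A + card B) * 1 * exp (h1 * real (card A)))"
      unfolding pf_def using ncl_wiring_bounds(2)[OF H B] q by (intro sum_mono mult_right_mono power_increasing) auto
    also have "\<dots> = ?Z B h1 * q ^ card B"
      by (simp add: pf_def power_add sum_distrib_left mult_ac)
    finally have "ln (?Z {} h1) \<le> ln (?Z B h1 * q ^ card B)"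
      using pos[of "{}" h1] pos[of B h1] q by (subst ln_le_cancel_iff) (auto intro: mult_pos_pos)
    also have "\<dots> = ln (?Z B h1) + real (card B) * ln q" using pos[of B h1] q by (simp add: ln_mult ln_realpow)
    finally show ?thesis .
  qed
  have "(h2 - h1) * gE (logistic h1) q H B ?c \<le> (h2 - h1) * gE (logistic z) q H B ?c"
    using h z mono by (intro mult_left_mono) auto
  also have "\<dots> \<le> (h2 - h1) * gE (logistic z') q H {} ?c + real (card B) * ln q"
    using 1 2 z(2) z'(2) by linarith
  also have "\<dots> \<le> (h2 - h1) * gE (logistic h2) q H {} ?c + real (card B) * ln q"
    using h z' mono by (intro add_right_mono mult_left_mono) auto
  also have "\<dots> = (h2 - h1) * (gE (logistic h2) q H {} ?c + real (card B) * ln q / (h2 - h1))"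
    using h by (simp add: field_simps)
  finally show ?thesis using h by simp
qed

lemma gE_card:
  assumes "finite_graph H"
  shows "gE p q H B (\<lambda>A. real (card A)) = (\<Sum>e\<in>edges H. gE p q H B (\<lambda>A. of_bool (e \<in> A)))"
proof -
  have "real (card A) = (\<Sum>e\<in>edges H. of_bool (e \<in> A))" if "A \<in> Pow (edges H)" for A
  proof -
    have "edges H \<inter> {e. e \<in> A} = A" using that by auto
    then show ?thesis using finite_edges[OF assms] by simp
  qed
  then show ?thesis unfolding gE_def rcE_def wE_sum[symmetric] by (intro wE_cong)
qed

context lf_graph
begin

definition inc :: "'a \<Rightarrow> 'a set set" where "inc v = {e\<in>edges G. v \<in> e}"

lemma finite_inc: "v \<in> V \<Longrightarrow> finite (inc v)"
  using lf by (simp add: locally_finite_def inc_def)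

lemma handshake:
  fixes w :: "'a set \<Rightarrow> real"
  assumes W: "finite W"
  shows "(\<Sum>v\<in>W. \<Sum>e\<in>inc v \<inter> edges (ind G W). w e) = 2 * (\<Sum>e\<in>edges (ind G W). w e)"
proof -
  let ?E = "edges (ind G W)"
  have E: "finite ?E" by (rule finite_edges[OF finite_graph_ind[OF simple W]])
  have "(\<Sum>v\<in>W. \<Sum>e\<in>inc v \<inter> ?E. w e) = (\<Sum>v\<in>W. \<Sum>e\<in>?E. if v \<in> e then w e else 0)"
    using E by (intro sum.cong refl sum.mono_neutral_cong_left) (auto simp: inc_def)
  also have "\<dots> = (\<Sum>e\<in>?E. \<Sum>v\<in>W. if v \<in> e then w e else 0)" by (rule sum.swap)
  also have "\<dots> = (\<Sum>e\<in>?E. 2 * w e)"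
  proof (rule sum.cong[OF refl])
    fix e assume e: "e \<in> ?E"
    have "(\<Sum>v\<in>W. if v \<in> e then w e else 0) = (\<Sum>v\<in>e. w e)"
      using e W by (intro sum.mono_neutral_cong_right) auto
    also have "card e = 2" using e simple by (auto simp: simple_graph_def)
    then have "(\<Sum>v\<in>e. w e) = 2 * w e" by simp
    finally show "(\<Sum>v\<in>W. if v \<in> e then w e else 0) = 2 * w e" .
  qed
  finally show ?thesis by (simp add: sum_distrib_left)
qed

section \<open>Single-edge densities and equality of the two measures\<close>

definition op1 :: "real \<Rightarrow> 'a set \<Rightarrow> real" where "op1 p e = Pw p {e} (\<lambda>A. e \<in> A)"
definition op0 :: "real \<Rightarrow> 'a set \<Rightarrow> real" where "op0 p e = Pf p {e} (\<lambda>A. e \<in> A)"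

lemma incr_mem: "incr_on F (\<lambda>A. of_bool (e \<in> A) :: real)"
  by (auto simp: incr_on_def)

lemma Pf_bounds: "0 \<le> p \<Longrightarrow> p \<le> 1 \<Longrightarrow> 0 \<le> Pf p F Q" "0 \<le> p \<Longrightarrow> p \<le> 1 \<Longrightarrow> Pf p F Q \<le> 1"
  unfolding Pf_def using prob_space.prob_le_1[OF free_rc_prob] by auto

lemma Pw_bounds: "0 \<le> p \<Longrightarrow> p \<le> 1 \<Longrightarrow> 0 \<le> Pw p F Q" "0 \<le> p \<Longrightarrow> p \<le> 1 \<Longrightarrow> Pw p F Q \<le> 1"
  unfolding Pw_def using prob_space.prob_le_1[OF wired_rc_prob] by auto

lemma Pf_mono_p:
  assumes p: "0 \<le> p" "p \<le> p'" "p' \<le> 1" and F: "finite F" "F \<subseteq> edges G" and Q: "incr_on F (\<lambda>A. of_bool (Q A) :: real)"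
  shows "Pf p F Q \<le> Pf p' F Q"
proof -
  obtain K where K: "exhausts K G" "\<And>n. induced_subgraph (K n) G"
    using ex_induced_exhaustion[OF simple countable nonempty] by blast
  have "gE p q (K n) {} (\<lambda>A. of_bool (Q (A \<inter> F))) \<le> gE p' q (K n) {} (\<lambda>A. of_bool (Q (A \<inter> F)))" for n
    using p q exhausts_finite[OF K(1)] by (intro gE_mono incr_restrict[OF Q]) auto
  then show ?thesis using LIMSEQ_le[OF Pf_limit[OF _ _ K(1) F, of p Q] Pf_limit[OF _ _ K(1) F, of p' Q]] p by auto
qed

lemma exhausts_aut:
  assumes a: "aut \<sigma>" and K: "exhausts K G" shows "exhausts (\<lambda>n. gim \<sigma> (K n)) G"
proof -
  have "(\<Union>n. \<sigma> ` verts (K n)) = \<sigma> ` (\<Union>n. verts (K n))" by blast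
  moreover have "(\<Union>n. (`) \<sigma> ` edges (K n)) = (`) \<sigma> ` (\<Union>n. edges (K n))" by blast
  moreover have "finite_graph (gim \<sigma> (K n))" for n
  proof -
    have "finite_graph (K n)" using K by (rule exhausts_finite)
    moreover have "card (\<sigma> ` e) = card e" for e       using a unfolding aut_def by (meson bij_is_inj card_image inj_on_subset subset_UNIV)
    ultimately show ?thesis by (fastforce simp: finite_graph_def simple_graph_def)
  qed
  moreover have "subgraph (gim \<sigma> (K n)) (gim \<sigma> (K (Suc n)))" for n
    using K by (auto simp: exhausts_def subgraph_def)
  ultimately show ?thesis using K a by (auto simp: exhausts_def aut_def)
qed

lemma induced_aut: "aut \<sigma> \<Longrightarrow> induced_subgraph H G \<Longrightarrow> induced_subgraph (gim \<sigma> H) G"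
proof -
  assume a: "aut \<sigma>" and H: "induced_subgraph H G"
  have "H = ind G (verts H)" using H by (cases H) (auto simp: ind_def induced_subgraph_def)
  then have "gim \<sigma> H = ind G (\<sigma> ` verts H)" using ind_aut[OF a] by metis
  moreover have "\<sigma> ` verts H \<subseteq> V" using H a by (auto simp: induced_subgraph_def aut_vert)
  ultimately show ?thesis by (simp add: induced_ind)
qed

text \<open>An automorphism carries an exhaustion to another exhaustion, and the limit is the same
  for both.\<close>

lemma op_aut:
  assumes a: "aut \<sigma>" and p: "0 \<le> p" "p \<le> 1" and e: "e \<in> edges G"
  shows "op1 p (\<sigma> ` e) = op1 p e" "op0 p (\<sigma> ` e) = op0 p e"
proof -
  obtain K where K: "exhausts K G" "\<And>n. induced_subgraph (K n) G"
    using ex_induced_exhaustion[OF simple countable nonempty] by blast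
  have F: "finite {e}" "{e} \<subseteq> edges G" "finite {\<sigma> ` e}" "{\<sigma> ` e} \<subseteq> edges G"
    using e a by (auto simp: aut_edge)
  have bij: "bij \<sigma>" using a by (simp add: aut_def)
  have mem: "\<sigma> ` e \<in> (`) \<sigma> ` A \<longleftrightarrow> e \<in> A" for A
    using inj_set_image[OF bij_is_inj[OF bij]] by (simp add: inj_image_mem_iff)
  have "(\<lambda>n. wexp p (gim \<sigma> (K n)) (\<lambda>A. of_bool (\<sigma> ` e \<in> A \<inter> {\<sigma> ` e}))) \<longlonglongrightarrow> op1 p (\<sigma> ` e)"
    unfolding op1_def using induced_aut[OF a K(2)] F by (intro Pw_limit[OF p exhausts_aut[OF a K(1)]]) auto
  moreover have "wexp p (gim \<sigma> (K n)) (\<lambda>A. of_bool (\<sigma> ` e \<in> A \<inter> {\<sigma> ` e})) = wexp p (K n) (\<lambda>A. of_bool (e \<in> A \<inter> {e}))" for n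
    unfolding wexp_def boundary_aut[OF a] gE_image[OF bij] by (simp add: mem)
  moreover have "(\<lambda>n. wexp p (K n) (\<lambda>A. of_bool (e \<in> A \<inter> {e}))) \<longlonglongrightarrow> op1 p e"
    unfolding op1_def using F by (intro Pw_limit[OF p K]) auto
  ultimately show "op1 p (\<sigma> ` e) = op1 p e" using LIMSEQ_unique by simp
  have "(\<lambda>n. gE p q (gim \<sigma> (K n)) {} (\<lambda>A. of_bool (\<sigma> ` e \<in> A \<inter> {\<sigma> ` e}))) \<longlonglongrightarrow> op0 p (\<sigma> ` e)"
    unfolding op0_def using F by (intro Pf_limit[OF p exhausts_aut[OF a K(1)]]) auto
  moreover have "gE p q (gim \<sigma> (K n)) {} (\<lambda>A. of_bool (\<sigma> ` e \<in> A \<inter> {\<sigma> ` e})) = gE p q (K n) {} (\<lambda>A. of_bool (e \<in> A \<inter> {e}))" for n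
    using gE_image[OF bij, of p q "K n" "{}"] by (simp add: mem)
  moreover have "(\<lambda>n. gE p q (K n) {} (\<lambda>A. of_bool (e \<in> A \<inter> {e}))) \<longlonglongrightarrow> op0 p e"
    unfolding op0_def using F by (intro Pf_limit[OF p K(1)]) auto
  ultimately show "op0 p (\<sigma> ` e) = op0 p e" using LIMSEQ_unique by simp
qed

lemma inc_aut: "aut \<sigma> \<Longrightarrow> inc (\<sigma> v) = (`) \<sigma> ` inc v"
proof (intro equalityI subsetI)
  fix e assume a: "aut \<sigma>" and e: "e \<in> inc (\<sigma> v)"
  have "e = \<sigma> ` inv \<sigma> ` e" using a by (simp add: image_image aut_inv_eq)
  moreover have "inv \<sigma> ` e \<in> inc v"
    using e aut_edge[OF aut_inv[OF a], of e] a by (auto simp: inc_def aut_inv_eq intro!: image_eqI[of _ _ "\<sigma> v"])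
  ultimately show "e \<in> (`) \<sigma> ` inc v" by blast
qed (auto simp: inc_def aut_edge)

lemma sum_inc_aut:
  fixes w :: "'a set \<Rightarrow> real"
  assumes "aut \<sigma>" "\<And>e. e \<in> edges G \<Longrightarrow> w (\<sigma> ` e) = w e"
  shows "(\<Sum>e\<in>inc (\<sigma> v). w e) = (\<Sum>e\<in>inc v. w e)"
proof -
  have "inj_on ((`) \<sigma>) (inc v)"
    by (rule inj_on_subset[OF inj_set_image[OF bij_is_inj] subset_UNIV]) (use assms(1) in \<open>simp add: aut_def\<close>)
  then show ?thesis unfolding inc_aut[OF assms(1)] using assms(2)
    by (subst sum.reindex) (auto simp: inc_def)
qed

text \<open>A unit weight on each open edge dominates the indicator of any event, so that the difference
  of the two is increasing and the ordering of the two measures reverses on it.\<close>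

lemma Pw_le_Pf_if_marginals:
  assumes p: "0 \<le> p" "p \<le> 1" and F: "finite F" "F \<subseteq> edges G" and Q: "incr_on F (\<lambda>A. of_bool (Q A) :: real)"
    and eq: "\<And>e. e \<in> F \<Longrightarrow> op1 p e = op0 p e"
  shows "Pw p F Q \<le> Pf p F Q"
proof -
  obtain K where K: "exhausts K G" "\<And>n. induced_subgraph (K n) G"
    using ex_induced_exhaustion[OF simple countable nonempty] by blast
  let ?g = "\<lambda>A. (\<Sum>e\<in>F. of_bool (e \<in> A \<inter> {e})) - of_bool (Q (A \<inter> F)) :: real"
  have g: "incr_on E ?g" for E
    unfolding incr_on_def
  proof (intro allI impI)
    fix A B :: "'a set set" assume AB: "A \<subseteq> B"
    have s: "(\<Sum>e\<in>F. of_bool (e \<in> C \<inter> {e})) = real (card (C \<inter> F))" for C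
      using F by (simp add: Int_commute Collect_conj_eq)
    show "?g A \<le> ?g B"
    proof (cases "A \<inter> F = B \<inter> F")
      case False
      then have "A \<inter> F \<subset> B \<inter> F" using AB by auto
      then have "card (A \<inter> F) < card (B \<inter> F)" using F by (intro psubset_card_mono) auto
      then show ?thesis unfolding s by auto
    next
      case True
      then show ?thesis unfolding s by simp
    qed
  qed
  have lin: "gE p q H B ?g = (\<Sum>e\<in>F. gE p q H B (\<lambda>A. of_bool (e \<in> A \<inter> {e}))) - gE p q H B (\<lambda>A. of_bool (Q (A \<inter> F)))" for H B
    unfolding gE_def rcE_def by (simp only: wE_diff wE_sum)
  have "(\<lambda>n. gE p q (K n) {} ?g) \<longlonglongrightarrow> (\<Sum>e\<in>F. op0 p e) - Pf p F Q"
    unfolding lin op0_def using F by (intro tendsto_diff tendsto_sum Pf_limit[OF p K(1)]) auto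
  moreover have "(\<lambda>n. gE p q (K n) (boundary G (K n)) ?g) \<longlonglongrightarrow> (\<Sum>e\<in>F. op1 p e) - Pw p F Q"
    unfolding lin op1_def using F by (intro tendsto_diff tendsto_sum Pw_limit[OF p K, unfolded wexp_def]) auto
  moreover have "gE p q (K n) {} ?g \<le> gE p q (K n) (boundary G (K n)) ?g" for n
    using p q exhausts_finite[OF K(1)] g by (intro gE_mono) auto
  ultimately have "(\<Sum>e\<in>F. op0 p e) - Pf p F Q \<le> (\<Sum>e\<in>F. op1 p e) - Pw p F Q"
    using LIMSEQ_le by blast
  then show ?thesis using eq by simp
qed

end

context periodic_graph
begin

section \<open>Densities of open edges on large boxes\<close>

definition sq :: "nat \<Rightarrow> (int \<times> int) set" where
  "sq N = {- int N..int N} \<times> {- int N..int N}"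

definition box :: "nat \<Rightarrow> 'a set" where
  "box N = (\<Union>z\<in>sq N. \<tau> z ` D)"

lemma card_sq: "card (sq N) = (2 * N + 1)\<^sup>2"
proof -
  have "card {- int N..int N} = 2 * N + 1" by simp
  then show ?thesis unfolding sq_def card_cartesian_product by (simp only: power2_eq_square)
qed

lemma box_subset: "box N \<subseteq> V"
  unfolding box_def cover by blast

lemma finite_box: "finite (box N)"
  unfolding box_def using D by (auto simp: sq_def)

lemma \<tau>_inj: "inj_on (\<tau> z) X"
  using \<tau>_aut[of z] unfolding aut_def by (meson bij_is_inj inj_on_subset subset_UNIV)

lemma sum_box:
  fixes g :: "'a \<Rightarrow> real"
  assumes "\<And>z u. u \<in> D \<Longrightarrow> g (\<tau> z u) = g u"
  shows "(\<Sum>v\<in>box N. g v) = real ((2 * N + 1)\<^sup>2) * (\<Sum>u\<in>D. g u)"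
proof -
  have "(\<Sum>v\<in>box N. g v) = (\<Sum>z\<in>sq N. \<Sum>v\<in>\<tau> z ` D. g v)"
    unfolding box_def
  proof (rule sum.UNION_disjoint)
    show "\<forall>z\<in>sq N. \<forall>z'\<in>sq N. z \<noteq> z' \<longrightarrow> \<tau> z ` D \<inter> \<tau> z' ` D = {}" using disjoint by blast
  qed (use D in \<open>auto simp: sq_def\<close>)
  also have "\<dots> = (\<Sum>z\<in>sq N. \<Sum>u\<in>D. g u)"
    using assms by (intro sum.cong[OF refl]) (simp add: sum.reindex[OF \<tau>_inj])
  finally show ?thesis by (simp add: card_sq)
qed

lemma card_box: "card (box N) = (2 * N + 1)\<^sup>2 * card D"
proof -
  have "real (card (box N)) = real ((2 * N + 1)\<^sup>2 * card D)"
    using sum_box[of "\<lambda>_. 1" N] by simp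
  then show ?thesis by (simp only: of_nat_eq_iff)
qed

text \<open>The fundamental domain has finitely many neighbours, whose cells have coordinates
  bounded by some \<open>R\<close>. By translation, no edge leads from \<open>box (N - R)\<close>
  out of \<open>box N\<close>.\<close>

lemma boundary_box:
  "\<exists>R. \<forall>N\<ge>R. boundary G (ind G (box N)) \<subseteq> box N - box (N - R)"
proof -
  define Nb where "Nb = (\<Union>v\<in>D. {u. {v, u} \<in> edges G})"
  have fin: "finite Nb" unfolding Nb_def using D finite_neighbours by blast
  have "\<forall>u. \<exists>z. u \<in> V \<longrightarrow> u \<in> \<tau> z ` D" using cover by blast
  then obtain zc where zc: "\<And>u. u \<in> V \<Longrightarrow> u \<in> \<tau> (zc u) ` D" by metis
  define R where "R = (\<Sum>u\<in>Nb. nat \<bar>fst (zc u)\<bar> + nat \<bar>snd (zc u)\<bar>)"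
  have R: "\<bar>fst (zc u)\<bar> \<le> int R" "\<bar>snd (zc u)\<bar> \<le> int R" if "u \<in> Nb" for u
  proof -
    have "nat \<bar>fst (zc u)\<bar> + nat \<bar>snd (zc u)\<bar> \<le> R"
      unfolding R_def using fin that by (intro member_le_sum) auto
    then show "\<bar>fst (zc u)\<bar> \<le> int R" "\<bar>snd (zc u)\<bar> \<le> int R" by linarith+
  qed
  have "boundary G (ind G (box N)) \<subseteq> box N - box (N - R)" if N: "R \<le> N" for N
  proof
    fix v assume "v \<in> boundary G (ind G (box N))"
    then obtain u where v: "v \<in> box N" and u: "u \<in> V" "u \<notin> box N" "{u, v} \<in> edges G" by (auto simp: boundary_def)
    have "v \<notin> box (N - R)"
    proof
      assume "v \<in> box (N - R)"
      then obtain z v0 where z: "z \<in> sq (N - R)" "v0 \<in> D" "v = \<tau> z v0" by (auto simp: box_def)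
      define u0 where "u0 = inv (\<tau> z) u"
      have u0: "u = \<tau> z u0" unfolding u0_def by (simp add: aut_inv_eq[OF \<tau>_aut])
      have "{v0, u0} \<in> edges G" using u(3) aut_edge2[OF \<tau>_aut, of z u0 v0] by (simp add: u0 z insert_commute)
      then have Nb: "u0 \<in> Nb" using z(2) by (auto simp: Nb_def)
      have "u0 \<in> V" using u(1) aut_vert[OF \<tau>_aut] by (simp add: u0)
      then obtain u1 where u1: "u1 \<in> D" "u0 = \<tau> (zc u0) u1" using zc by blast
      have "u = \<tau> (z + zc u0) u1" unfolding u0 by (subst u1(2)) (rule \<tau>_add)
      moreover have "z + zc u0 \<in> sq N"
        using z(1) R[OF Nb] N by (cases z; cases "zc u0") (auto simp: sq_def)
      ultimately show False using u(2) u1(1) by (auto simp: box_def)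
    qed
    then show "v \<in> box N - box (N - R)" using v by simp
  qed
  then show ?thesis by blast
qed

definition dens1 :: "real \<Rightarrow> real" where "dens1 h = (\<Sum>v\<in>D. \<Sum>e\<in>inc v. op1 (logistic h) e)"
definition dens0 :: "real \<Rightarrow> real" where "dens0 h = (\<Sum>v\<in>D. \<Sum>e\<in>inc v. op0 (logistic h) e)"

text \<open>Finite wired boxes have larger edge densities than \<open>op1\<close>, finite free boxes
  smaller ones than \<open>op0\<close>. Combined with \<open>free_energy_comparison\<close> on
  \<open>box N\<close> this bounds total wired density at \<open>h1\<close> by total free density at
  \<open>h2\<close> up to a multiple of the boundary, which disappears after division by the number
  of cells.\<close>

lemma dens_le:
  assumes h: "h1 < h2" shows "dens1 h1 \<le> dens0 h2"
proof -
  let ?p1 = "logistic h1" and ?p2 = "logistic h2"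
  have lb: "0 \<le> logistic h" "logistic h \<le> 1" for h using logistic_bounds[of h] by auto
  obtain R where R: "\<And>N. R \<le> N \<Longrightarrow> boundary G (ind G (box N)) \<subseteq> box N - box (N - R)" using boundary_box by blast
  define \<Delta> where "\<Delta> = (\<Sum>u\<in>D. real (card (inc u)))"
  have \<Delta>: "real (card (inc v)) \<le> \<Delta>" if v: "v \<in> V" for v
  proof -
    obtain z u where u: "u \<in> D" "v = \<tau> z u" using v cover by auto
    have "real (card (inc v)) = real (card (inc u))" using sum_inc_aut[OF \<tau>_aut, of "\<lambda>_. 1" z u] u by simp
    also have "\<dots> \<le> \<Delta>" unfolding \<Delta>_def using u D by (intro member_le_sum) auto
    finally show ?thesis .
  qed
  have \<Delta>0: "0 \<le> \<Delta>" unfolding \<Delta>_def by (intro sum_nonneg) auto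
  \<comment> \<open>The first term is the loss in \<open>free_energy_comparison\<close>, doubled by
    the handshake. \<open>\<Delta>\<close> bounds the number of edges at a boundary vertex, some of
    which may leave the box.\<close>
  define C where "C = 2 * ln q / (h2 - h1) + \<Delta>"
  have C: "0 \<le> C" using q h \<Delta>0 by (simp add: C_def)
  have main: "real ((2 * N + 1)\<^sup>2) * dens1 h1 \<le> real ((2 * N + 1)\<^sup>2) * dens0 h2 + C * real (card (boundary G (ind G (box N))))" for N
  proof -
    let ?H = "ind G (box N)"
    let ?E = "edges ?H" and ?B = "boundary G ?H"
    have fin: "finite_graph ?H" by (rule finite_graph_ind[OF simple finite_box])
    have ind: "induced_subgraph ?H G" by (rule induced_ind[OF box_subset])
    have B: "?B \<subseteq> box N" using boundary_subset[of G ?H] by simp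
    have finB: "finite ?B" using B finite_box by (rule finite_subset)
    have o1: "0 \<le> op1 ?p1 e" "op1 ?p1 e \<le> 1" for e unfolding op1_def using Pw_bounds lb by auto
    have o0: "0 \<le> op0 ?p2 e" for e unfolding op0_def using Pf_bounds lb by auto
    have inv1: "(\<Sum>e\<in>inc (\<tau> z u). op1 ?p1 e) = (\<Sum>e\<in>inc u. op1 ?p1 e)" for z u
      using \<tau>_aut lb by (intro sum_inc_aut op_aut) auto
    have inv0: "(\<Sum>e\<in>inc (\<tau> z u). op0 ?p2 e) = (\<Sum>e\<in>inc u. op0 ?p2 e)" for z u
      using \<tau>_aut lb by (intro sum_inc_aut op_aut) auto
    have "real ((2 * N + 1)\<^sup>2) * dens1 h1 = (\<Sum>v\<in>box N. \<Sum>e\<in>inc v. op1 ?p1 e)"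
      unfolding dens1_def by (rule sum_box[symmetric]) (rule inv1)
    also have "\<dots> \<le> (\<Sum>v\<in>box N. (\<Sum>e\<in>inc v \<inter> ?E. op1 ?p1 e) + (if v \<in> ?B then \<Delta> else 0))"
    proof (rule sum_mono)
      fix v assume v: "v \<in> box N"
      then have vV: "v \<in> V" using box_subset by auto
      show "(\<Sum>e\<in>inc v. op1 ?p1 e) \<le> (\<Sum>e\<in>inc v \<inter> ?E. op1 ?p1 e) + (if v \<in> ?B then \<Delta> else 0)"
      proof (cases "v \<in> ?B")
        case True
        have "(\<Sum>e\<in>inc v. op1 ?p1 e) \<le> (\<Sum>e\<in>inc v. 1)" using o1 by (intro sum_mono)
        also have "\<dots> \<le> \<Delta>" using \<Delta>[OF vV] by simp
        finally show ?thesis using True o1 by (simp add: sum_nonneg add_increasing)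
      next
        case False
        have "inc v \<subseteq> ?E"
        proof
          fix e assume e: "e \<in> inc v"
          then obtain x y where "e = {x, y}" using simple_edge[OF simple, of e] unfolding inc_def by blast
          then obtain u where u: "e = {u, v}" using e by (auto simp: inc_def insert_commute)
          then have "u \<in> box N" using False e v edge_verts[of u v] by (auto simp: boundary_def inc_def)
          then show "e \<in> ?E" using e u v by (auto simp: inc_def)
        qed
        then show ?thesis using False by (simp add: Int_absorb2)
      qed
    qed
    also have "\<dots> = 2 * (\<Sum>e\<in>?E. op1 ?p1 e) + \<Delta> * real (card ?B)"
    proof -
      have "(\<Sum>v\<in>box N. if v \<in> ?B then \<Delta> else 0) = (\<Sum>v\<in>?B. \<Delta>)"
        using B finite_box by (intro sum.mono_neutral_cong_right) auto
      then show ?thesis unfolding sum.distrib handshake[OF finite_box] by (simp add: mult.commute)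
    qed
    also have "(\<Sum>e\<in>?E. op1 ?p1 e) \<le> (\<Sum>e\<in>?E. gE ?p1 q ?H ?B (\<lambda>A. of_bool (e \<in> A)))"
    proof (rule sum_mono)
      fix e assume "e \<in> ?E"
      then have "op1 ?p1 e \<le> wexp ?p1 ?H (\<lambda>A. of_bool (e \<in> A \<inter> {e}))"
        unfolding op1_def using lb ind fin by (intro Pw_le_wexp incr_mem) auto
      then show "op1 ?p1 e \<le> gE ?p1 q ?H ?B (\<lambda>A. of_bool (e \<in> A))" by (simp add: wexp_def)
    qed
    also have "\<dots> = gE ?p1 q ?H ?B (\<lambda>A. real (card A))" by (rule gE_card[OF fin, symmetric])
    also have "\<dots> \<le> gE ?p2 q ?H {} (\<lambda>A. real (card A)) + real (card ?B) * ln q / (h2 - h1)"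
      by (rule free_energy_comparison[OF fin boundary_subset q h])
    also have "gE ?p2 q ?H {} (\<lambda>A. real (card A)) = (\<Sum>e\<in>?E. gE ?p2 q ?H {} (\<lambda>A. of_bool (e \<in> A)))" by (rule gE_card[OF fin])
    also have "\<dots> \<le> (\<Sum>e\<in>?E. op0 ?p2 e)"
    proof (rule sum_mono)
      fix e assume "e \<in> ?E"
      then have "gE ?p2 q ?H {} (\<lambda>A. of_bool (e \<in> A \<inter> {e})) \<le> op0 ?p2 e"
        unfolding op0_def using lb induced_is_subgraph[OF ind] fin by (intro Pf_ge_gE incr_mem) auto
      then show "gE ?p2 q ?H {} (\<lambda>A. of_bool (e \<in> A)) \<le> op0 ?p2 e" by simp
    qed
    finally have 1: "real ((2 * N + 1)\<^sup>2) * dens1 h1 \<le> 2 * ((\<Sum>e\<in>?E. op0 ?p2 e) + real (card ?B) * ln q / (h2 - h1)) + \<Delta> * real (card ?B)"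
      by simp
    have "2 * (\<Sum>e\<in>?E. op0 ?p2 e) = (\<Sum>v\<in>box N. \<Sum>e\<in>inc v \<inter> ?E. op0 ?p2 e)"
      by (rule handshake[OF finite_box, symmetric])
    also have "\<dots> \<le> (\<Sum>v\<in>box N. \<Sum>e\<in>inc v. op0 ?p2 e)"
      using o0 box_subset by (intro sum_mono sum_mono2 finite_inc) auto
    also have "\<dots> = real ((2 * N + 1)\<^sup>2) * dens0 h2"
      unfolding dens0_def by (rule sum_box) (rule inv0)
    finally have 2: "2 * (\<Sum>e\<in>?E. op0 ?p2 e) \<le> real ((2 * N + 1)\<^sup>2) * dens0 h2" .
    have "2 * ((\<Sum>e\<in>?E. op0 ?p2 e) + real (card ?B) * ln q / (h2 - h1)) + \<Delta> * real (card ?B)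
      = 2 * (\<Sum>e\<in>?E. op0 ?p2 e) + C * real (card ?B)"
      by (simp add: C_def algebra_simps)
    then show ?thesis using 1 2 by linarith
  qed
  have cB: "real (card (boundary G (ind G (box N)))) \<le> 4 * real R * real (card D) * real (2 * N + 1)" if N: "R \<le> N" for N
  proof -
    have "box (N - R) \<subseteq> box N" unfolding box_def sq_def by (intro UN_mono) auto
    then have "card (box N - box (N - R)) = card (box N) - card (box (N - R))"
      using finite_box by (intro card_Diff_subset) auto
    moreover have "card (box (N - R)) \<le> card (box N)" using \<open>box (N - R) \<subseteq> box N\<close> finite_box by (intro card_mono) auto
    ultimately have "real (card (box N - box (N - R))) = real ((2 * N + 1)\<^sup>2 * card D) - real ((2 * (N - R) + 1)\<^sup>2 * card D)"
      by (simp only: card_box of_nat_diff)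
    also have "\<dots> = ((real (2 * N + 1))\<^sup>2 - (real (2 * N + 1) - 2 * real R)\<^sup>2) * real (card D)"
      using N by (simp add: of_nat_diff algebra_simps)
    also have "\<dots> \<le> (4 * real R * real (2 * N + 1)) * real (card D)"
      by (intro mult_right_mono) (auto simp: power2_eq_square algebra_simps)
    finally have "real (card (box N - box (N - R))) \<le> 4 * real R * real (card D) * real (2 * N + 1)" by (simp add: mult_ac)
    moreover have "card (boundary G (ind G (box N))) \<le> card (box N - box (N - R))"
      using R[OF N] finite_box by (intro card_mono) auto
    ultimately show ?thesis by linarith
  qed
  have "(\<lambda>N. C * (4 * real R * real (card D)) / real (2 * N + 1)) \<longlonglongrightarrow> 0" by real_asymp
  moreover have "\<forall>\<^sub>F N in sequentially. dens1 h1 - dens0 h2 \<le> C * (4 * real R * real (card D)) / real (2 * N + 1)"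
    using eventually_ge_at_top[of R]
  proof eventually_elim
    case (elim N)
    let ?M = "real (2 * N + 1)"
    have "C * real (card (boundary G (ind G (box N)))) \<le> C * (4 * real R * real (card D) * ?M)"
      using cB[OF elim] C by (rule mult_left_mono)
    then have "?M * ?M * (dens1 h1 - dens0 h2) \<le> ?M * (C * (4 * real R * real (card D)))"
      using main[of N] by (simp add: power2_eq_square algebra_simps)
    then have "?M * (dens1 h1 - dens0 h2) \<le> C * (4 * real R * real (card D))"
      by (simp only: mult.assoc) (simp add: mult_le_cancel_left_pos)
    then show ?case by (simp add: pos_le_divide_eq mult.commute)
  qed
  ultimately have "dens1 h1 - dens0 h2 \<le> 0" by (rule tendsto_lowerbound) simp
  then show ?thesis by simp
qed

lemma mono_dens0: "mono dens0"
proof (rule monoI)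
  fix h h' :: real assume "h \<le> h'"
  then show "dens0 h \<le> dens0 h'"
    unfolding dens0_def op0_def using logistic_bounds[of h] logistic_bounds[of h'] logistic_mono[of h h']
    by (intro sum_mono Pf_mono_p incr_mem) (auto simp: inc_def)
qed

text \<open>The free density is monotone, hence continuous at some point of every interval, and there it
  agrees with the wired density.\<close>

lemma ex_equal_marginals:
  assumes "a < b"
  shows "\<exists>h. a < h \<and> h < b \<and> (\<forall>e\<in>edges G. op1 (logistic h) e = op0 (logistic h) e)"
proof -
  have "uncountable ({a<..<b} - {h. \<not> isCont dens0 h})"
    using assms mono_ctble_discont[OF mono_dens0] by (intro uncountable_minus_countable) (auto simp: uncountable_open_interval)
  then have "{a<..<b} - {h. \<not> isCont dens0 h} \<noteq> {}" by (metis countable_empty)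
  then obtain h where h: "a < h" "h < b" "isCont dens0 h" by auto
  have lb: "0 \<le> logistic h" "logistic h \<le> 1" using logistic_bounds[of h] by auto
  have "(dens0 \<longlongrightarrow> dens0 h) (at_right h)"
    using h(3) unfolding isCont_def by (rule filterlim_at_split[THEN iffD1, THEN conjunct2])
  then have "dens1 h \<le> dens0 h"
    by (rule tendsto_lowerbound) (auto simp: eventually_at_right[OF h(2)] intro!: exI[of _ b] h dens_le)
  \<comment> \<open>The differences \<open>op1 - op0\<close> are nonnegative, while their sum over
    the edges at \<open>D\<close> is at most zero. So each of them vanishes, and translations carry
    the equality to all edges.\<close>
  have le: "op0 (logistic h) e \<le> op1 (logistic h) e" if "e \<in> edges G" for e
    unfolding op0_def op1_def using that lb by (intro Pf_le_Pw incr_mem) auto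
  have upper: "(\<Sum>v\<in>D. \<Sum>e\<in>inc v. op1 (logistic h) e - op0 (logistic h) e) \<le> 0"
    using \<open>dens1 h \<le> dens0 h\<close> by (simp add: dens1_def dens0_def sum_subtractf)
  have nn: "0 \<le> (\<Sum>e\<in>inc v. op1 (logistic h) e - op0 (logistic h) e)" for v
    using le by (intro sum_nonneg) (auto simp: inc_def)
  have "(\<Sum>v\<in>D. \<Sum>e\<in>inc v. op1 (logistic h) e - op0 (logistic h) e) = 0"
    by (rule antisym[OF upper], rule sum_nonneg, rule nn)
  then have z: "(\<Sum>e\<in>inc v. op1 (logistic h) e - op0 (logistic h) e) = 0" if "v \<in> D" for v
    using that nn D by (subst (asm) sum_nonneg_eq_0_iff) auto
  have eqD: "op1 (logistic h) e = op0 (logistic h) e" if "v \<in> D" "e \<in> inc v" for v e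
  proof -
    have "v \<in> V" using that D by auto
    then show ?thesis using z[OF that(1)] that(2) le finite_inc by (subst (asm) sum_nonneg_eq_0_iff) (auto simp: inc_def)
  qed
  have "op1 (logistic h) e = op0 (logistic h) e" if e: "e \<in> edges G" for e
  proof -
    obtain x y where xy: "e = {x, y}" "x \<in> V" using simple_edge[OF simple e] by blast
    obtain z u where u: "u \<in> D" "x = \<tau> z u" using xy(2) cover by auto
    have "e \<in> inc (\<tau> z u)" using e xy u by (simp add: inc_def)
    then obtain e0 where e0: "e0 \<in> inc u" "e = \<tau> z ` e0" unfolding inc_aut[OF \<tau>_aut] by auto
    then have "e0 \<in> edges G" by (simp add: inc_def)
    then show ?thesis using op_aut[OF \<tau>_aut lb, of e0 z] eqD[OF u(1) e0(1)] e0(2) by simp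
  qed
  then show ?thesis using h by blast
qed

text \<open>Equality of the two measures is available only at some parameters, so one is picked
  strictly between \<open>p_c\<close> and \<open>p\<close>. The wired arm bound passes to the free
  measure there and rises to \<open>p\<close> by monotonicity; the picked parameter is below
  \<open>1\<close> even if \<open>p = 1\<close>.\<close>

lemma supercritical_free_arm:
  assumes p: "p_c < p" "p \<le> 1"
  shows "\<exists>u\<in>V. \<exists>L>0. \<forall>m. L \<le> Pf p (edges (Lam u m)) (reach u m)"
proof -
  define p1 where "p1 = (2 * p_c + p) / 3"
  define p2 where "p2 = (p_c + 2 * p) / 3"
  have p12: "p_c < p1" "p1 < p2" "p2 < p" "0 < p1" "p2 < 1" using p p_c_bounds by (auto simp: p1_def p2_def)
  obtain a b where ab: "p1 = logistic a" "p2 = logistic b"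
    using logistic_surj[of p1] logistic_surj[of p2] p12 by auto
  have less: "a < b" using p12(2) logistic_mono[of b a] unfolding ab by (cases "a < b") auto
  obtain h where h: "a < h" "h < b" "\<And>e. e \<in> edges G \<Longrightarrow> op1 (logistic h) e = op0 (logistic h) e"
    using ex_equal_marginals[OF less] by blast
  let ?p = "logistic h"
  have lb: "0 \<le> ?p" "?p \<le> 1" "?p < 1" using logistic_bounds[of h] by auto
  have pp: "p_c < ?p" "?p \<le> p"
    using logistic_strict_mono[OF h(1)] logistic_strict_mono[OF h(2)] p12 unfolding ab by auto
  obtain u L where u: "u \<in> D" "0 < L" "\<And>n. L \<le> \<theta> ?p u n" using supercritical_arm[OF pp(1) lb(3)] by blast
  have uV: "u \<in> V" using u D by auto
  have "L \<le> Pf p (edges (Lam u m)) (reach u m)" for m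
  proof -
    have F: "finite (edges (Lam u m))" "edges (Lam u m) \<subseteq> edges G"
      using finite_edges[OF finite_Lam[OF uV]] edges_Lam_G by auto
    have "L \<le> Pw ?p (edges (Lam u m)) (reach u m)" by (rule Pw_reach_ge[OF lb(1,2) uV u(3)])
    also have "\<dots> \<le> Pf ?p (edges (Lam u m)) (reach u m)"
      using h(3) F by (intro Pw_le_Pf_if_marginals lb F incr_reach) auto
    also have "\<dots> \<le> Pf p (edges (Lam u m)) (reach u m)"
      using pp p lb by (intro Pf_mono_p F incr_reach) auto
    finally show ?thesis .
  qed
  then show ?thesis using u(2) uV by blast
qed

end

section \<open>Infinite clusters under the free measure\<close>

lemma cl_eq_conn: "cl {v} A = conn {} A `` {v}"
  by (simp add: cl_def conn_def)

context lf_graph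
begin

definition fin_cl :: "'a set set \<Rightarrow> bool" where
  "fin_cl A \<longleftrightarrow> (\<forall>v\<in>V. finite (cl {v} A))"

text \<open>After adding an edge, each cluster is covered by three old ones: its own and those of
  the two endpoints.\<close>

lemma fin_cl_insert: "fin_cl A \<Longrightarrow> x \<in> V \<Longrightarrow> y \<in> V \<Longrightarrow> fin_cl (insert {x, y} A)"
  unfolding fin_cl_def
proof
  fix v assume *: "\<forall>v\<in>V. finite (cl {v} A)" "x \<in> V" "y \<in> V" "v \<in> V"
  have "cl {v} (insert {x, y} A) \<subseteq> cl {v} A \<union> cl {x} A \<union> cl {y} A"
    unfolding cl_eq_conn conn_insert by auto
  then show "finite (cl {v} (insert {x, y} A))" using * by (auto intro: finite_subset)
qed

lemma fin_cl_union: "finite Y \<Longrightarrow> Y \<subseteq> edges G \<Longrightarrow> fin_cl A \<Longrightarrow> fin_cl (A \<union> Y)"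
proof (induction Y rule: finite_induct)
  case (insert e Y)
  obtain x y where "e = {x, y}" "x \<in> V" "y \<in> V" using simple_edge[OF simple] insert.prems by blast
  then show ?case using insert by (simp add: fin_cl_insert)
qed simp

lemma fin_cl_mono: "fin_cl A \<Longrightarrow> A' \<subseteq> A \<Longrightarrow> fin_cl A'"
  unfolding fin_cl_def by (intro ballI) (rule finite_subset[OF cl_mono], auto)

text \<open>Balls are finite, so a cluster is finite exactly when some distance is not reached. This
  writes the event in terms of local ones.\<close>

lemma fin_cl_iff:
  assumes A: "A \<subseteq> edges G" shows "fin_cl A \<longleftrightarrow> (\<forall>v\<in>V. \<exists>j. \<not> reach v j A)"
proof
  assume f: "fin_cl A"
  show "\<forall>v\<in>V. \<exists>j. \<not> reach v j A"
  proof
    fix v assume v: "v \<in> V"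
    then have "finite (d v ` cl {v} A)" using f by (simp add: fin_cl_def)
    then obtain m where m: "\<forall>i\<in>d v ` cl {v} A. i < m" unfolding finite_nat_set_iff_bounded by blast
    have "\<not> reach v m A"
    proof
      assume "reach v m A"
      then obtain y where y: "d v y = m" "(v, y) \<in> (adj (A \<inter> edges (Lam v m)))\<^sup>*" by (auto simp: reach_def)
      have "(v, y) \<in> (adj A)\<^sup>*" using y(2) rtrancl_mono[OF adj_mono[of "A \<inter> edges (Lam v m)" A]] by blast
      then have "y \<in> cl {v} A" by (auto simp: cl_def)
      then show False using m y(1) by auto
    qed
    then show "\<exists>j. \<not> reach v j A" by blast
  qed
next
  assume r: "\<forall>v\<in>V. \<exists>j. \<not> reach v j A"
  show "fin_cl A" unfolding fin_cl_def
  proof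
    fix v assume v: "v \<in> V"
    then obtain j where j: "\<not> reach v j A" using r by blast
    have "cl {v} A \<subseteq> bl v j"
    proof
      fix y assume "y \<in> cl {v} A"
      then have vy: "(v, y) \<in> (adj A)\<^sup>*" by (simp add: cl_def)
      then have "y \<in> V" using v by (induction rule: rtrancl_induct) (use A edge_verts in \<open>auto simp: adj_def\<close>)
      moreover have "d v y < j" using reachI[OF v A vy, of j] j by (meson not_le)
      ultimately show "y \<in> bl v j" by (simp add: bl_def)
    qed
    then show "finite (cl {v} A)" using finite_bl[OF v] by (rule finite_subset)
  qed
qed

context
  fixes p :: real assumes p: "0 \<le> p" "p \<le> 1"
begin

private abbreviation "\<mu> \<equiv> free_rc p q G"

text \<open>Conditionally on anything outside a finite graph, the free measure inside it dominates its own
  finite-volume version.\<close>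

lemma free_decoupling:
  assumes H: "subgraph H G" "finite_graph H" and R: "incr_on (edges H) (\<lambda>A. of_bool (R A) :: real)"
    and F: "finite F" "F \<subseteq> edges G - edges H"
  shows "measure \<mu> {\<omega> \<in> space \<mu>. \<not> R {e\<in>edges H. \<omega> e} \<and> Q {e\<in>F. \<omega> e}}
    \<le> (1 - gE p q H {} (\<lambda>A. of_bool (R A))) * measure \<mu> {\<omega> \<in> space \<mu>. Q {e\<in>F. \<omega> e}}"
proof -
  obtain K where K: "exhausts K G" "\<And>n. induced_subgraph (K n) G"
    using ex_induced_exhaustion[OF simple countable nonempty] by blast
  have HG: "verts H \<subseteq> V" "edges H \<subseteq> edges G" using H by (auto simp: subgraph_def)
  let ?F = "edges H \<union> F" and ?c = "1 - gE p q H {} (\<lambda>A. of_bool (R A))"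
  let ?Q = "\<lambda>B. \<not> R (B \<inter> edges H) \<and> Q (B \<inter> F)"
  have F': "finite ?F" "?F \<subseteq> edges G" "finite F" "F \<subseteq> edges G" using F HG finite_edges[OF H(2)] by auto
  have "\<forall>\<^sub>F n in sequentially. verts H \<subseteq> verts (K n) \<and> edges H \<subseteq> edges (K n)"
    using H HG finite_edges[OF H(2)] by (intro exhausts_eventually[OF K(1)]) (auto simp: finite_graph_def)
  then have "\<forall>\<^sub>F n in sequentially. gE p q (K n) {} (\<lambda>A. of_bool (?Q (A \<inter> ?F))) \<le> ?c * gE p q (K n) {} (\<lambda>A. of_bool (Q (A \<inter> F)))"
  proof eventually_elim
    case (elim n)
    let ?g = "\<lambda>Y. of_bool (Q (Y \<inter> F)) :: real" and ?f = "\<lambda>A. of_bool (R A) :: real"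
    have AF: "(A - edges H) \<inter> F = A \<inter> F" for A using F by auto
    have "gE p q H {} ?f * gE p q (K n) {} (\<lambda>A. ?g (A - edges H))
      \<le> gE p q (K n) {} (\<lambda>A. ?f (A \<inter> edges H) * ?g (A - edges H))"
      using H elim exhausts_finite[OF K(1)] p q R by (intro gE_volume_free) (auto simp: subgraph_def)
    moreover have "(\<lambda>A. of_bool (?Q (A \<inter> ?F))) = (\<lambda>A. ?g (A - edges H) - ?f (A \<inter> edges H) * ?g (A - edges H))"
    proof
      fix A
      have "A \<inter> ?F \<inter> edges H = A \<inter> edges H" "A \<inter> ?F \<inter> F = A \<inter> F" by auto
      then show "of_bool (?Q (A \<inter> ?F)) = ?g (A - edges H) - ?f (A \<inter> edges H) * ?g (A - edges H)"
        by (simp add: AF)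
    qed
    then have "gE p q (K n) {} (\<lambda>A. of_bool (?Q (A \<inter> ?F)))
      = gE p q (K n) {} (\<lambda>A. ?g (A - edges H)) - gE p q (K n) {} (\<lambda>A. ?f (A \<inter> edges H) * ?g (A - edges H))"
      unfolding gE_def rcE_def by (simp only: wE_diff)
    ultimately show ?case by (simp add: AF left_diff_distrib)
  qed
  moreover note tendsto_mult[OF tendsto_const[of ?c] Pf_limit[OF p K(1) F'(3,4), of Q]]
  ultimately have "Pf p ?F ?Q \<le> ?c * Pf p F Q"
    using Pf_limit[OF p K(1) F'(1,2), of ?Q] by (intro tendsto_le[OF sequentially_bot])
  moreover have "{e\<in>?F. \<omega> e} \<inter> edges H = {e\<in>edges H. \<omega> e}" "{e\<in>?F. \<omega> e} \<inter> F = {e\<in>F. \<omega> e}" for \<omega>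
    by auto
  ultimately show ?thesis by (simp add: Pf_def)
qed

text \<open>Closing the edges of \<open>Lam u k\<close> does not affect \<open>N\<close>, which is
  therefore a limit of local events outside this ball: in \<open>M n j\<close> no vertex of the
  finite set \<open>W n\<close> reaches distance \<open>j\<close> through outside edges. These
  increase in \<open>j\<close>, and their unions \<open>M' n\<close> decrease to \<open>N\<close>,
  so \<open>free_decoupling\<close> is carried through two limits.\<close>

lemma finite_clusters_decoupling:
  assumes u: "u \<in> V" and mk: "m \<le> k"
  defines "N \<equiv> {\<omega> \<in> space \<mu>. fin_cl (open_edges G \<omega>)}"
  shows "N \<in> sets \<mu>"
    and "measure \<mu> ({\<omega> \<in> space \<mu>. \<not> reach u m (open_edges G \<omega>)} \<inter> N)
      \<le> (1 - gE p q (Lam u k) {} (\<lambda>A. of_bool (reach u m A))) * measure \<mu> N"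
proof -
  interpret prob_space \<mu> by (rule free_rc_prob[OF p])
  have sp: "space \<mu> = space (CS (edges G))" by (rule sets_eq_imp_space_eq[OF free_rc_sets[OF p]])
  let ?E = "edges (Lam u k)" and ?c = "1 - gE p q (Lam u k) {} (\<lambda>A. of_bool (reach u m A))"
  have EG: "?E \<subseteq> edges G" "finite ?E" using edges_Lam_G finite_edges[OF finite_Lam[OF u]] by auto
  define W where "W n = from_nat_into V ` {..n}" for n :: nat
  have r: "range (from_nat_into V) = V" using countable nonempty by (intro range_from_nat_into) auto
  have W: "finite (W n)" "W n \<subseteq> V" for n unfolding W_def using r by auto
  have Wmono: "n \<le> n' \<Longrightarrow> W n \<subseteq> W n'" for n n' by (auto simp: W_def)
  have UW: "\<exists>n. v \<in> W n" if "v \<in> V" for v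
  proof -
    have "v \<in> range (from_nat_into V)" using that by (simp only: r)
    then show ?thesis by (auto simp: W_def)
  qed
  define X where "X = {\<omega> \<in> space \<mu>. \<not> reach u m (open_edges G \<omega>)}"
  define M where "M n j = {\<omega> \<in> space \<mu>. \<forall>v\<in>W n. \<not> reach v j (open_edges G \<omega> - ?E)}" for n j
  define F where "F n j = (\<Union>v\<in>W n. edges (Lam v j)) - ?E" for n j
  have F: "finite (F n j)" "F n j \<subseteq> edges G - ?E" for n j
    unfolding F_def using W finite_edges[OF finite_Lam] edges_Lam_G by blast+
  have Xeq: "reach u m (open_edges G \<omega>) \<longleftrightarrow> reach u m {e\<in>?E. \<omega> e}" for \<omega>
  proof -
    have "{e\<in>?E. \<omega> e} = open_edges G \<omega> \<inter> ?E" using EG by (auto simp: open_edges_def)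
    then show ?thesis using edges_Lam_mono[OF u u, of m k] mk by (simp add: reach_local)
  qed
  have Meq: "(\<forall>v\<in>W n. \<not> reach v j (open_edges G \<omega> - ?E)) \<longleftrightarrow> (\<forall>v\<in>W n. \<not> reach v j {e\<in>F n j. \<omega> e})" for n j \<omega>
  proof (intro ball_cong refl arg_cong[where f=Not])
    fix v assume v: "v \<in> W n"
    have "(open_edges G \<omega> - ?E) \<inter> edges (Lam v j) = {e\<in>F n j. \<omega> e} \<inter> edges (Lam v j)"
      using v edges_Lam_G by (auto simp: F_def open_edges_def)
    then show "reach v j (open_edges G \<omega> - ?E) \<longleftrightarrow> reach v j {e\<in>F n j. \<omega> e}"
      using reach_local[of v j "edges (Lam v j)" "open_edges G \<omega> - ?E"]
        reach_local[of v j "edges (Lam v j)" "{e\<in>F n j. \<omega> e}"] by simp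
  qed
  have Xs: "X \<in> events" unfolding X_def Xeq sp free_rc_sets[OF p] using EG by (intro measurable_local)
  have Ms: "M n j \<in> events" for n j
    unfolding M_def Meq sp free_rc_sets[OF p] using F[of n j] by (intro measurable_local) auto
  have step: "prob (X \<inter> M n j) \<le> ?c * prob (M n j)" for n j
  proof -
    have "X \<inter> M n j = {\<omega> \<in> space \<mu>. \<not> reach u m {e\<in>?E. \<omega> e} \<and> (\<forall>v\<in>W n. \<not> reach v j {e\<in>F n j. \<omega> e})}"
      unfolding X_def M_def Meq Xeq by auto
    then have eq: "prob (X \<inter> M n j) = prob \<dots>" by (rule arg_cong)
    show ?thesis
      by (subst eq, unfold M_def Meq)
        (rule free_decoupling[OF induced_is_subgraph[OF induced_Lam] finite_Lam[OF u] incr_reach F(1) F(2)])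
  qed
  define M' where "M' n = (\<Union>j. M n j)" for n
  have inc: "incseq (M n)" for n
    unfolding incseq_def M_def using reach_antimono W(2)[of n] by blast
  have step': "prob (X \<inter> M' n) \<le> ?c * prob (M' n)" for n
  proof -
    have 1: "(\<lambda>j. prob (M n j)) \<longlonglongrightarrow> prob (M' n)"
      unfolding M'_def using Ms inc by (intro finite_Lim_measure_incseq) auto
    have "incseq (\<lambda>j. X \<inter> M n j)" using inc[of n] unfolding incseq_def by blast
    then have "(\<lambda>j. prob (X \<inter> M n j)) \<longlonglongrightarrow> prob (\<Union>j. X \<inter> M n j)"
      using Ms Xs by (intro finite_Lim_measure_incseq) auto
    then have 2: "(\<lambda>j. prob (X \<inter> M n j)) \<longlonglongrightarrow> prob (X \<inter> M' n)" by (simp add: M'_def)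
    show ?thesis using LIMSEQ_le[OF 2 tendsto_mult[OF tendsto_const[of ?c] 1]] step by blast
  qed
  have M'eq: "M' n = {\<omega> \<in> space \<mu>. \<forall>v\<in>W n. \<exists>j. \<not> reach v j (open_edges G \<omega> - ?E)}" for n
  proof (intro equalityI subsetI)
    fix \<omega> assume w: "\<omega> \<in> {\<omega> \<in> space \<mu>. \<forall>v\<in>W n. \<exists>j. \<not> reach v j (open_edges G \<omega> - ?E)}"
    then have "\<forall>v\<in>W n. \<exists>j. \<not> reach v j (open_edges G \<omega> - ?E)" by simp
    then obtain J where J: "\<And>v. v \<in> W n \<Longrightarrow> \<not> reach v (J v) (open_edges G \<omega> - ?E)" by metis
    \<comment> \<open>The sum over the finite set \<open>W n\<close> serves as a common radius above
      each \<open>J v\<close>.\<close>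
    have "\<omega> \<in> M n (\<Sum>v\<in>W n. J v)"
      unfolding M_def
    proof (intro CollectI conjI ballI notI)
      fix v assume v: "v \<in> W n" and r: "reach v (\<Sum>v\<in>W n. J v) (open_edges G \<omega> - ?E)"
      have "J v \<le> (\<Sum>v\<in>W n. J v)" using v W(1) by (intro member_le_sum) auto
      then have "reach v (J v) (open_edges G \<omega> - ?E)" using reach_antimono[OF _ r] v W(2) by blast
      then show False using J[OF v] by simp
    qed (use w in simp)
    then show "\<omega> \<in> M' n" by (auto simp: M'_def)
  qed (auto simp: M'_def M_def)
  have dec: "decseq M'" unfolding decseq_def M'eq using Wmono by blast
  have Neq: "(\<Inter>n. M' n) = N"
  proof -
    have "(\<Inter>n. M' n) = {\<omega> \<in> space \<mu>. \<forall>v\<in>V. \<exists>j. \<not> reach v j (open_edges G \<omega> - ?E)}"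
    proof (intro equalityI subsetI)
      fix \<omega> assume \<omega>: "\<omega> \<in> (\<Inter>n. M' n)"
      have "\<exists>j. \<not> reach v j (open_edges G \<omega> - ?E)" if "v \<in> V" for v
      proof -
        obtain n where "v \<in> W n" using UW[OF \<open>v \<in> V\<close>] by blast
        moreover have "\<omega> \<in> M' n" using \<omega> by blast
        ultimately show ?thesis unfolding M'eq by blast
      qed
      moreover have "\<omega> \<in> space \<mu>" using \<omega> unfolding M'eq by blast
      ultimately show "\<omega> \<in> {\<omega> \<in> space \<mu>. \<forall>v\<in>V. \<exists>j. \<not> reach v j (open_edges G \<omega> - ?E)}" by simp
    next
      fix \<omega> assume \<omega>: "\<omega> \<in> {\<omega> \<in> space \<mu>. \<forall>v\<in>V. \<exists>j. \<not> reach v j (open_edges G \<omega> - ?E)}"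
      show "\<omega> \<in> (\<Inter>n. M' n)"
      proof
        fix n
        show "\<omega> \<in> M' n" using \<omega> subsetD[OF W(2)[of n]] unfolding M'eq by simp
      qed
    qed
    also have "\<dots> = N"
      unfolding N_def
    proof (intro Collect_cong conj_cong refl)
      fix \<omega>
      have o: "open_edges G \<omega> \<subseteq> edges G" "open_edges G \<omega> - ?E \<subseteq> edges G" by (auto simp: open_edges_def)
      have "open_edges G \<omega> \<subseteq> (open_edges G \<omega> - ?E) \<union> ?E" "open_edges G \<omega> - ?E \<subseteq> open_edges G \<omega>" by auto
      then have "fin_cl (open_edges G \<omega> - ?E) \<longleftrightarrow> fin_cl (open_edges G \<omega>)"
        using fin_cl_mono[OF fin_cl_union[OF EG(2,1)]] fin_cl_mono[of "open_edges G \<omega>"] by meson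
      then show "(\<forall>v\<in>V. \<exists>j. \<not> reach v j (open_edges G \<omega> - ?E)) \<longleftrightarrow> fin_cl (open_edges G \<omega>)"
        using fin_cl_iff[OF o(2)] by simp
    qed
    finally show ?thesis .
  qed
  have M's: "M' n \<in> events" for n unfolding M'_def using Ms by auto
  show "N \<in> events" unfolding Neq[symmetric] using M's by auto
  have 1: "(\<lambda>n. prob (M' n)) \<longlonglongrightarrow> prob N"
    unfolding Neq[symmetric] using M's dec by (intro finite_Lim_measure_decseq) auto
  have "(\<lambda>n. prob (X \<inter> M' n)) \<longlonglongrightarrow> prob (\<Inter>n. X \<inter> M' n)"
    using M's Xs dec by (intro finite_Lim_measure_decseq) (auto simp: decseq_def)
  then have 2: "(\<lambda>n. prob (X \<inter> M' n)) \<longlonglongrightarrow> prob (X \<inter> N)" unfolding Neq[symmetric] by simp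
  have "prob (X \<inter> N) \<le> ?c * prob N"
    using LIMSEQ_le[OF 2 tendsto_mult[OF tendsto_const[of ?c] 1]] step' by blast
  then show "measure \<mu> ({\<omega> \<in> space \<mu>. \<not> reach u m (open_edges G \<omega>)} \<inter> N) \<le> ?c * measure \<mu> N"
    by (simp add: X_def)
qed

text \<open>The decoupling bound contains an arm probability in a finite free ball
  \<open>Lam u k\<close>. Letting \<open>k\<close> grow with \<open>m\<close> fixed turns it into
  the infinite-volume probability, which is at least \<open>L\<close>; only then does
  \<open>m\<close> grow.\<close>

theorem infinite_cluster_if_arms:
  assumes u: "u \<in> V" and L: "0 < L" "\<And>m. L \<le> Pf p (edges (Lam u m)) (reach u m)"
  shows "AE \<omega> in \<mu>. \<exists>C\<in>clusters G \<omega>. infinite C"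
proof -
  interpret prob_space \<mu> by (rule free_rc_prob[OF p])
  have sp: "space \<mu> = space (CS (edges G))" by (rule sets_eq_imp_space_eq[OF free_rc_sets[OF p]])
  define N where "N = {\<omega> \<in> space \<mu>. fin_cl (open_edges G \<omega>)}"
  define X where "X m = {\<omega> \<in> space \<mu>. \<not> reach u m (open_edges G \<omega>)}" for m
  have Ns: "N \<in> events" unfolding N_def by (rule finite_clusters_decoupling(1)[OF u order_refl[of 0]])
  have bound: "prob (X m \<inter> N) \<le> (1 - L) * prob N" for m
  proof -
    have "exhausts (Lam u) G" using exhausts_Lam[OF u, of "\<lambda>n. n"] by (simp add: strict_mono_def)
    then have "(\<lambda>k. gE p q (Lam u k) {} (\<lambda>A. of_bool (reach u m (A \<inter> edges (Lam u m))))) \<longlonglongrightarrow> Pf p (edges (Lam u m)) (reach u m)"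
      using finite_edges[OF finite_Lam[OF u]] edges_Lam_G by (intro Pf_limit p)
    then have "(\<lambda>k. (1 - gE p q (Lam u k) {} (\<lambda>A. of_bool (reach u m A))) * prob N)
        \<longlonglongrightarrow> (1 - Pf p (edges (Lam u m)) (reach u m)) * prob N"
      by (intro tendsto_mult tendsto_diff tendsto_const) (simp add: reach_local)
    moreover have "\<forall>\<^sub>F k in sequentially. prob (X m \<inter> N) \<le> (1 - gE p q (Lam u k) {} (\<lambda>A. of_bool (reach u m A))) * prob N"
      using eventually_ge_at_top[of m]
    proof eventually_elim
      case (elim k)
      show ?case using finite_clusters_decoupling(2)[OF u elim] by (simp add: X_def N_def)
    qed
    ultimately have "prob (X m \<inter> N) \<le> (1 - Pf p (edges (Lam u m)) (reach u m)) * prob N"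
      by (rule tendsto_lowerbound) simp
    also have "\<dots> \<le> (1 - L) * prob N" using L(2)[of m] by (intro mult_right_mono) auto
    finally show ?thesis .
  qed
  have Xs: "X m \<in> events" for m
  proof -
    have F: "finite (edges (Lam u m))" "edges (Lam u m) \<subseteq> edges G" using finite_edges[OF finite_Lam[OF u]] edges_Lam_G by auto
    have eq: "reach u m (open_edges G \<omega>) \<longleftrightarrow> reach u m {e\<in>edges (Lam u m). \<omega> e}" for \<omega>
    proof -
      have "{e\<in>edges (Lam u m). \<omega> e} = open_edges G \<omega> \<inter> edges (Lam u m)" using F by (auto simp: open_edges_def)
      then show ?thesis by (simp add: reach_local)
    qed
    show ?thesis unfolding X_def sp free_rc_sets[OF p] eq
      by (rule measurable_local[OF F, of "\<lambda>B. \<not> reach u m B"])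
  qed
  have inc: "incseq (\<lambda>m. X m \<inter> N)" unfolding incseq_def X_def using reach_antimono[OF u] by blast
  have "(\<lambda>m. prob (X m \<inter> N)) \<longlonglongrightarrow> prob (\<Union>m. X m \<inter> N)"
    using Xs Ns inc by (intro finite_Lim_measure_incseq) auto
  also have "(\<Union>m. X m \<inter> N) = N"
  proof -
    have "\<exists>m. \<omega> \<in> X m" if "\<omega> \<in> N" for \<omega>
    proof -
      have "open_edges G \<omega> \<subseteq> edges G" by (auto simp: open_edges_def)
      then have "\<exists>j. \<not> reach u j (open_edges G \<omega>)" using that u fin_cl_iff by (auto simp: N_def)
      then show ?thesis using that by (auto simp: X_def N_def)
    qed
    then show ?thesis by auto
  qed
  finally have "prob N \<le> (1 - L) * prob N"
    by (rule LIMSEQ_le_const2) (use bound in auto)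
  then have "L * prob N \<le> 0" by (simp add: algebra_simps)
  then have "prob N = 0" using L(1) measure_nonneg[of \<mu> N] by (simp add: mult_le_0_iff)
  then have null: "N \<in> null_sets \<mu>" using Ns by (simp add: null_sets_def emeasure_eq_measure)
  show ?thesis
  proof (rule AE_I'[OF null], rule subsetI)
    fix \<omega> assume \<omega>: "\<omega> \<in> {\<omega> \<in> space \<mu>. \<not> (\<exists>C\<in>clusters G \<omega>. infinite C)}"
    have "finite (cl {v} (open_edges G \<omega>))" if "v \<in> V" for v
    proof -
      have "cl {v} (open_edges G \<omega>) \<in> clusters G \<omega>"
        unfolding clusters_eq_image[OF simple empty_subsetI] cl_eq_conn using that by auto
      then show ?thesis using \<omega> by auto
    qed
    then show "\<omega> \<in> N" using \<omega> by (simp add: N_def fin_cl_def)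
  qed
qed

end

end

theorem (in periodic_graph) supercritical:
  assumes "p_c < p" "p \<le> 1"
  shows "AE \<omega> in free_rc p q G. \<exists>C\<in>clusters G \<omega>. infinite C"
proof -
  obtain u L where "u \<in> V" "0 < L" "\<And>m. L \<le> Pf p (edges (Lam u m)) (reach u m)"
    using supercritical_free_arm[OF assms] by blast
  then show ?thesis using assms p_c_bounds by (intro infinite_cluster_if_arms[of p u L]) auto
qed

section \<open>Slabs\<close>

text \<open>Invariance under \<open>f 1\<close> gives invariance under its inverse
  \<open>f (-1)\<close>, and induction in both directions reaches every integer.\<close>

lemma int_action_invariant:
  fixes f :: "int \<Rightarrow> 'b \<Rightarrow> 'b"
  assumes add: "\<And>i j x. f i (f j x) = f (i + j) x" and zero: "\<And>x. f 0 x = x" and one: "f 1 ` A = A"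
  shows "f i ` A = A"
proof -
  have "f (-1) ` f 1 ` A = A" by (simp add: image_image add zero)
  then have neg: "f (-1) ` A = A" unfolding one .
  show ?thesis
  proof (induction i rule: int_induct[where k = 0])
    case base then show ?case by (simp add: zero)
  next
    case (step1 i)
    have "f 1 ` f i ` A = f (i + 1) ` A" by (simp add: image_image add add.commute)
    then show ?case using step1 one by simp
  next
    case (step2 i)
    have "f (-1) ` f i ` A = f (i - 1) ` A" by (simp add: image_image add)
    then show ?case using step2 neg by simp
  qed
qed

section \<open>Integer translations of the lattice and of the slab\<close>

definition plane_shift :: "int \<times> int \<Rightarrow> real \<times> real \<Rightarrow> real \<times> real" where
  "plane_shift z v = (fst v + of_int (fst z), snd v + of_int (snd z))"

lemma plane_shift_add: "plane_shift z (plane_shift z' v) = plane_shift (z + z') v"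
  by (simp add: plane_shift_def)

lemma plane_shift_zero [simp]: "plane_shift 0 v = v" "plane_shift (0, 0) v = v"
  by (simp_all add: plane_shift_def)

lemma lattice_shift:
  assumes "planar_lattice G \<gamma>"
  shows "plane_shift z ` verts G = verts G" "(`) (plane_shift z) ` edges G = edges G"
proof -
  have inv: "invariant_under (\<lambda>(x, y). (x + 1, y)) G \<gamma>" "invariant_under (\<lambda>(x, y). (x, y + 1)) G \<gamma>"
    using assms by (simp_all add: planar_lattice_def)
  have e: "(\<lambda>(x, y). (x + 1, y)) = plane_shift (1, 0)" "(\<lambda>(x, y). (x, y + 1)) = plane_shift (0, 1)"
    by (auto simp: plane_shift_def)
  note inv' = inv[unfolded invariant_under_def e]
  have v: "plane_shift (i, 0) ` verts G = verts G" "plane_shift (0, i) ` verts G = verts G" for i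
    by (rule int_action_invariant[where f = "\<lambda>i. plane_shift (i, 0)"];
        use inv' in \<open>simp add: plane_shift_add\<close>)
      (rule int_action_invariant[where f = "\<lambda>i. plane_shift (0, i)"];
        use inv' in \<open>simp add: plane_shift_add\<close>)
  have d: "(`) (plane_shift (i, 0)) ` edges G = edges G" "(`) (plane_shift (0, i)) ` edges G = edges G" for i
    by (rule int_action_invariant[where f = "\<lambda>i. (`) (plane_shift (i, 0))"];
        use inv' in \<open>simp add: plane_shift_add image_image\<close>)
      (rule int_action_invariant[where f = "\<lambda>i. (`) (plane_shift (0, i))"];
        use inv' in \<open>simp add: plane_shift_add image_image\<close>)
  have z: "plane_shift z x = plane_shift (fst z, 0) (plane_shift (0, snd z) x)" for x
    by (simp add: plane_shift_add)
  have "plane_shift z ` verts G = plane_shift (fst z, 0) ` plane_shift (0, snd z) ` verts G"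
    unfolding image_image by (simp only: z[symmetric])
  then show "plane_shift z ` verts G = verts G" by (simp only: v)
  have "(`) (plane_shift z) ` edges G = (`) (plane_shift (fst z, 0)) ` (`) (plane_shift (0, snd z)) ` edges G"
    unfolding image_image by (simp only: z[symmetric])
  then show "(`) (plane_shift z) ` edges G = edges G" by (simp only: d)
qed

lemma slab_edge_cases:
  assumes "e \<in> edges (slab G S)"
  obtains u v v' where "e = {(u, v), (u, v')}" "u \<in> verts G" "{v, v'} \<in> edges S"
  | u u' v where "e = {(u, v), (u', v)}" "{u, u'} \<in> edges G" "v \<in> verts S"
  using assms by (auto simp: slab_def)

lemma slab_verts [simp]: "verts (slab G S) = verts G \<times> verts S"
  by (simp add: slab_def)

lemma slab_vertical: "u \<in> verts G \<Longrightarrow> {v, v'} \<in> edges S \<Longrightarrow> {(u, v), (u, v')} \<in> edges (slab G S)"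
  by (auto simp: slab_def)

lemma slab_horizontal: "{u, u'} \<in> edges G \<Longrightarrow> v \<in> verts S \<Longrightarrow> {(u, v), (u', v)} \<in> edges (slab G S)"
  by (auto simp: slab_def)

lemma simple_slab:
  assumes "simple_graph G" "simple_graph S" shows "simple_graph (slab G S)"
  unfolding simple_graph_def
proof
  fix e assume "e \<in> edges (slab G S)"
  then show "e \<subseteq> verts (slab G S) \<and> card e = 2"
  proof (cases rule: slab_edge_cases)
    case (1 u v v')
    then have "{v, v'} \<subseteq> verts S" "card {v, v'} = 2"
      using bspec[OF assms(2)[unfolded simple_graph_def], of "{v, v'}"] by simp_all
    then show ?thesis using 1 by (auto simp: card_insert_if split: if_splits)
  next
    case (2 u u' v)
    then have "{u, u'} \<subseteq> verts G" "card {u, u'} = 2"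
      using bspec[OF assms(1)[unfolded simple_graph_def], of "{u, u'}"] by simp_all
    then show ?thesis using 2 by (auto simp: card_insert_if split: if_splits)
  qed
qed

lemma connected_slab:
  assumes "connected_graph G" "connected_graph S" shows "connected_graph (slab G S)"
proof -
  let ?A = "adj (edges (slab G S))"
  have 1: "((u, v), (u', v)) \<in> ?A\<^sup>*" if "(u, u') \<in> (adj (edges G))\<^sup>*" "v \<in> verts S" for u u' v
    using that(1)
  proof (induction rule: rtrancl_induct)
    case (step a b)
    then have "((a, v), (b, v)) \<in> ?A" using that(2) by (simp add: adj_def slab_horizontal)
    then show ?case using step.IH by (rule rtrancl_into_rtrancl[rotated])
  qed simp
  have 2: "((u, v), (u, v')) \<in> ?A\<^sup>*" if "(v, v') \<in> (adj (edges S))\<^sup>*" "u \<in> verts G" for u v v'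
    using that(1)
  proof (induction rule: rtrancl_induct)
    case (step a b)
    then have "((u, a), (u, b)) \<in> ?A" using that(2) by (simp add: adj_def slab_vertical)
    then show ?case using step.IH by (rule rtrancl_into_rtrancl[rotated])
  qed simp
  have "((u, v), (u', v')) \<in> ?A\<^sup>*" if "u \<in> verts G" "u' \<in> verts G" "v \<in> verts S" "v' \<in> verts S" for u u' v v'
    using rtrancl_trans[OF 1 2] that assms unfolding connected_graph_def by blast
  moreover have "verts (slab G S) \<noteq> {}" using assms by (auto simp: connected_graph_def)
  ultimately show ?thesis unfolding connected_graph_def by auto
qed

lemma locally_finite_slab:
  assumes "simple_graph G" "locally_finite G" "simple_graph S" "finite (verts S)" shows "locally_finite (slab G S)"
  unfolding locally_finite_def
proof
  fix x assume "x \<in> verts (slab G S)"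
  then obtain u v where x: "x = (u, v)" "u \<in> verts G" "v \<in> verts S" by auto
  let ?N = "{e\<in>edges G. u \<in> e}"
  have "finite e" if "e \<in> edges G" for e
    using that assms(1) unfolding simple_graph_def by (metis card.infinite zero_neq_numeral)
  then have fin: "finite (\<Union>?N)" using assms(2) x by (intro finite_Union) (auto simp: locally_finite_def)
  have "{e\<in>edges (slab G S). x \<in> e} \<subseteq> (\<lambda>v'. {(u, v), (u, v')}) ` verts S \<union> (\<lambda>u'. {(u, v), (u', v)}) ` \<Union>?N"
  proof
    fix e assume "e \<in> {e\<in>edges (slab G S). x \<in> e}"
    then have e: "e \<in> edges (slab G S)" "(u, v) \<in> e" using x by auto
    from e(1) show "e \<in> (\<lambda>v'. {(u, v), (u, v')}) ` verts S \<union> (\<lambda>u'. {(u, v), (u', v)}) ` \<Union>?N"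
    proof (cases rule: slab_edge_cases)
      case (1 a b b')
      then have "{b, b'} \<subseteq> verts S" using bspec[OF assms(3)[unfolded simple_graph_def], of "{b, b'}"] by simp
      then show ?thesis using 1 e(2) by (auto simp: insert_commute)
    next
      case (2 a a' b)
      then show ?thesis using e(2) by (auto simp: insert_commute)
    qed
  qed
  then show "finite {e\<in>edges (slab G S). x \<in> e}" using fin assms(4) by (auto intro: finite_subset)
qed

definition slab_shift :: "int \<times> int \<Rightarrow> (real \<times> real) \<times> 's \<Rightarrow> (real \<times> real) \<times> 's" where
  "slab_shift z x = (plane_shift z (fst x), snd x)"

lemma slab_shift_bij: "bij (slab_shift z)"
proof (rule bij_betw_byWitness[where f' = "slab_shift (- z)"])
qed (auto simp: slab_shift_def plane_shift_add)

lemma slab_shift_edges: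
  assumes G: "planar_lattice G \<gamma>"
  shows "(`) (slab_shift z) ` edges (slab G S) = edges (slab G S)"
proof -
  have sub: "slab_shift z ` e \<in> edges (slab G S)" if "e \<in> edges (slab G S)" for e z
    using that
  proof (cases rule: slab_edge_cases)
    case (1 u v v')
    have "plane_shift z u \<in> verts G" using lattice_shift(1)[OF G, of z] 1(2) by blast
    then show ?thesis using 1 by (simp add: slab_shift_def slab_vertical)
  next
    case (2 u u' v)
    have "plane_shift z ` {u, u'} \<in> edges G" using lattice_shift(2)[OF G, of z] 2(2) by blast
    then show ?thesis using 2 by (simp add: slab_shift_def slab_horizontal)
  qed
  show ?thesis
  proof (intro equalityI subsetI)
    fix e assume e: "e \<in> edges (slab G S)"
    \<comment> \<open>Preservation of edges is known for all shifts, so the opposite shift supplies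
      a preimage.\<close>
    have "e = slab_shift z ` slab_shift (- z) ` e" by (simp add: image_image slab_shift_def plane_shift_add)
    then show "e \<in> (`) (slab_shift z) ` edges (slab G S)" using sub[OF e] by blast
  next
    fix e assume "e \<in> (`) (slab_shift z) ` edges (slab G S)"
    then show "e \<in> edges (slab G S)" using sub by blast
  qed
qed

text \<open>The square is half-open so that each vertex lies in exactly one integer
  translate.\<close>

definition slab_cell :: "(real \<times> real) graph \<Rightarrow> 's graph \<Rightarrow> ((real \<times> real) \<times> 's) set" where
  "slab_cell G S = (verts G \<inter> {v. 0 \<le> fst v \<and> fst v < 1 \<and> 0 \<le> snd v \<and> snd v < 1}) \<times> verts S"

text \<open>The integer translations of the lattice act on the slab through its first component.
  Properness of the embedding makes the cell finite, and the cover by countably many translates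
  makes the vertex set countable.\<close>

lemma slab_periodic:
  assumes G: "planar_lattice G \<gamma>" and S: "finite_graph S" "connected_graph S" and q: "1 \<le> q"
  shows "periodic_graph (slab G S) q slab_shift (slab_cell G S)"
proof -
  have sG: "simple_graph G" and cG: "connected_graph G" and lG: "locally_finite G" and pG: "properly_embedded G \<gamma>"
    using G by (auto simp: planar_lattice_def)
  have sS: "simple_graph S" "finite (verts S)" using S by (auto simp: finite_graph_def)
  let ?D = "slab_cell G S"
  have cover: "verts (slab G S) = (\<Union>z. slab_shift z ` ?D)"
  proof (intro equalityI subsetI)
    fix x assume "x \<in> verts (slab G S)"
    then obtain a b s where x: "x = ((a, b), s)" "(a, b) \<in> verts G" "s \<in> verts S" by (cases x) auto
    let ?z = "(\<lfloor>a\<rfloor>, \<lfloor>b\<rfloor>)"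
    have "plane_shift (- ?z) (a, b) \<in> verts G" using lattice_shift(1)[OF G, of "- ?z"] x(2) by blast
    then have "((a - of_int \<lfloor>a\<rfloor>, b - of_int \<lfloor>b\<rfloor>), s) \<in> ?D"
      using x(3) by (auto simp: slab_cell_def plane_shift_def) linarith+
    moreover have "x = slab_shift ?z ((a - of_int \<lfloor>a\<rfloor>, b - of_int \<lfloor>b\<rfloor>), s)"
      by (simp add: x slab_shift_def plane_shift_def)
    ultimately show "x \<in> (\<Union>z. slab_shift z ` ?D)" by blast
  next
    fix x assume "x \<in> (\<Union>z. slab_shift z ` ?D)"
    then obtain z v s where x: "x = (plane_shift z v, s)" "v \<in> verts G" "s \<in> verts S"
      by (auto simp: slab_cell_def slab_shift_def)
    have "plane_shift z v \<in> verts G" using lattice_shift(1)[OF G, of z] x(2) by blast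
    then show "x \<in> verts (slab G S)" using x by simp
  qed
  have finD: "finite ?D"
  proof -
    have "\<forall>K. compact K \<longrightarrow> finite (verts G \<inter> K)" using pG by (simp add: properly_embedded_def)
    then have "finite (verts G \<inter> cbox (0, 0) (1, 1))" using compact_cbox by simp
    then have "finite (verts G \<inter> {v. 0 \<le> fst v \<and> fst v < 1 \<and> 0 \<le> snd v \<and> snd v < 1})"
      by (rule finite_subset[rotated]) (auto simp: cbox_Pair_eq)
    then show ?thesis unfolding slab_cell_def using sS by simp
  qed
  have conn: "connected_graph (slab G S)" by (rule connected_slab[OF cG S(2)])
  then have ne: "verts (slab G S) \<noteq> {}" by (simp add: connected_graph_def)
  interpret lf_graph "slab G S" q
  proof
    show "simple_graph (slab G S)" by (rule simple_slab[OF sG sS(1)])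
    have "countable (\<Union>z :: int \<times> int. slab_shift z ` ?D)"
      using finD by (intro countable_UN) (auto intro: countable_finite)
    then show "countable (verts (slab G S))" unfolding cover .
    show "locally_finite (slab G S)" by (rule locally_finite_slab[OF sG lG sS])
  qed (fact ne q conn)+
  show ?thesis
  proof
    fix z
    have "slab_shift z ` verts (slab G S) = plane_shift z ` verts G \<times> verts S"
      unfolding slab_verts by (auto simp: slab_shift_def image_iff)
    then show "aut (slab_shift z)"
      unfolding aut_def using slab_shift_bij[of z] slab_shift_edges[OF G, of z S] lattice_shift(1)[OF G, of z] by simp
  next
    show "slab_shift z (slab_shift z' x) = slab_shift (z + z') x" for z z' and x :: "(real \<times> real) \<times> 'a"
      by (simp add: slab_shift_def plane_shift_add)
    show "?D \<subseteq> verts (slab G S)" by (auto simp: slab_cell_def)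
    show "?D \<noteq> {}" using cover ne by auto
  next
    fix x y z z' assume xy: "x \<in> ?D" "y \<in> ?D" "slab_shift z x = slab_shift z' y"
    then have "fst (fst x) + of_int (fst z) = fst (fst y) + of_int (fst z')"
      "snd (fst x) + of_int (snd z) = snd (fst y) + of_int (snd z')"
      by (auto simp: slab_shift_def plane_shift_def)
    moreover have "0 \<le> fst (fst x)" "fst (fst x) < 1" "0 \<le> fst (fst y)" "fst (fst y) < 1"
      "0 \<le> snd (fst x)" "snd (fst x) < 1" "0 \<le> snd (fst y)" "snd (fst y) < 1"
      using xy by (auto simp: slab_cell_def)
    ultimately have "fst z = fst z'" "snd z = snd z'" by linarith+
    then show "z = z'" by (rule prod_eqI)
  qed (fact finD cover)+
qed

theorem theorem1p1:
  fixes G :: "(real \<times> real) graph"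
    and \<gamma> :: "(real \<times> real) set \<Rightarrow> (real \<times> real) set"
    and S :: "'s graph"
    and q :: real
  assumes "planar_lattice G \<gamma>"
    and "finite_graph S" and "connected_graph S"
    and "q \<ge> 1"
  shows "\<exists>pc\<in>{0..1::real}.
    (\<forall>p\<in>{0..1}. p < pc \<longrightarrow>
       (\<exists>c>0. \<forall>x\<in>verts (slab G S). \<forall>y\<in>verts (slab G S).
          measure (wired_rc p q (slab G S))
              {\<omega> \<in> space (wired_rc p q (slab G S)). joined (slab G S) \<omega> x y}
            \<le> exp (- c * real (graph_dist (slab G S) x y)))) \<and>
    (\<forall>p\<in>{0..1}. p > pc \<longrightarrow>
       (AE \<omega> in free_rc p q (slab G S). \<exists>C\<in>clusters (slab G S) \<omega>. infinite C))"
proof -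
  interpret periodic_graph "slab G S" q slab_shift "slab_cell G S"
    by (rule slab_periodic) (use assms in auto)
  show ?thesis
  proof (intro bexI[of _ p_c] conjI ballI impI)
    show "p_c \<in> {0..1}" using p_c_bounds by simp
  next
    fix p :: real assume "p \<in> {0..1}" "p < p_c"
    then show "\<exists>c>0. \<forall>x\<in>verts (slab G S). \<forall>y\<in>verts (slab G S).
        measure (wired_rc p q (slab G S))
            {\<omega> \<in> space (wired_rc p q (slab G S)). joined (slab G S) \<omega> x y}
          \<le> exp (- c * real (graph_dist (slab G S) x y))"
      by (intro subcritical) auto
  next
    fix p :: real assume "p \<in> {0..1}" "p_c < p"
    then show "AE \<omega> in free_rc p q (slab G S). \<exists>C\<in>clusters (slab G S) \<omega>. infinite C"
      by (intro supercritical) auto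
  qed
qed

end
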